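(* For any directed graph $G=(V,E)$ with $n$ vertices and any set $\mathcal{P}\subseteq V\times V$ of vertex pairs, there exists a 2-fault-tolerant reachability subgraph of $G$ for $\mathcal{P}$ having at most $O(n^{4/3}|\mathcal{P}|^{1/3})$ edges. Furthermore, such a subgraph can be found in polynomial time.
   Context: A subgraph $H$ of $G$ is a $k$-fault-tolerant reachability subgraph ($k$-FTRS) of $G$ for $\mathcal{P}$ if for every pair $(s,t)\in\mathcal{P}$ and every set $F\subseteq E$ of at most $k$ edges, $t$ is reachable from $s$ in $G\setminus F$ if and only if $t$ is reachable from $s$ in $H\setminus F$, where $X\setminus F$ denotes deletion of the edges of $F$. *)

theory Defs
  imports
    "Graph_Theory.Graph_Theory"
    "HOL-Library.Log_Nat"
    "HOL-Computational_Algebra.Polynomial"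
    Complex_Main
begin

section \<open>Fault-tolerant reachability subgraphs\<close>

text \<open>
  A directed graph \<open>G = (V, E)\<close> with \<open>E \<subseteq> V \<times> V\<close> is a \<^typ>\<open>'a pair_pre_digraph\<close>;
  the coercion \<^const>\<open>with_proj\<close> makes the general digraph notions
  \<^const>\<open>reachable\<close> and \<^const>\<open>subgraph\<close> available for it.
\<close>

definition del_arcs :: "'a pair_pre_digraph \<Rightarrow> ('a \<times> 'a) set \<Rightarrow> 'a pair_pre_digraph" where
  "del_arcs X F = \<lparr>pverts = pverts X, parcs = parcs X - F\<rparr>"

definition ftrs ::
  "nat \<Rightarrow> 'a pair_pre_digraph \<Rightarrow> ('a \<times> 'a) set \<Rightarrow> 'a pair_pre_digraph \<Rightarrow> bool" where
  "ftrs k G P H \<longleftrightarrow>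
     subgraph (with_proj H) (with_proj G) \<and>
     (\<forall>(s, t) \<in> P. \<forall>F. F \<subseteq> parcs G \<and> finite F \<and> card F \<le> k \<longrightarrow>
        (reachable (with_proj (del_arcs G F)) s t \<longleftrightarrow>
         reachable (with_proj (del_arcs H F)) s t))"

section \<open>Random access machines\<close>

text \<open>
  Polynomial time refers to a unit-cost random access machine whose arithmetic consists of
  addition and (truncated) subtraction, with programs written in structured form. Since there
  is no multiplication, a run of \<open>t\<close> steps only produces numbers whose bit length exceeds that
  of the input numbers and program constants by \<open>O(t)\<close>, so polynomial time on this machine
  coincides with polynomial time on Turing machines.

  The first component of a state holds the registers, the second one the memory. Each program
  mentions only finitely many registers; the unbounded store is the memory, which is
  addressed indirectly through registers. Guards test whether a register is nonzero.
\<close>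

datatype com =
    Skip
  | Set_const nat nat
  | Add nat nat nat
  | Sub nat nat nat
  | Load nat nat
  | Store nat nat
  | Seq com com
  | Cond nat com com
  | While nat com

type_synonym state = "(nat \<Rightarrow> nat) \<times> (nat \<Rightarrow> nat)"

text \<open>\<open>exec c s t s'\<close>: started in \<open>s\<close>, program \<open>c\<close> halts in \<open>s'\<close> after \<open>t\<close> steps.\<close>

inductive exec :: "com \<Rightarrow> state \<Rightarrow> nat \<Rightarrow> state \<Rightarrow> bool" where
  Skip: "exec Skip s 1 s"
| Set_const: "exec (Set_const x k) (r, m) 1 (r(x := k), m)"
| Add: "exec (Add x y z) (r, m) 1 (r(x := r y + r z), m)"
| Sub: "exec (Sub x y z) (r, m) 1 (r(x := r y - r z), m)"
| Load: "exec (Load x y) (r, m) 1 (r(x := m (r y)), m)"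
| Store: "exec (Store x y) (r, m) 1 (r, m(r x := r y))"
| Seq: "exec c1 s1 t1 s2 \<Longrightarrow> exec c2 s2 t2 s3 \<Longrightarrow> exec (Seq c1 c2) s1 (t1 + t2) s3"
| Cond_true: "r x \<noteq> 0 \<Longrightarrow> exec c1 (r, m) t s' \<Longrightarrow> exec (Cond x c1 c2) (r, m) (Suc t) s'"
| Cond_false: "r x = 0 \<Longrightarrow> exec c2 (r, m) t s' \<Longrightarrow> exec (Cond x c1 c2) (r, m) (Suc t) s'"
| While_false: "r x = 0 \<Longrightarrow> exec (While x c) (r, m) 1 (r, m)"
| While_true: "r x \<noteq> 0 \<Longrightarrow> exec c (r, m) t1 s2 \<Longrightarrow> exec (While x c) s2 t2 s3 \<Longrightarrow>
    exec (While x c) (r, m) (Suc (t1 + t2)) s3"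

inductive_cases exec_elims:
  "exec Skip s t s'" "exec (Set_const x k) s t s'" "exec (Add x y z) s t s'"
  "exec (Sub x y z) s t s'" "exec (Load x y) s t s'" "exec (Store x y) s t s'"
  "exec (Seq c1 c2) s t s'" "exec (Cond x c1 c2) s t s'" "exec (While x c) s t s'"

lemma exec_deterministic:
  "exec c s t s' \<Longrightarrow> exec c s u s'' \<Longrightarrow> t = u \<and> s' = s''"
proof (induction arbitrary: u s'' rule: exec.induct)
  case (Seq c1 s1 t1 s2 c2 t2 s3)
  from Seq.prems show ?case by (rule exec_elims) (use Seq.IH in blast)
next
  case (While_true r x c m t1 s2 t2 s3)
  from While_true.prems show ?case
    by (rule exec_elims) (use While_true.IH While_true.hyps in fastforce)+
next
  case (Cond_true r x c1 m t s' c2)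
  from Cond_true.prems show ?case
    by (rule exec_elims) (use Cond_true.IH Cond_true.hyps in fastforce)+
next
  case (Cond_false r x c2 m t s' c1)
  from Cond_false.prems show ?case
    by (rule exec_elims) (use Cond_false.IH Cond_false.hyps in fastforce)+
qed (auto elim: exec_elims)

definition init_state :: "nat list \<Rightarrow> state" where
  "init_state xs = (\<lambda>_. 0, \<lambda>i. if i < length xs then xs ! i else 0)"

text \<open>The output is read off the initial segment of the memory.\<close>

definition outputs :: "state \<Rightarrow> nat list \<Rightarrow> bool" where
  "outputs s ys \<longleftrightarrow> (\<forall>i < length ys. snd s i = ys ! i)"

text \<open>Total bit length; the summand \<open>1\<close> makes every number, also \<open>0\<close>, contribute.\<close>

definition input_size :: "nat list \<Rightarrow> nat" where
  "input_size xs = (\<Sum>x\<leftarrow>xs. 1 + floorlog 2 x)"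

text \<open>
  The search problem of producing, from the code \<open>inp i\<close> of an instance \<open>i \<in> I\<close>, the code
  \<open>out i y\<close> of some object \<open>y\<close> with \<open>R i y\<close>.
\<close>

definition poly_time_solvable ::
  "'i set \<Rightarrow> ('i \<Rightarrow> nat list) \<Rightarrow> ('i \<Rightarrow> 'o \<Rightarrow> nat list) \<Rightarrow> ('i \<Rightarrow> 'o \<Rightarrow> bool) \<Rightarrow> bool" where
  "poly_time_solvable I inp out R \<longleftrightarrow>
     (\<exists>(c :: com) (p :: nat poly). \<forall>i \<in> I. \<exists>t s y.
        exec c (init_state (inp i)) t s \<and>
        t \<le> poly p (input_size (inp i)) \<and>
        outputs s (out i y) \<and> R i y)"

section \<open>Encoding of graphs\<close>

text \<open>
  For algorithmic purposes the vertices are \<open>0, \<dots>, n - 1\<close>, and relations on the vertices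
  are given by their \<open>n \<times> n\<close> Boolean matrices in row-major order.
\<close>

definition rel_code :: "nat \<Rightarrow> (nat \<times> nat) set \<Rightarrow> nat list" where
  "rel_code n A = [if (u, v) \<in> A then 1 else 0. u \<leftarrow> [0..<n], v \<leftarrow> [0..<n]]"

type_synonym instance_data = "nat \<times> (nat \<times> nat) set \<times> (nat \<times> nat) set"

definition graph_instances :: "instance_data set" where
  "graph_instances = {(n, E, P). E \<subseteq> {..<n} \<times> {..<n} \<and> P \<subseteq> {..<n} \<times> {..<n}}"

definition instance_code :: "instance_data \<Rightarrow> nat list" where
  "instance_code = (\<lambda>(n, E, P). n # rel_code n E @ rel_code n P)"

text \<open>The output graph is a set of arcs on the same vertices as the input graph.\<close>

definition arcs_code :: "instance_data \<Rightarrow> (nat \<times> nat) set \<Rightarrow> nat list" where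
  "arcs_code = (\<lambda>(n, E, P) A. n # rel_code n A)"

end

theory Submission
  imports Defs "HOL-Analysis.Convex"
begin

text \<open>
  Let \<open>n\<close> be the number of vertices, \<open>p = |P|\<close>, \<open>m \<approx> (n p) powr (1/3)\<close> and \<open>L = n / m\<close>. For a set \<open>R\<close> of
  \<open>O(m)\<close> vertices, \<open>O(m n)\<close> arcs suffice to preserve, under two faults, all reachability from and to
  members of \<open>R\<close>; this settles every pair and fault set for which some surviving walk meets \<open>R\<close>.

  For the rest, note that after any deletion of arcs there are two walks from \<open>s\<close> to \<open>t\<close> sharing
  only bridges, so that a further non-bridge fault spares one of them. Let \<open>xs, ys\<close> be such walks in
  \<open>G\<close>. A fault set \<open>F\<close> hitting both is \<open>{e, f}\<close> with \<open>e\<close> on \<open>xs\<close> only and \<open>f\<close> on \<open>ys\<close> only. If \<open>e\<close> lies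
  between the first and the last vertex of \<open>R\<close> on \<open>xs\<close> and no surviving walk meets \<open>R\<close>, then every
  surviving walk avoids that whole middle part of \<open>xs\<close>, so one pair of walks, in \<open>G\<close> minus the middle
  part, serves all these \<open>e\<close>. For a well-chosen \<open>R\<close> the remaining \<open>e\<close> number \<open>O(L)\<close> per pair on
  average, and the walks that miss \<open>R\<close> have length \<open>O(L)\<close> on average. The total is
  \<open>O(m n + p L\<^sup>2)\<close>.

  The algorithm deletes arcs greedily as long as the result remains fault-tolerant. Applied to the
  resulting minimal graph \<open>A\<close>, the existence result yields a subgraph that can only be \<open>A\<close> itself,
  so \<open>A\<close> obeys the size bound.
\<close>

section \<open>Single-source preservers\<close>

text \<open>Only the first fault \<open>e\<close> is ever enumerated; the second is absorbed by the
  pair of walks chosen after \<open>e\<close>, or the whole middle part, has been deleted. Even so,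
  trying every \<open>e\<close> on \<open>xs\<close> would cost up to \<open>n\<close> pairs of
  walks of length up to \<open>n\<close> for each vertex pair. The set \<open>R\<close> cuts both
  factors down to \<open>L\<close>. It has to be chosen in two stages: which arcs belong to the
  middle part depends on a first hitting set, and only then are the walks known that a second one
  must shorten. Both hitting sets bound sums over all vertex pairs, hence the averages. The price of
  \<open>R\<close> is linear in \<open>n\<close> for each member because a minimal preserver for one
  source has boundedly many arcs into each vertex, a bound in terms of the number of faults alone
  that rests on the submodularity of cuts.\<close>

definition out_cut :: "('a \<times> 'a) set \<Rightarrow> 'a set \<Rightarrow> ('a \<times> 'a) set" where
  "out_cut E X = {(u, v) \<in> E. u \<in> X \<and> v \<notin> X}"

lemma finite_out_cut: "finite E \<Longrightarrow> finite (out_cut E X)"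
  by (rule finite_subset[of _ E]) (auto simp: out_cut_def)

lemma card_out_cut_submodular:
  assumes "finite E"
  shows "card (out_cut E (X \<union> Y)) + card (out_cut E (X \<inter> Y)) \<le> card (out_cut E X) + card (out_cut E Y)"
proof -
  note fin = finite_out_cut[OF assms]
  have "card (out_cut E (X \<union> Y)) + card (out_cut E (X \<inter> Y)) =
      card (out_cut E (X \<union> Y) \<union> out_cut E (X \<inter> Y)) + card (out_cut E (X \<union> Y) \<inter> out_cut E (X \<inter> Y))"
    using fin by (intro card_Un_Int) auto
  also have "\<dots> \<le> card (out_cut E X \<union> out_cut E Y) + card (out_cut E X \<inter> out_cut E Y)"
    using fin by (intro add_mono card_mono) (auto simp: out_cut_def)
  also have "\<dots> = card (out_cut E X) + card (out_cut E Y)"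
    using fin by (intro card_Un_Int[symmetric]) auto
  finally show ?thesis .
qed

text \<open>Captures the arcs into \<open>t\<close> of a minimal preserver: if faults
  \<open>F\<close> together with the arc cut off \<open>t\<close>, the part still reachable from the
  source is such an \<open>X\<close>, with at most \<open>card F + 1\<close> leaving arcs. The
  reachability clause makes the set empty once some cut has no leaving arcs.\<close>

definition small_cut_arcs ::
  "'a set \<Rightarrow> 'a \<Rightarrow> ('a \<times> 'a) set \<Rightarrow> 'a set \<Rightarrow> nat \<Rightarrow> ('a \<times> 'a) set" where
  "small_cut_arcs V t E S K = {(u, v) \<in> E. v = t \<and>
     (\<exists>X. S \<subseteq> X \<and> X \<subseteq> V - {t} \<and> u \<in> X \<and> card (out_cut E X) \<le> K \<and>
        (\<exists>s\<in>S. (s, u) \<in> (E \<inter> X \<times> X)\<^sup>*))}"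

lemma rtrancl_closed:
  assumes "(s, u) \<in> R\<^sup>*" "s \<in> A" "\<And>x y. (x, y) \<in> R \<Longrightarrow> x \<in> A \<Longrightarrow> y \<in> A"
  shows "u \<in> A"
  using assms by (induction rule: rtrancl_induct) auto

text \<open>
  Branch on an arc \<open>(a, b)\<close> leaving the largest minimum cut \<open>A\<close>. By submodularity a small cut may be
  enlarged by \<open>A\<close>. Either it then still contains \<open>(a, b)\<close>, whose deletion lowers both \<open>K\<close> and \<open>l\<close>,
  or \<open>b\<close> is on its source side, and adding \<open>b\<close> to the sources raises \<open>l\<close>. In both cases \<open>2 * K - l\<close>
  decreases.
\<close>

lemma card_small_cut_arcs:
  assumes V: "finite V" and E: "E \<subseteq> V \<times> V" and S: "S \<subseteq> V"
    and min: "\<And>A. S \<subseteq> A \<Longrightarrow> A \<subseteq> V - {t} \<Longrightarrow> l \<le> card (out_cut E A)"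
    and d: "2 * K \<le> d + l"
  shows "card (small_cut_arcs V t E S K) < 2 ^ d"
  using E S min d
proof (induction d arbitrary: E S K l)
  case 0
  have finE: "finite E" using V 0(1) finite_subset by blast
  \<comment> \<open>Here \<open>2 * K \<le> l\<close>, whereas a cut witnessing a member has at
    least \<open>l\<close> and at most \<open>K\<close> leaving arcs, one of them being the member
    itself.\<close>
  have "small_cut_arcs V t E S K = {}"
  proof (rule ccontr)
    assume "small_cut_arcs V t E S K \<noteq> {}"
    then obtain u X where X: "(u, t) \<in> E" "S \<subseteq> X" "X \<subseteq> V - {t}" "u \<in> X" "card (out_cut E X) \<le> K"
      by (auto simp: small_cut_arcs_def)
    then have "(u, t) \<in> out_cut E X" by (auto simp: out_cut_def)
    then have "card (out_cut E X) > 0" using finite_out_cut[OF finE] card_gt_0_iff by blast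
    then show False using 0(3)[OF X(2,3)] X(5) 0(4) by simp
  qed
  then show ?case by simp
next
  case (Suc d)
  have finE: "finite E" using V Suc.prems(1) finite_subset by blast
  show ?case
  proof (cases "\<exists>A. S \<subseteq> A \<and> A \<subseteq> V - {t} \<and> card (out_cut E A) = l")
    \<comment> \<open>No cut attains \<open>l\<close>, so \<open>l\<close> can be raised without
      branching.\<close>
    case False
    then have "Suc l \<le> card (out_cut E A)" if "S \<subseteq> A" "A \<subseteq> V - {t}" for A
      using Suc.prems(3)[OF that] that by (metis Suc_leI le_neq_implies_less)
    then have "card (small_cut_arcs V t E S K) < 2 ^ d"
      using Suc.prems by (intro Suc.IH[of E S "Suc l"]) auto
    then show ?thesis by simp
  next
    case True
    let ?P = "\<lambda>A. S \<subseteq> A \<and> A \<subseteq> V - {t} \<and> card (out_cut E A) = l"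
    have "finite {A. ?P A}" by (rule finite_subset[of _ "Pow V"]) (use V in auto)
    then have fin: "finite (card ` {A. ?P A})" and ne: "card ` {A. ?P A} \<noteq> {}" using True by auto
    obtain A where Max_A: "Max (card ` {A. ?P A}) = card A" and "A \<in> {A. ?P A}"
      by (rule imageE[OF Max_in[OF fin ne]])
    then have A: "?P A" by simp
    have Amax: "card B \<le> card A" if "?P B" for B
      unfolding Max_A[symmetric] using that by (intro Max_ge[OF fin]) simp
    show ?thesis
    proof (cases "out_cut E A = {}")
      case True
      have "small_cut_arcs V t E S K = {}"
      proof (rule ccontr)
        assume "small_cut_arcs V t E S K \<noteq> {}"
        then obtain u s X where X: "(u, t) \<in> E" "s \<in> S" "(s, u) \<in> (E \<inter> X \<times> X)\<^sup>*"
          by (auto simp: small_cut_arcs_def)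
        have "u \<in> A" by (rule rtrancl_closed[OF X(3)]) (use X A True in \<open>auto simp: out_cut_def\<close>)
        then show False using True X A by (auto simp: out_cut_def)
      qed
      then show ?thesis by simp
    next
      case False
      then obtain a b where f: "(a, b) \<in> E" "a \<in> A" "b \<notin> A" by (auto simp: out_cut_def)
      have fA: "(a, b) \<in> out_cut E A" using f by (auto simp: out_cut_def)
      then have l: "l > 0" using A finite_out_cut[OF finE] card_gt_0_iff by blast
      let ?D1 = "small_cut_arcs V t (E - {(a, b)}) A (K - 1)"
      let ?D2 = "small_cut_arcs V t E (insert b A) K"
      \<comment> \<open>A cut of size \<open>l\<close> containing \<open>A\<close> and
        \<open>b\<close> would be a larger minimum cut, so the minimum now exceeds \<open>l\<close>.
        If \<open>b = t\<close> there is no such cut and the claim about minima is vacuous.\<close>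
      have "card ?D2 < 2 ^ d"
      proof (rule Suc.IH[of _ _ "Suc l"])
        fix B assume B: "insert b A \<subseteq> B" "B \<subseteq> V - {t}"
        then have "l \<le> card (out_cut E B)" using A Suc.prems(3)[of B] by auto
        moreover have "card (out_cut E B) \<noteq> l"
        proof
          assume "card (out_cut E B) = l"
          then have "card B \<le> card A" using Amax[of B] B A by auto
          moreover have "card A < card B"
            using B f V by (intro psubset_card_mono) (auto intro: finite_subset)
          ultimately show False by simp
        qed
        ultimately show "Suc l \<le> card (out_cut E B)" by simp
      qed (use Suc.prems(1,4) A f in auto)
      moreover have "card ?D1 < 2 ^ d"
      proof (rule Suc.IH[of _ _ "l - 1"])
        fix B assume B: "A \<subseteq> B" "B \<subseteq> V - {t}"
        have "l \<le> card (out_cut E B)" using A B Suc.prems(3)[of B] by auto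
        moreover have "out_cut (E - {(a, b)}) B = out_cut E B - {(a, b)}"
          by (auto simp: out_cut_def)
        ultimately show "l - 1 \<le> card (out_cut (E - {(a, b)}) B)"
          using diff_card_le_card_Diff[of "{(a, b)}" "out_cut E B"] by simp
      qed (use Suc.prems(1,4) A f l in auto)
      \<comment> \<open>The arc \<open>(a, b)\<close> may be a member itself, and \<open>?D1\<close>
        has deleted it. Two strict bounds by \<open>2 ^ d\<close> leave just enough room for this
        extra arc below \<open>2 ^ Suc d\<close>.\<close>
      moreover have "small_cut_arcs V t E S K \<subseteq> insert (a, b) (?D1 \<union> ?D2)"
      proof
        fix e assume e: "e \<in> small_cut_arcs V t E S K"
        then obtain u X s where X: "e = (u, t)" "(u, t) \<in> E" "S \<subseteq> X" "X \<subseteq> V - {t}" "u \<in> X"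
          "card (out_cut E X) \<le> K" "s \<in> S" "(s, u) \<in> (E \<inter> X \<times> X)\<^sup>*"
          by (auto simp: small_cut_arcs_def)
        let ?Y = "X \<union> A"
        have "l \<le> card (out_cut E (X \<inter> A))" using A X by (intro Suc.prems(3)) auto
        then have Y: "card (out_cut E ?Y) \<le> K"
          using card_out_cut_submodular[OF finE, of X A] A X(6) by auto
        have reach: "(s, u) \<in> (E' \<inter> ?Y \<times> ?Y)\<^sup>*" if "E \<inter> X \<times> X \<subseteq> E'" for E'
          by (rule set_mp[OF rtrancl_mono X(8)]) (use that in auto)
        show "e \<in> insert (a, b) (?D1 \<union> ?D2)"
        proof (cases "b \<in> ?Y")
          case True
          have "e \<in> ?D2"
            unfolding small_cut_arcs_def using X A True Y reach[of E] by (auto intro!: exI[of _ ?Y])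
          then show ?thesis by simp
        next
          case False
          then have fY: "(a, b) \<in> out_cut E ?Y" using f by (auto simp: out_cut_def)
          have "out_cut (E - {(a, b)}) ?Y = out_cut E ?Y - {(a, b)}" by (auto simp: out_cut_def)
          then have "card (out_cut (E - {(a, b)}) ?Y) \<le> K - 1"
            using Y fY finite_out_cut[OF finE] by simp
          moreover have "(s, u) \<in> ((E - {(a, b)}) \<inter> ?Y \<times> ?Y)\<^sup>*"
            by (rule reach) (use False in auto)
          ultimately have "e \<in> ?D1" if "e \<noteq> (a, b)"
            unfolding small_cut_arcs_def using X A that by (auto intro!: exI[of _ ?Y])
          then show ?thesis by auto
        qed
      qed
      moreover have fin: "finite ?D1" "finite ?D2"
        by (auto intro!: finite_subset[OF _ finE] simp: small_cut_arcs_def)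
      ultimately have "card (small_cut_arcs V t E S K) \<le> Suc (card ?D1 + card ?D2)"
      proof -
        have "card (small_cut_arcs V t E S K) \<le> card (insert (a, b) (?D1 \<union> ?D2))"
          using fin \<open>_ \<subseteq> insert (a, b) (?D1 \<union> ?D2)\<close> by (intro card_mono) auto
        also have "\<dots> \<le> Suc (card (?D1 \<union> ?D2))" using fin by (simp add: card_insert_if)
        finally show ?thesis using card_Un_le[of ?D1 ?D2] by linarith
      qed
      then show ?thesis using \<open>card ?D1 < 2 ^ d\<close> \<open>card ?D2 < 2 ^ d\<close> by simp
    qed
  qed
qed

text \<open>One implication is enough, as \<open>H \<subseteq> E\<close> gives the converse.
  \<open>F\<close> ranges over all small sets of pairs, not just subsets of \<open>E\<close>, so
  that the same \<open>F\<close> can be passed on to a subgraph in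
  \<open>preserves_trans\<close>.\<close>

definition preserves :: "nat \<Rightarrow> ('a \<times> 'a) set \<Rightarrow> ('a \<times> 'a) set \<Rightarrow> ('a \<times> 'a) set \<Rightarrow> bool" where
  "preserves k P E H \<longleftrightarrow> H \<subseteq> E \<and>
     (\<forall>(s, t) \<in> P. \<forall>F. finite F \<longrightarrow> card F \<le> k \<longrightarrow> (s, t) \<in> (E - F)\<^sup>* \<longrightarrow> (s, t) \<in> (H - F)\<^sup>*)"

lemma preservesI:
  assumes "H \<subseteq> E"
    and "\<And>s t F. (s, t) \<in> P \<Longrightarrow> finite F \<Longrightarrow> card F \<le> k \<Longrightarrow> (s, t) \<in> (E - F)\<^sup>* \<Longrightarrow> (s, t) \<in> (H - F)\<^sup>*"
  shows "preserves k P E H"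
  using assms unfolding preserves_def by auto

lemma preserves_subset: "preserves k P E H \<Longrightarrow> H \<subseteq> E"
  unfolding preserves_def by simp

lemma preservesD:
  assumes "preserves k P E H" "(s, t) \<in> P" "finite F" "card F \<le> k" "(s, t) \<in> (E - F)\<^sup>*"
  shows "(s, t) \<in> (H - F)\<^sup>*"
  using assms unfolding preserves_def by auto

lemma preserves_refl: "preserves k P E E"
  by (rule preservesI) auto

lemma preserves_trans:
  assumes "preserves k P E H" "preserves k P H H'"
  shows "preserves k P E H'"
proof (rule preservesI)
  show "H' \<subseteq> E" using assms[THEN preserves_subset] by simp
qed (intro preservesD[OF assms(2)] preservesD[OF assms(1)])

lemma preserves_mono:
  assumes "preserves k P E H'" "H' \<subseteq> H" "H \<subseteq> E"
  shows "preserves k P E H"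
proof (rule preservesI)
  fix s t F assume "(s, t) \<in> P" "finite F" "card F \<le> k" "(s, t) \<in> (E - F)\<^sup>*"
  then have "(s, t) \<in> (H' - F)\<^sup>*" by (rule preservesD[OF assms(1)])
  then show "(s, t) \<in> (H - F)\<^sup>*" by (rule set_mp[OF rtrancl_mono, rotated]) (use assms(2) in auto)
qed (rule assms(3))

text \<open>A preserver of least cardinality works: by transitivity a preserver of \<open>H\<close>
  also preserves \<open>E\<close>, so it cannot be smaller than \<open>H\<close>.\<close>

lemma ex_minimal_preserver:
  assumes "finite E"
  obtains H where "preserves k P E H" "\<And>e. e \<in> H \<Longrightarrow> \<not> preserves k P H (H - {e})"
proof -
  obtain H where H: "preserves k P E H" and min: "\<And>H'. preserves k P E H' \<Longrightarrow> card H \<le> card H'"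
    using ex_has_least_nat[of "preserves k P E" E card] preserves_refl by metis
  have "finite H" using H assms finite_subset unfolding preserves_def by blast
  then have "\<not> preserves k P H (H - {e})" if "e \<in> H" for e
    using min[of "H - {e}"] preserves_trans[OF H] that card_Diff1_less[of H e] by fastforce
  with H that show ?thesis by blast
qed

lemma rtrancl_remove_arc:
  assumes "(s, v) \<in> R\<^sup>*" "(s, v) \<notin> (R - {(u, t)})\<^sup>*"
  shows "(u, t) \<in> R" "(s, u) \<in> (R - {(u, t)})\<^sup>*" "(t, v) \<in> (R - {(u, t)})\<^sup>*"
proof -
  have "R = insert (u, t) (R - {(u, t)})" if "(u, t) \<in> R" using that by auto
  moreover show "(u, t) \<in> R" using assms by (metis Diff_empty Diff_insert0)
  ultimately have "(s, v) \<in> (insert (u, t) (R - {(u, t)}))\<^sup>*" using assms(1) by metis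
  then show "(s, u) \<in> (R - {(u, t)})\<^sup>*" "(t, v) \<in> (R - {(u, t)})\<^sup>*"
    using assms(2) unfolding rtrancl_insert by auto
qed

lemma rtrancl_within_image:
  assumes "(s, u) \<in> R\<^sup>*"
  shows "(s, u) \<in> (R \<inter> R\<^sup>* `` {s} \<times> R\<^sup>* `` {s})\<^sup>*"
  using assms
proof (induction rule: rtrancl_induct)
  case (step y z)
  then have "(y, z) \<in> R \<inter> R\<^sup>* `` {s} \<times> R\<^sup>* `` {s}" by auto
  with step.IH show ?case by (rule rtrancl_into_rtrancl)
qed simp

text \<open>Each arc \<open>(u, t)\<close> of a minimal preserver is critical for some
  \<open>v\<close> and \<open>F\<close>. The vertices still reached from \<open>s\<close> without
  \<open>F\<close> and \<open>(u, t)\<close> form a cut with at most \<open>k + 1\<close> leaving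
  arcs, so \<open>small_cut_arcs\<close> counts the arc. The trivial minimum \<open>l = 0\<close>
  then gives fewer than \<open>4 ^ Suc k\<close> arcs into every \<open>t\<close>.\<close>

lemma single_source_preserver:
  assumes V: "finite V" and E: "E \<subseteq> V \<times> V" and s: "s \<in> V"
  obtains H where "preserves k ({s} \<times> UNIV) E H" "card H \<le> 4 ^ Suc k * card V"
proof -
  have finE: "finite E" using V E finite_subset by blast
  obtain H where H: "preserves k ({s} \<times> UNIV) E H"
    and min: "\<And>e. e \<in> H \<Longrightarrow> \<not> preserves k ({s} \<times> UNIV) H (H - {e})"
    using ex_minimal_preserver[OF finE, of k "{s} \<times> UNIV"] by metis
  have HV: "H \<subseteq> V \<times> V" using H E unfolding preserves_def by blast
  have finH: "finite H" using HV V finite_subset by blast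
  have in_arc: "(u, t) \<in> small_cut_arcs V t H {s} (Suc k)" if ut: "(u, t) \<in> H" for u t
  proof -
    obtain v F where F: "finite F" "card F \<le> k" "(s, v) \<in> (H - F)\<^sup>*"
      "(s, v) \<notin> (H - {(u, t)} - F)\<^sup>*"
      using min[OF ut] unfolding preserves_def by auto
    have eq: "H - {(u, t)} - F = H - F - {(u, t)}" by auto
    let ?R = "H - F - {(u, t)}"
    let ?X = "?R\<^sup>* `` {s}"
    note * = rtrancl_remove_arc[OF F(3) F(4)[unfolded eq]]
    \<comment> \<open>Otherwise the rest of the walk from \<open>t\<close> to \<open>v\<close> would
      reconnect \<open>v\<close> without \<open>(u, t)\<close>.\<close>
    have "t \<notin> ?X" using * F(4) eq by (auto dest: rtrancl_trans)
    moreover have "?X \<subseteq> V"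
    proof
      fix x assume "x \<in> ?X"
      then have "(s, x) \<in> ?R\<^sup>*" by simp
      then show "x \<in> V" by (rule rtrancl_closed) (use s HV in auto)
    qed
    moreover have "card (out_cut H ?X) \<le> Suc k"
    proof -
      have "out_cut H ?X \<subseteq> insert (u, t) F"
        by (auto simp: out_cut_def intro: rtrancl_into_rtrancl)
      then have "card (out_cut H ?X) \<le> card (insert (u, t) F)" using F by (intro card_mono) auto
      also have "\<dots> \<le> Suc k" using F by (simp add: card_insert_if)
      finally show ?thesis .
    qed
    moreover have "(s, u) \<in> (H \<inter> ?X \<times> ?X)\<^sup>*"
      by (rule set_mp[OF rtrancl_mono rtrancl_within_image[OF *(2)]]) auto
    ultimately show ?thesis
      unfolding small_cut_arcs_def using ut *(2) by (auto intro!: exI[of _ ?X])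
  qed
  have "H \<subseteq> (\<Union>t\<in>V. small_cut_arcs V t H {s} (Suc k))" using in_arc HV by force
  moreover have "finite (small_cut_arcs V t H {s} (Suc k))" for t
    by (rule finite_subset[OF _ finH]) (auto simp: small_cut_arcs_def)
  ultimately have "card H \<le> card (\<Union>t\<in>V. small_cut_arcs V t H {s} (Suc k))"
    using V by (intro card_mono) auto
  also have "\<dots> \<le> (\<Sum>t\<in>V. card (small_cut_arcs V t H {s} (Suc k)))" by (rule card_UN_le[OF V])
  also have "\<dots> \<le> (\<Sum>t\<in>V. 2 ^ (2 * Suc k))"
    using card_small_cut_arcs[OF V HV, of "{s}" _ 0 "Suc k" "2 * Suc k"] s
    by (intro sum_mono less_imp_le) auto
  also have "\<dots> = 4 ^ Suc k * card V" by (simp add: power_mult)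
  finally show ?thesis using that H by blast
qed

lemma rtrancl_converse_Diff: "(s, t) \<in> (E\<inverse> - F\<inverse>)\<^sup>* \<longleftrightarrow> (t, s) \<in> (E - F)\<^sup>*"
proof -
  have "E\<inverse> - F\<inverse> = (E - F)\<inverse>" by auto
  then show ?thesis by (simp add: rtrancl_converse)
qed

lemma single_sink_preserver:
  assumes "finite V" and "E \<subseteq> V \<times> V" and "t \<in> V"
  obtains H where "preserves k (UNIV \<times> {t}) E H" "card H \<le> 4 ^ Suc k * card V"
proof -
  have "E\<inverse> \<subseteq> V \<times> V" using assms by auto
  then obtain H where H: "preserves k ({t} \<times> UNIV) (E\<inverse>) H" "card H \<le> 4 ^ Suc k * card V"
    by (rule single_source_preserver[OF assms(1) _ assms(3)])
  have "preserves k (UNIV \<times> {t}) E (H\<inverse>)"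
    unfolding preserves_def
  proof (safe)
    fix u F assume F: "finite F" "card F \<le> k" "(u, t) \<in> (E - F)\<^sup>*"
    then have "(t, u) \<in> (H - F\<inverse>)\<^sup>*"
      by (intro preservesD[OF H(1)]) (auto simp: rtrancl_converse_Diff)
    then show "(u, t) \<in> (H\<inverse> - F)\<^sup>*"
      using rtrancl_converse_Diff[of t u "H\<inverse>" F] by simp
  qed (use H(1) in \<open>auto simp: preserves_def\<close>)
  with that H(2) show ?thesis by simp
qed

section \<open>Two walks sharing only bridges\<close>

lemma rtrancl_in_mono: "(s, t) \<in> R\<^sup>* \<Longrightarrow> R \<subseteq> R' \<Longrightarrow> (s, t) \<in> R'\<^sup>*"
  using rtrancl_mono by blast

section \<open>Walks as vertex lists\<close>

definition walk_arcs :: "'a list \<Rightarrow> ('a \<times> 'a) set" where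
  "walk_arcs xs = set (zip xs (tl xs))"

lemma walk_arcs_simps [simp]:
  "walk_arcs [] = {}" "walk_arcs [x] = {}"
  "walk_arcs (x # y # ys) = insert (x, y) (walk_arcs (y # ys))"
  by (simp_all add: walk_arcs_def)

lemma walk_arcs_append: "walk_arcs (xs @ z # ys) = walk_arcs (xs @ [z]) \<union> walk_arcs (z # ys)"
  by (induction xs rule: induct_list012) auto

lemma walk_arcs_append2:
  "walk_arcs (xs @ a # b # ys) = insert (a, b) (walk_arcs (xs @ [a]) \<union> walk_arcs (b # ys))"
  by (simp add: walk_arcs_append[of xs a "b # ys"])

lemma walk_arcs_iff: "(a, b) \<in> walk_arcs xs \<longleftrightarrow> (\<exists>ys zs. xs = ys @ a # b # zs)"
proof
  show "(a, b) \<in> walk_arcs xs \<Longrightarrow> \<exists>ys zs. xs = ys @ a # b # zs"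
  proof (induction xs rule: induct_list012)
    case (3 x y zs)
    then show ?case by (auto intro: exI[of _ "[]"]) (metis append_Cons)
  qed auto
qed (auto simp: walk_arcs_append2)

lemma walk_arcs_nth_iff:
  "(a, b) \<in> walk_arcs xs \<longleftrightarrow> (\<exists>i. Suc i < length xs \<and> a = xs ! i \<and> b = xs ! Suc i)"
proof -
  have "(a, b) \<in> walk_arcs xs \<longleftrightarrow> (\<exists>i. xs ! i = a \<and> tl xs ! i = b \<and> i < length xs \<and> i < length (tl xs))"
    by (simp add: walk_arcs_def in_set_zip)
  also have "\<dots> \<longleftrightarrow> (\<exists>i. Suc i < length xs \<and> a = xs ! i \<and> b = xs ! Suc i)"
  proof (intro ex_cong1 iffI)
    fix i assume "Suc i < length xs \<and> a = xs ! i \<and> b = xs ! Suc i"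
    then show "xs ! i = a \<and> tl xs ! i = b \<and> i < length xs \<and> i < length (tl xs)"
      by (simp add: nth_tl less_diff_conv)
  qed (auto simp: nth_tl)
  finally show ?thesis .
qed

lemma walk_arcs_subset_set: "walk_arcs xs \<subseteq> set xs \<times> set xs"
  by (auto simp: walk_arcs_nth_iff)

lemma walk_arcs_Cons_head: "walk_arcs (z # Z) \<subseteq> UNIV \<times> set Z"
  by (auto simp: walk_arcs_def dest: set_zip_rightD)

lemma walk_arcs_snoc_tail: "walk_arcs (A @ [z]) \<subseteq> set A \<times> UNIV"
  by (induction A rule: induct_list012) auto

lemma card_walk_arcs: "card (walk_arcs xs) \<le> length xs"
  unfolding walk_arcs_def by (rule le_trans[OF card_length]) simp

lemma nth_reach:
  assumes "i \<le> j" "j < length xs" "\<And>k. i \<le> k \<Longrightarrow> k < j \<Longrightarrow> (xs ! k, xs ! Suc k) \<in> E"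
  shows "(xs ! i, xs ! j) \<in> E\<^sup>*"
  using assms
proof (induction j rule: dec_induct)
  case (step j)
  then have "(xs ! i, xs ! j) \<in> E\<^sup>*" by simp
  also have "(xs ! j, xs ! Suc j) \<in> E" using step by simp
  finally show ?case .
qed simp

lemma walk_arcs_reach_last:
  "walk_arcs (x # xs) \<subseteq> E \<Longrightarrow> y \<in> set (x # xs) \<Longrightarrow> (y, last (x # xs)) \<in> E\<^sup>*"
proof (induction xs arbitrary: x y)
  case (Cons z zs)
  have z: "(z, last (z # zs)) \<in> E\<^sup>*" using Cons.prems by (intro Cons.IH) auto
  show ?case
  proof (cases "y = x")
    case True
    with z Cons.prems show ?thesis by (auto intro: converse_rtrancl_into_rtrancl)
  next
    case False
    with Cons.IH[of z y] Cons.prems show ?thesis by auto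
  qed
qed simp

lemma walk_arcs_reach_hd:
  "walk_arcs (x # xs) \<subseteq> E \<Longrightarrow> y \<in> set (x # xs) \<Longrightarrow> (x, y) \<in> E\<^sup>*"
proof (induction xs arbitrary: x)
  case (Cons z zs)
  from Cons.IH[of z] Cons.prems show ?case
    by (auto intro: converse_rtrancl_into_rtrancl)
qed simp

definition is_walk :: "('a \<times> 'a) set \<Rightarrow> 'a \<Rightarrow> 'a list \<Rightarrow> 'a \<Rightarrow> bool" where
  "is_walk E s xs t \<longleftrightarrow> xs \<noteq> [] \<and> hd xs = s \<and> last xs = t \<and> walk_arcs xs \<subseteq> E"

lemma is_walk_start: "is_walk E s xs t \<Longrightarrow> s \<in> set xs"
  by (auto simp: is_walk_def)

lemma is_walk_append_iff:
  "is_walk E s (A @ z # B) t \<longleftrightarrow> is_walk E s (A @ [z]) z \<and> is_walk E z (z # B) t"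
proof -
  have "hd (A @ z # B) = hd (A @ [z])" by (cases A) auto
  then show ?thesis unfolding is_walk_def walk_arcs_append[of A z B] by auto
qed

lemma is_walk_mono: "is_walk E s xs t \<Longrightarrow> E \<subseteq> E' \<Longrightarrow> is_walk E' s xs t"
  by (auto simp: is_walk_def)

lemma is_walk_reach_from: "is_walk E s xs t \<Longrightarrow> x \<in> set xs \<Longrightarrow> (s, x) \<in> E\<^sup>*"
  unfolding is_walk_def by (cases xs) (auto intro: walk_arcs_reach_hd)

lemma is_walk_reach_to: "is_walk E s xs t \<Longrightarrow> x \<in> set xs \<Longrightarrow> (x, t) \<in> E\<^sup>*"
  unfolding is_walk_def by (cases xs) (auto dest: walk_arcs_reach_last)

lemma is_walk_reach: "is_walk E s xs t \<Longrightarrow> (s, t) \<in> E\<^sup>*"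
  using is_walk_reach_from[of E s xs t t] by (auto simp: is_walk_def)

lemma ex_distinct_walk:
  assumes "(s, t) \<in> E\<^sup>*"
  shows "\<exists>xs. is_walk E s xs t \<and> distinct xs"
  using assms
proof (induction rule: rtrancl_induct)
  case base
  show ?case by (rule exI[of _ "[s]"]) (simp add: is_walk_def)
next
  case (step y z)
  then obtain xs where xs: "is_walk E s xs y" "distinct xs" by blast
  show ?case
  proof (cases "z \<in> set xs")
    case True
    then obtain as bs where "xs = as @ z # bs" by (meson split_list)
    then show ?thesis
      using xs by (intro exI[of _ "as @ [z]"])
        (auto simp: is_walk_append_iff[of E s as z bs])
  next
    case False
    obtain as where "xs = as @ [y]"
      using xs(1) unfolding is_walk_def by (metis append_butlast_last_id)
    then show ?thesis
      using xs step.hyps False by (intro exI[of _ "xs @ [z]"])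
        (auto simp: is_walk_def walk_arcs_append2 hd_append split: if_splits)
  qed
qed

lemma ex_distinct_subwalk:
  assumes "is_walk E s xs t"
  shows "\<exists>ys. is_walk E s ys t \<and> distinct ys \<and> walk_arcs ys \<subseteq> walk_arcs xs"
proof -
  have "is_walk (walk_arcs xs) s xs t" using assms by (simp add: is_walk_def)
  then obtain ys where "is_walk (walk_arcs xs) s ys t" "distinct ys"
    using is_walk_reach ex_distinct_walk by meson
  then show ?thesis using assms by (auto simp: is_walk_def)
qed

lemma walk_snoc:
  assumes "is_walk E s p u" "(u, v) \<in> E"
  shows "is_walk E s (p @ [v]) v" "walk_arcs (p @ [v]) = insert (u, v) (walk_arcs p)"
proof -
  obtain as where "p = as @ [u]"
    using assms(1) unfolding is_walk_def by (metis append_butlast_last_id)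
  then show "is_walk E s (p @ [v]) v" "walk_arcs (p @ [v]) = insert (u, v) (walk_arcs p)"
    using assms by (auto simp: is_walk_def walk_arcs_append2 hd_append split: if_splits)
qed

abbreviation is_bridge :: "('a \<times> 'a) set \<Rightarrow> 'a \<Rightarrow> 'a \<Rightarrow> 'a \<times> 'a \<Rightarrow> bool" where
  "is_bridge E s t e \<equiv> (s, t) \<notin> (E - {e})\<^sup>*"

text \<open>The new pair is \<open>A @ z # Z\<close> and \<open>q @ [v]\<close>. The detour adds no
  common arc: its arcs end in \<open>Z\<close>, which avoids \<open>q\<close>, and it does not use
  \<open>(u, v)\<close>. Nor does the prefix use \<open>(u, v)\<close>, since \<open>u\<close> lies
  on \<open>z # B\<close> and the walk is distinct.\<close>

lemma reroute_walk:
  assumes p: "is_walk E s (A @ z # B) u" "distinct (A @ z # B)" and q: "is_walk E s q u"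
    and uv: "(u, v) \<in> E"
    and Z: "is_walk (E - {(u, v)}) z (z # Z) v" "set Z \<inter> set q = {}"
    and common: "\<And>e. e \<in> walk_arcs (A @ [z]) \<Longrightarrow> e \<in> walk_arcs q \<Longrightarrow> is_bridge E s v e"
  shows "\<exists>p q. is_walk E s p v \<and> is_walk E s q v \<and>
    (\<forall>e \<in> walk_arcs p \<inter> walk_arcs q. is_bridge E s v e)"
proof (intro exI conjI)
  show "is_walk E s (A @ z # Z) v"
    using p(1) Z(1) is_walk_append_iff[of E s A z] is_walk_mono[of _ z "z # Z" v E] by blast
  show "is_walk E s (q @ [v]) v" using walk_snoc[OF q uv] by simp
  have "u \<in> set (z # B)" using p(1) last_in_set[of "z # B"] by (simp add: is_walk_def)
  then have "u \<notin> set A" using p(2) by auto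
  then have "(u, v) \<notin> walk_arcs (A @ [z])" using walk_arcs_snoc_tail[of A z] by auto
  moreover note walk_arcs_Cons_head[of z Z]
  ultimately show "\<forall>e \<in> walk_arcs (A @ z # Z) \<inter> walk_arcs (q @ [v]). is_bridge E s v e"
    using common Z walk_snoc(2)[OF q uv] walk_arcs_subset_set[of q]
    by (auto simp: walk_arcs_append[of A z Z] is_walk_def)
qed

text \<open>
  The walks to \<open>u\<close> cannot simply be prolonged when a common bridge \<open>c\<close> towards \<open>u\<close> is no bridge towards
  \<open>v\<close>. A walk \<open>Z\<close> to \<open>v\<close> that bypasses the first such \<open>c\<close> cannot touch \<open>p\<close> or \<open>q\<close> beyond \<open>c\<close>; one of the
  two new walks follows \<open>Z\<close> from its last vertex on \<open>p\<close> or \<open>q\<close>.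
\<close>

lemma two_walks_step:
  assumes p: "is_walk E s p u" "distinct p" and q: "is_walk E s q u" "distinct q"
    and uv: "(u, v) \<in> E"
    and common: "\<And>e. e \<in> walk_arcs p \<Longrightarrow> e \<in> walk_arcs q \<Longrightarrow> is_bridge E s u e"
  shows "\<exists>p q. is_walk E s p v \<and> is_walk E s q v \<and>
    (\<forall>e \<in> walk_arcs p \<inter> walk_arcs q. is_bridge E s v e)"
proof (cases "is_bridge E s v (u, v)")
  case True
  \<comment> \<open>All walks to \<open>v\<close> pass through \<open>u\<close> here, so bridges
    towards \<open>u\<close> are bridges towards \<open>v\<close> and both walks can be
    prolonged.\<close>
  have "is_bridge E s v e" if e: "is_bridge E s u e" for e
  proof
    assume *: "(s, v) \<in> (E - {e})\<^sup>*"
    have "(s, v) \<notin> (E - {e} - {(u, v)})\<^sup>*"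
    proof
      assume "(s, v) \<in> (E - {e} - {(u, v)})\<^sup>*"
      then have "(s, v) \<in> (E - {(u, v)})\<^sup>*" by (rule rtrancl_in_mono) auto
      with True show False ..
    qed
    from rtrancl_remove_arc(2)[OF * this] have "(s, u) \<in> (E - {e})\<^sup>*"
      by (rule rtrancl_in_mono) auto
    with e show False ..
  qed
  then show ?thesis
    using walk_snoc(1)[OF p(1) uv] walk_snoc(1)[OF q(1) uv] common True
    by (intro exI[of _ "p @ [v]"] exI[of _ "q @ [v]"] conjI)
      (simp_all add: walk_snoc(2)[OF p(1) uv] walk_snoc(2)[OF q(1) uv])
next
  case False
  define Bad where "Bad = {c \<in> walk_arcs p \<inter> walk_arcs q. \<not> is_bridge E s v c}"
  have s: "s \<in> set p" "s \<in> set q" using p q is_walk_start by metis+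
  have split: "\<exists>Y z Z'. Z = Y @ z # Z' \<and> (z \<in> set p \<or> z \<in> set q) \<and> set Z' \<inter> set p = {} \<and>
      set Z' \<inter> set q = {} \<and> is_walk R z (z # Z') v"
    if Z: "is_walk R s Z v" for R Z
  proof -
    have "\<exists>x\<in>set Z. x \<in> set p \<or> x \<in> set q" using is_walk_start[OF Z] s by auto
    from split_list_last_prop[OF this] obtain Y z Z' where *: "Z = Y @ z # Z'"
      "z \<in> set p \<or> z \<in> set q" "\<forall>x\<in>set Z'. \<not> (x \<in> set p \<or> x \<in> set q)" by blast
    moreover have "is_walk R z (z # Z') v"
      using Z * is_walk_append_iff[of R s Y z Z' v] by simp
    ultimately show ?thesis by blast
  qed
  show ?thesis
  proof (cases "Bad = {}")
    case True
    from False obtain Z where Z: "is_walk (E - {(u, v)}) s Z v"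
      using ex_distinct_walk[of s v "E - {(u, v)}"] by auto
    then obtain z Z' where Z': "z \<in> set p \<or> z \<in> set q" "set Z' \<inter> set p = {}" "set Z' \<inter> set q = {}"
      "is_walk (E - {(u, v)}) z (z # Z') v"
      using split[OF Z] by metis
    show ?thesis
    proof (cases "z \<in> set p")
      case True
      then obtain A B where AB: "p = A @ z # B" by (meson split_list)
      show ?thesis
        by (rule reroute_walk[OF p[unfolded AB] q(1) uv Z'(4,3)])
          (use \<open>Bad = {}\<close> AB in \<open>auto simp: Bad_def walk_arcs_append[of A z B]\<close>)
    next
      case False
      then obtain A B where AB: "q = A @ z # B" using Z'(1) by (meson split_list)
      show ?thesis
        by (rule reroute_walk[OF q[unfolded AB] p(1) uv Z'(4,2)])
          (use \<open>Bad = {}\<close> AB in \<open>auto simp: Bad_def walk_arcs_append[of A z B]\<close>)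
    qed
  next
    case False
    \<comment> \<open>A shortest prefix \<open>A\<close> with this property ends at the first bad
      arc along \<open>p\<close>.\<close>
    define Q where "Q A \<longleftrightarrow> (\<exists>a b B. p = A @ a # b # B \<and> (a, b) \<in> Bad)" for A
    obtain a0 b0 where bad0: "(a0, b0) \<in> Bad" using False by auto
    then have "(a0, b0) \<in> walk_arcs p" unfolding Bad_def by simp
    then obtain A0 where "Q A0" using bad0 unfolding walk_arcs_iff Q_def by metis
    then obtain A where "Q A" and A_min: "\<And>A'. Q A' \<Longrightarrow> length A \<le> length A'"
      using ex_has_least_nat[of Q A0 length] by metis
    then obtain a b B where AB: "p = A @ a # b # B" and bad: "(a, b) \<in> Bad"
      unfolding Q_def by metis
    have bad': "(a, b) \<in> walk_arcs p" "(a, b) \<in> walk_arcs q" using bad unfolding Bad_def by simp_all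
    obtain A2 B2 where AB2: "q = A2 @ a # b # B2"
      using bad'(2) unfolding walk_arcs_iff by metis
    let ?R = "E - {(a, b)}"
    have su: "(s, u) \<notin> ?R\<^sup>*" by (rule common[OF bad'])
    have first: "e \<notin> Bad" if "e \<in> walk_arcs (A @ [a])" for e
    proof
      assume bad_e: "e \<in> Bad"
      obtain a' b' where e: "e = (a', b')" by (cases e)
      with that obtain A' B' where A': "A @ [a] = A' @ a' # b' # B'" by (auto simp: walk_arcs_iff)
      then have "p = A' @ a' # b' # (B' @ b # B)" using AB by simp
      then have "length A \<le> length A'" using bad_e e unfolding Q_def by (intro A_min) (metis Q_def)
      moreover have "length (A @ [a]) = length (A' @ a' # b' # B')" using A' by simp
      ultimately show False by simp
    qed
    \<comment> \<open>Everything behind \<open>b\<close> on either walk reaches \<open>u\<close>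
      without \<open>(a, b)\<close>, so \<open>s\<close> cannot reach it without this
      bridge.\<close>
    have B_to: "(x, u) \<in> ?R\<^sup>*" if "x \<in> set (b # B) \<or> x \<in> set (b # B2)" for x
    proof -
      have *: "(x, u) \<in> ?R\<^sup>*"
        if "is_walk E s (C @ a # b # D) u" "distinct (C @ a # b # D)" "x \<in> set (b # D)" for C D
      proof -
        have "a \<notin> set (b # D)" using that by auto
        then have "walk_arcs (b # D) \<subseteq> ?R"
          using that(1) walk_arcs_subset_set[of "b # D"] by (auto simp: is_walk_def walk_arcs_append2)
        then have "is_walk ?R b (b # D) u" using that(1) by (auto simp: is_walk_def)
        from is_walk_reach_to[OF this that(3)] show ?thesis .
      qed
      from that show ?thesis using *[of A B] *[of A2 B2] p q AB AB2 by blast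
    qed
    have A2_from: "(s, x) \<in> ?R\<^sup>*" if "x \<in> set (A2 @ [a])" for x
    proof -
      have "b \<notin> set (A2 @ [a])" using q AB2 by auto
      then have "walk_arcs (A2 @ [a]) \<subseteq> ?R"
        using q(1) AB2 walk_arcs_subset_set[of "A2 @ [a]"] by (auto simp: is_walk_def walk_arcs_append2)
      then have "is_walk ?R s (A2 @ [a]) a"
        using q(1) is_walk_append_iff[of E s A2 a "b # B2" u] by (simp add: AB2 is_walk_def)
      from is_walk_reach_from[OF this that] show ?thesis .
    qed
    obtain Z where Z: "is_walk ?R s Z v"
      using bad ex_distinct_walk[of s v ?R] unfolding Bad_def by auto
    then obtain Y z Z' where Z': "Z = Y @ z # Z'" "z \<in> set p \<or> z \<in> set q"
      "set Z' \<inter> set p = {}" "set Z' \<inter> set q = {}" "is_walk ?R z (z # Z') v"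
      using split[OF Z] by metis
    have z: "z \<notin> set (b # B)" "z \<notin> set (b # B2)"
      using B_to[of z] su is_walk_reach_from[OF Z, of z] Z'(1) by (auto dest: rtrancl_trans)
    \<comment> \<open>A walk that bypasses the bridge \<open>(a, b)\<close> cannot visit
      \<open>u\<close>, so it avoids \<open>(u, v)\<close> for free.\<close>
    have "u \<notin> set Z" using su is_walk_reach_from[OF Z] by blast
    then have "(u, v) \<notin> walk_arcs (z # Z')" using walk_arcs_subset_set[of "z # Z'"] Z'(1) by auto
    then have Z'': "is_walk (E - {(u, v)}) z (z # Z') v" using Z'(5) by (auto simp: is_walk_def)
    show ?thesis
    proof (cases "z \<in> set p")
      case True
      then have "z \<in> set (A @ [a])" using z AB by auto
      then obtain A' B' where A': "A @ [a] = A' @ z # B'" by (meson split_list)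
      then have p': "p = A' @ z # (B' @ b # B)" using AB by simp
      have "walk_arcs (A' @ [z]) \<subseteq> walk_arcs (A @ [a])" unfolding A' walk_arcs_append[of A' z B'] by simp
      then have "is_bridge E s v e" if "e \<in> walk_arcs (A' @ [z])" "e \<in> walk_arcs q" for e
        using first[of e] that p' unfolding Bad_def by (auto simp: walk_arcs_append[of A' z "B' @ b # B"])
      then show ?thesis by (rule reroute_walk[OF p[unfolded p'] q(1) uv Z'' Z'(4)])
    next
      case False
      then have "z \<in> set (A2 @ [a])" using z AB2 Z' by auto
      then obtain A' B' where A': "A2 @ [a] = A' @ z # B'" by (meson split_list)
      then have q': "q = A' @ z # (B' @ b # B2)" using AB2 by simp
      have sub: "walk_arcs (A' @ [z]) \<subseteq> walk_arcs (A2 @ [a])"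
        unfolding A' walk_arcs_append[of A' z B'] by simp
      \<comment> \<open>\<open>(a, b)\<close> is the first bad arc along \<open>p\<close>, not
        necessarily along \<open>q\<close>. But a common arc in front of \<open>a\<close> on
        \<open>q\<close> has a head reachable from \<open>s\<close> without \<open>(a, b)\<close>,
        so on \<open>p\<close> too it precedes \<open>b\<close>, where no arc is bad.\<close>
      have "is_bridge E s v e" if e: "e \<in> walk_arcs (A' @ [z])" "e \<in> walk_arcs p" for e
      proof -
        obtain a' b' where ab': "e = (a', b')" by (cases e)
        have "b' \<in> set (A2 @ [a])" using e(1) sub walk_arcs_subset_set[of "A2 @ [a]"] ab' by auto
        then have "b' \<notin> set (b # B)" using A2_from[of b'] B_to[of b'] su by (auto dest: rtrancl_trans)
        then have "e \<in> walk_arcs (A @ [a])"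
          using e(2) ab' walk_arcs_subset_set[of "b # B"] by (auto simp: AB walk_arcs_append2)
        from first[OF this] show ?thesis
          using e q' unfolding Bad_def by (auto simp: walk_arcs_append[of A' z "B' @ b # B2"])
      qed
      then show ?thesis by (rule reroute_walk[OF q[unfolded q'] p(1) uv Z'' Z'(3)])
    qed
  qed
qed

text \<open>Induction along a walk. A step may produce walks with repeated vertices; shortening them
  only drops arcs, so the common arcs remain bridges.\<close>

lemma two_walks:
  assumes "(s, t) \<in> E\<^sup>*"
  shows "\<exists>p q. is_walk E s p t \<and> distinct p \<and> is_walk E s q t \<and> distinct q \<and>
    (\<forall>e \<in> walk_arcs p \<inter> walk_arcs q. is_bridge E s t e)"
  using assms
proof (induction rule: rtrancl_induct)
  case base
  show ?case by (intro exI[of _ "[s]"]) (simp add: is_walk_def)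
next
  case (step u v)
  then obtain p q where "is_walk E s p v" "is_walk E s q v"
    "\<forall>e \<in> walk_arcs p \<inter> walk_arcs q. is_bridge E s v e"
    using two_walks_step[OF _ _ _ _ step.hyps(2)] by (metis IntI)
  moreover from this(1,2) obtain p' q' where "is_walk E s p' v" "distinct p'"
    "walk_arcs p' \<subseteq> walk_arcs p" "is_walk E s q' v" "distinct q'" "walk_arcs q' \<subseteq> walk_arcs q"
    using ex_distinct_subwalk by meson
  ultimately show ?case by blast
qed

section \<open>Hitting sets\<close>

text \<open>One measure for two purposes: it bounds the number of arcs up to the first hit, and it
  is the full length of a list that \<open>R\<close> misses.\<close>

definition unhit :: "'a set \<Rightarrow> 'a list \<Rightarrow> nat" where
  "unhit R xs = length (takeWhile (\<lambda>x. x \<notin> R) xs)"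

lemma unhit_disjoint: "set xs \<inter> R = {} \<Longrightarrow> unhit R xs = length xs"
  by (induction xs) (auto simp: unhit_def)

lemma unhit_nth: "unhit R xs < length xs \<Longrightarrow> xs ! unhit R xs \<in> R"
  unfolding unhit_def using nth_length_takeWhile by fastforce

lemma unhit_insert: "unhit (insert x R) xs = length (takeWhile (\<lambda>y. y \<noteq> x) (takeWhile (\<lambda>y. y \<notin> R) xs))"
  unfolding unhit_def by (induction xs) auto

lemma unhit_insert_le: "unhit (insert x R) xs \<le> unhit R xs"
  unfolding unhit_insert unfolding unhit_def by (rule length_takeWhile_le)

text \<open>Cutting \<open>ys\<close> at position \<open>i\<close> gains
  \<open>length ys - i\<close>. Over all positions this sums to
  \<open>1 + 2 + ... + length ys\<close>, at least half the square.\<close>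

lemma sum_takeWhile_gain:
  assumes "finite V" "distinct ys" "set ys \<subseteq> V"
  shows "(length ys)\<^sup>2 \<le> 2 * (\<Sum>x\<in>V. length ys - length (takeWhile (\<lambda>y. y \<noteq> x) ys))"
  using assms(2,3)
proof (induction ys)
  case (Cons y ys)
  let ?g = "\<lambda>x. length ys - length (takeWhile (\<lambda>y. y \<noteq> x) ys)"
  let ?h = "\<lambda>x. length (y # ys) - length (takeWhile (\<lambda>y. y \<noteq> x) (y # ys))"
  have y: "y \<in> V" "y \<notin> set ys" using Cons.prems by auto
  have "takeWhile (\<lambda>z. z \<noteq> y) ys = ys" using y(2) by (induction ys) auto
  then have "?g y = 0" by (simp only: diff_self_eq_0)
  then have "(\<Sum>x\<in>V. ?g x) = (\<Sum>x\<in>V - {y}. ?g x)"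
    using assms(1) y(1) by (simp add: sum.remove)
  also have "\<dots> = (\<Sum>x\<in>V - {y}. ?h x)" by (rule sum.cong) auto
  finally have "(\<Sum>x\<in>V. ?h x) = Suc (length ys) + (\<Sum>x\<in>V. ?g x)"
    using assms(1) y(1) by (simp add: sum.remove)
  then show ?case using Cons by (simp add: power2_eq_square)
qed simp

text \<open>With \<open>x = U / c\<close> the point is that \<open>m * x \<le> 1\<close> implies
  \<open>(m + 1) * x * (1 - x) \<le> 1\<close>: add \<open>m * x * (1 - x) \<le> 1 - x\<close> and
  \<open>x * (1 - x) \<le> x\<close>. For \<open>x > 1\<close> the product is not positive.\<close>

lemma greedy_step_bound:
  fixes c U U' :: real
  assumes "0 \<le> U" "0 \<le> U'" "U' \<le> U" "0 \<le> c" and dec: "U\<^sup>2 \<le> c * (U - U')" and m: "real m * U \<le> c"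
  shows "real (Suc m) * U' \<le> c"
proof (cases "c = 0")
  case True
  then have "U = 0" using dec by simp
  then show ?thesis using assms by simp
next
  case False
  then have c: "c > 0" using assms by simp
  have "real (Suc m) * U * (c - U) \<le> c * c"
  proof (cases "U \<le> c")
    case True
    have "real m * U * (c - U) \<le> c * (c - U)" using m True by (intro mult_right_mono) auto
    moreover have "U * (c - U) \<le> c * U" using assms(1) by (simp add: algebra_simps)
    ultimately have "real m * U * (c - U) + U * (c - U) \<le> c * (c - U) + c * U" by (rule add_mono)
    then show ?thesis by (simp add: algebra_simps)
  next
    case False
    then have "real (Suc m) * U * (c - U) \<le> 0" using assms(1) by (intro mult_nonneg_nonpos) auto
    then show ?thesis by (meson zero_le_square order.trans)
  qed
  moreover have "real (Suc m) * (c * U') \<le> real (Suc m) * (U * (c - U))"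
    using dec by (intro mult_left_mono) (auto simp: algebra_simps power2_eq_square)
  ultimately have "c * (real (Suc m) * U') \<le> c * c" by (simp add: algebra_simps)
  then show ?thesis using c by (simp add: mult_le_cancel_left_pos)
qed

text \<open>
  A greedily chosen vertex lowers the total unhit length \<open>U\<close> by at least \<open>U\<^sup>2 / c\<close>, where
  \<open>c = 2 * card J * card V\<close>. Measuring lengths instead of covering all long lists is what
  avoids a logarithmic factor.
\<close>

lemma hitting_set:
  assumes V: "finite V" and J: "finite J"
    and lists: "\<And>j. j \<in> J \<Longrightarrow> distinct (f j)" "\<And>j. j \<in> J \<Longrightarrow> set (f j) \<subseteq> V"
  shows "\<exists>R \<subseteq> V. card R \<le> m \<and> m * (\<Sum>j\<in>J. unhit R (f j)) \<le> 2 * card J * card V"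
proof (induction m)
  case 0
  show ?case by (rule exI[of _ "{}"]) simp
next
  case (Suc m)
  then obtain R where R: "R \<subseteq> V" "card R \<le> m"
    "m * (\<Sum>j\<in>J. unhit R (f j)) \<le> 2 * card J * card V" by blast
  define U where "U R = (\<Sum>j\<in>J. unhit R (f j))" for R
  show ?case
  proof (cases "V = {}")
    case True
    then have "f j = []" if "j \<in> J" for j using lists(2)[OF that] by simp
    then have "(\<Sum>j\<in>J. unhit R (f j)) = 0" by (simp add: unhit_def)
    then show ?thesis using R by (intro exI[of _ R]) auto
  next
    case False
    have le: "U (insert x R) \<le> U R" for x
      unfolding U_def by (intro sum_mono unhit_insert_le)
    have "(real (U R))\<^sup>2 = (\<Sum>j\<in>J. real (unhit R (f j)))\<^sup>2" by (simp add: U_def)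
    \<comment> \<open>Cauchy-Schwarz, the source of the factor \<open>card J\<close>. The factor
      \<open>card V\<close> arises below, where the best vertex is compared with the average
      one.\<close>
    also have "\<dots> \<le> (\<Sum>j\<in>J. (real (unhit R (f j)))\<^sup>2) * card J"
      by (rule sum_squared_le_sum_of_squares)
    also have "(\<Sum>j\<in>J. (real (unhit R (f j)))\<^sup>2) \<le> (\<Sum>j\<in>J. 2 * (\<Sum>x\<in>V. real (unhit R (f j)) - real (unhit (insert x R) (f j))))"
    proof (rule sum_mono)
      fix j assume j: "j \<in> J"
      let ?ys = "takeWhile (\<lambda>y. y \<notin> R) (f j)"
      have "set ?ys \<subseteq> V" using lists(2)[OF j] set_takeWhileD by fastforce
      then have "(length ?ys)\<^sup>2 \<le> 2 * (\<Sum>x\<in>V. length ?ys - length (takeWhile (\<lambda>y. y \<noteq> x) ?ys))"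
        using lists(1)[OF j] V by (intro sum_takeWhile_gain) auto
      then have "(unhit R (f j))\<^sup>2 \<le> 2 * (\<Sum>x\<in>V. unhit R (f j) - unhit (insert x R) (f j))"
        by (simp add: unhit_insert) (simp add: unhit_def)
      then have "real ((unhit R (f j))\<^sup>2) \<le> real (2 * (\<Sum>x\<in>V. unhit R (f j) - unhit (insert x R) (f j)))"
        by (rule of_nat_mono)
      then show "(real (unhit R (f j)))\<^sup>2 \<le> 2 * (\<Sum>x\<in>V. real (unhit R (f j)) - real (unhit (insert x R) (f j)))"
        by (simp add: of_nat_diff unhit_insert_le)
    qed
    also have "\<dots> = 2 * (\<Sum>x\<in>V. \<Sum>j\<in>J. real (unhit R (f j)) - real (unhit (insert x R) (f j)))"
      by (subst sum.swap) (simp add: sum_distrib_left)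
    also have "\<dots> = 2 * (\<Sum>x\<in>V. real (U R) - real (U (insert x R)))"
      by (simp add: U_def sum_subtractf)
    finally have main: "(real (U R))\<^sup>2 \<le> 2 * card J * (\<Sum>x\<in>V. real (U R) - real (U (insert x R)))"
      by (simp add: mult_ac mult_right_mono)
    obtain x where x: "x \<in> V" and x_max: "\<And>y. y \<in> V \<Longrightarrow> U (insert x R) \<le> U (insert y R)"
      using ex_has_least_nat[of "\<lambda>x. x \<in> V" _ "\<lambda>x. U (insert x R)"] False by blast
    have "(\<Sum>y\<in>V. real (U R) - real (U (insert y R))) \<le> of_nat (card V) * (real (U R) - real (U (insert x R)))"
      by (rule sum_bounded_above) (use x_max in auto)
    then have "2 * card J * (\<Sum>y\<in>V. real (U R) - real (U (insert y R)))
        \<le> 2 * card J * (card V * (real (U R) - real (U (insert x R))))"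
      by (intro mult_left_mono) auto
    with main have "(real (U R))\<^sup>2 \<le> real (2 * card J * card V) * (real (U R) - real (U (insert x R)))"
      by (simp add: algebra_simps)
    moreover have "real m * real (U R) \<le> real (2 * card J * card V)"
      using R(3) unfolding U_def[symmetric] by (metis of_nat_le_iff of_nat_mult)
    ultimately have "real (Suc m) * real (U (insert x R)) \<le> real (2 * card J * card V)"
      using le[of x] by (intro greedy_step_bound[of "real (U R)"]) auto
    then have "Suc m * U (insert x R) \<le> 2 * card J * card V"
      by (metis of_nat_le_iff of_nat_mult)
    moreover have "card (insert x R) \<le> Suc m"
      using R card_insert_le_m1[of "Suc m" R x] by simp
    ultimately show ?thesis
      using R x unfolding U_def by (intro exI[of _ "insert x R"]) auto
  qed
qed

section \<open>Pairwise preservers\<close>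

text \<open>These are the arcs before the first and after the last vertex of \<open>R\<close> on
  \<open>xs\<close>, including the arc that enters the first and the arc that leaves the last. If
  \<open>xs\<close> misses \<open>R\<close>, every arc is outer.\<close>

definition outer_arcs :: "'a set \<Rightarrow> 'a list \<Rightarrow> ('a \<times> 'a) set" where
  "outer_arcs R xs = (\<lambda>i. (xs ! i, xs ! Suc i)) `
     {i. Suc i < length xs \<and> (i < unhit R xs \<or> length xs \<le> Suc i + unhit R (rev xs))}"

definition inner_arcs :: "'a set \<Rightarrow> 'a list \<Rightarrow> ('a \<times> 'a) set" where
  "inner_arcs R xs = (\<lambda>i. (xs ! i, xs ! Suc i)) `
     {i. unhit R xs \<le> i \<and> Suc i + unhit R (rev xs) < length xs}"

lemma walk_arcs_outer_inner: "walk_arcs xs \<subseteq> outer_arcs R xs \<union> inner_arcs R xs"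
proof
  fix e assume "e \<in> walk_arcs xs"
  then obtain i where i: "e = (xs ! i, xs ! Suc i)" "Suc i < length xs"
    by (cases e) (auto simp: walk_arcs_nth_iff)
  show "e \<in> outer_arcs R xs \<union> inner_arcs R xs"
  proof (cases "i < unhit R xs \<or> length xs \<le> Suc i + unhit R (rev xs)")
    case True
    then have "e \<in> outer_arcs R xs" unfolding outer_arcs_def using i by (intro image_eqI[of _ _ i]) auto
    then show ?thesis ..
  next
    case False
    then have "e \<in> inner_arcs R xs" unfolding inner_arcs_def using i by (intro image_eqI[of _ _ i]) auto
    then show ?thesis ..
  qed
qed

lemma card_outer_arcs: "finite (outer_arcs R xs)" "card (outer_arcs R xs) \<le> unhit R xs + unhit R (rev xs)"
proof -
  let ?I = "{i. Suc i < length xs \<and> (i < unhit R xs \<or> length xs \<le> Suc i + unhit R (rev xs))}"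
  have sub: "?I \<subseteq> {..<unhit R xs} \<union> {length xs - Suc (unhit R (rev xs))..<length xs - 1}" by auto
  then have fin: "finite ?I" by (rule finite_subset) simp
  then show "finite (outer_arcs R xs)" unfolding outer_arcs_def by simp
  have "card (outer_arcs R xs) \<le> card ?I" unfolding outer_arcs_def by (rule card_image_le[OF fin])
  also have "\<dots> \<le> card ({..<unhit R xs} \<union> {length xs - Suc (unhit R (rev xs))..<length xs - 1})"
    by (rule card_mono[OF _ sub]) simp
  also have "\<dots> \<le> card {..<unhit R xs} + card {length xs - Suc (unhit R (rev xs))..<length xs - 1}"
    by (rule card_Un_le)
  also have "\<dots> \<le> unhit R xs + unhit R (rev xs)" by simp
  finally show "card (outer_arcs R xs) \<le> unhit R xs + unhit R (rev xs)" .
qed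

lemma rtrancl_through:
  assumes "(s, t) \<in> A\<^sup>*"
  shows "(s, t) \<in> {(x, y) \<in> A. (s, x) \<in> A\<^sup>* \<and> (y, t) \<in> A\<^sup>*}\<^sup>*"
proof -
  obtain xs where xs: "is_walk A s xs t" using ex_distinct_walk[OF assms] by metis
  have "walk_arcs xs \<subseteq> {(x, y) \<in> A. (s, x) \<in> A\<^sup>* \<and> (y, t) \<in> A\<^sup>*}"
  proof
    fix e assume e: "e \<in> walk_arcs xs"
    then have "fst e \<in> set xs" "snd e \<in> set xs" "e \<in> A"
      using walk_arcs_subset_set[of xs] xs by (auto simp: is_walk_def)
    then show "e \<in> {(x, y) \<in> A. (s, x) \<in> A\<^sup>* \<and> (y, t) \<in> A\<^sup>*}"
      using is_walk_reach_from[OF xs, of "fst e"] is_walk_reach_to[OF xs, of "snd e"]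
      by (cases e) simp
  qed
  then have "is_walk {(x, y) \<in> A. (s, x) \<in> A\<^sup>* \<and> (y, t) \<in> A\<^sup>*} s xs t"
    using xs by (simp add: is_walk_def)
  then show ?thesis by (rule is_walk_reach)
qed

text \<open>The first vertex of \<open>R\<close> on \<open>xs\<close> is still reached from
  \<open>s\<close>, so by \<open>no_hit\<close> it cannot reach \<open>t\<close>, and neither can
  any vertex from there up to the tail of \<open>e\<close>. Symmetrically, \<open>s\<close> reaches
  nothing from the head of \<open>e\<close> to the last vertex of \<open>R\<close>. Hence no inner
  arc lies on a surviving walk.\<close>

lemma avoid_inner_arcs:
  assumes xs: "is_walk E s xs t" "distinct xs"
    and e: "e \<in> inner_arcs R xs" and f: "f \<notin> walk_arcs xs"
    and st: "(s, t) \<in> (E - {e, f})\<^sup>*"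
    and no_hit: "\<And>x. x \<in> R \<Longrightarrow> (s, x) \<in> (E - {e, f})\<^sup>* \<Longrightarrow> (x, t) \<notin> (E - {e, f})\<^sup>*"
  shows "(s, t) \<in> (E - inner_arcs R xs - {f})\<^sup>*"
proof -
  let ?A = "E - {e, f}"
  define a where "a = unhit R xs"
  define l where "l = length xs - Suc (unhit R (rev xs))"
  from e obtain i where i: "e = (xs ! i, xs ! Suc i)" "a \<le> i" "Suc i + unhit R (rev xs) < length xs"
    by (auto simp: inner_arcs_def a_def)
  then have il: "Suc i \<le> l" "l < length xs" unfolding l_def by auto
  have arc: "(xs ! k, xs ! Suc k) \<in> ?A" if "Suc k < length xs" "k \<noteq> i" for k
  proof -
    have "(xs ! k, xs ! Suc k) \<in> walk_arcs xs" using that walk_arcs_nth_iff by metis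
    moreover have "xs ! k \<noteq> xs ! i" using that il xs(2) by (simp add: nth_eq_iff_index_eq)
    ultimately show ?thesis using f i xs(1) by (auto simp: is_walk_def)
  qed
  have seg: "(xs ! j, xs ! k) \<in> ?A\<^sup>*" if "j \<le> k" "k < length xs" "k \<le> i \<or> Suc i \<le> j" for j k
    using that by (intro nth_reach arc) auto
  have ends: "xs ! 0 = s" "xs ! (length xs - 1) = t"
    using xs(1) by (auto simp: is_walk_def hd_conv_nth last_conv_nth)
  have "xs ! a \<in> R" using i(2) il unfolding a_def by (intro unhit_nth) simp
  then have "(xs ! a, t) \<notin> ?A\<^sup>*"
    using no_hit seg[of 0 a] i(2) il ends by simp
  then have left: "(xs ! k, t) \<notin> ?A\<^sup>*" if "a \<le> k" "k \<le> i" for k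
    using seg[of a k] that il by (auto dest: rtrancl_trans)
  have "rev xs ! unhit R (rev xs) \<in> R" using i(3) by (intro unhit_nth) simp
  then have "xs ! l \<in> R" using i(3) by (simp add: rev_nth l_def)
  then have "(s, xs ! l) \<notin> ?A\<^sup>*"
    using no_hit[of "xs ! l"] seg[of l "length xs - 1"] il ends by auto
  then have right: "(s, xs ! k) \<notin> ?A\<^sup>*" if "Suc i \<le> k" "k \<le> l" for k
    using seg[of k l] that il by (auto dest: rtrancl_trans)
  have "{(x, y) \<in> ?A. (s, x) \<in> ?A\<^sup>* \<and> (y, t) \<in> ?A\<^sup>*} \<subseteq> E - inner_arcs R xs - {f}"
  proof
    fix g assume "g \<in> {(x, y) \<in> ?A. (s, x) \<in> ?A\<^sup>* \<and> (y, t) \<in> ?A\<^sup>*}"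
    then obtain x y where g: "g = (x, y)" "(x, y) \<in> ?A" "(s, x) \<in> ?A\<^sup>*" "(y, t) \<in> ?A\<^sup>*" by auto
    have "g \<notin> inner_arcs R xs"
    proof
      assume "g \<in> inner_arcs R xs"
      then obtain j where j: "x = xs ! j" "y = xs ! Suc j" "a \<le> j" "Suc j \<le> l"
        unfolding g inner_arcs_def a_def l_def by auto
      have "(x, t) \<in> ?A\<^sup>*" using g(2,4) by (rule converse_rtrancl_into_rtrancl)
      moreover have "(s, y) \<in> ?A\<^sup>*" using g(3,2) by (rule rtrancl_into_rtrancl)
      ultimately show False using left[of j] right[of "Suc j"] j by (cases "j \<le> i") auto
    qed
    then show "g \<in> E - inner_arcs R xs - {f}" using g by auto
  qed
  from rtrancl_in_mono[OF rtrancl_through[OF st] this] show ?thesis .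
qed

text \<open>The sets to be deleted before a pair of walks is chosen. Treating the inner arcs as a
  single set keeps their number at most two above the number of outer arcs.\<close>

definition removal_sets :: "'a set \<Rightarrow> 'a list \<Rightarrow> ('a \<times> 'a) set set" where
  "removal_sets R xs = insert {} (insert (inner_arcs R xs) ((\<lambda>e. {e}) ` outer_arcs R xs))"

lemma card_removal_sets:
  "finite (removal_sets R xs)" "card (removal_sets R xs) \<le> 2 + (unhit R xs + unhit R (rev xs))"
proof -
  show "finite (removal_sets R xs)" using card_outer_arcs(1)[of R xs] by (simp add: removal_sets_def)
  have "card (removal_sets R xs) \<le> Suc (Suc (card ((\<lambda>e. {e}) ` outer_arcs R xs)))"
    unfolding removal_sets_def
    by (rule order.trans[OF card_insert_le_m1]) (auto intro: card_insert_le_m1)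
  also have "card ((\<lambda>e. {e}) ` outer_arcs R xs) \<le> card (outer_arcs R xs)"
    by (rule card_image_le[OF card_outer_arcs(1)])
  also have "\<dots> \<le> unhit R xs + unhit R (rev xs)" by (rule card_outer_arcs)
  finally show "card (removal_sets R xs) \<le> 2 + (unhit R xs + unhit R (rev xs))" by simp
qed

definition bridge_disjoint :: "('a \<times> 'a) set \<Rightarrow> 'a \<Rightarrow> 'a \<Rightarrow> 'a list \<Rightarrow> 'a list \<Rightarrow> bool" where
  "bridge_disjoint E s t p q \<longleftrightarrow> is_walk E s p t \<and> distinct p \<and> is_walk E s q t \<and> distinct q \<and>
    (\<forall>e \<in> walk_arcs p \<inter> walk_arcs q. is_bridge E s t e)"

text \<open>If \<open>F\<close> spares a walk of the first pair, \<open>{}\<close> does. Otherwise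
  \<open>F = {e, f}\<close> with \<open>e\<close> on \<open>p {}\<close>, and it suffices to find a
  set \<open>D\<close> that contains \<open>e\<close> while \<open>f\<close> is no bridge of
  \<open>E - D\<close>: then a walk of the pair for \<open>D\<close> avoids both faults.\<close>

lemma removal_sets_suffice:
  assumes W: "\<And>D. (s, t) \<in> (E - D)\<^sup>* \<Longrightarrow> bridge_disjoint (E - D) s t (p D) (q D)"
    and F: "finite F" "card F \<le> 2" and st: "(s, t) \<in> (E - F)\<^sup>*"
    and no_hit: "\<And>x. x \<in> R \<Longrightarrow> (s, x) \<in> (E - F)\<^sup>* \<Longrightarrow> (x, t) \<notin> (E - F)\<^sup>*"
  shows "\<exists>D \<in> removal_sets R (p {}). (s, t) \<in> (E - D)\<^sup>* \<and>
    (is_walk (E - F) s (p D) t \<or> is_walk (E - F) s (q D) t)"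
proof (cases "walk_arcs (p {}) \<inter> F = {} \<or> walk_arcs (q {}) \<inter> F = {}")
  case True
  have E: "(s, t) \<in> (E - {})\<^sup>*" by (rule rtrancl_in_mono[OF st]) auto
  from W[OF this] True show ?thesis
    using E by (intro bexI[of _ "{}"]) (auto simp: bridge_disjoint_def is_walk_def removal_sets_def)
next
  case False
  have "(s, t) \<in> (E - {})\<^sup>*" by (rule rtrancl_in_mono[OF st]) auto
  note W0 = W[OF this]
  from False obtain e f where e: "e \<in> walk_arcs (p {})" "e \<in> F" and f: "f \<in> walk_arcs (q {})" "f \<in> F"
    by auto
  \<comment> \<open>The surviving walk shows that no fault is a bridge, so no single fault can hit
    both walks.\<close>
  have not_common: "g \<notin> walk_arcs (p {}) \<or> g \<notin> walk_arcs (q {})" if "g \<in> F" for g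
  proof (rule ccontr)
    assume "\<not> ?thesis"
    then have "(s, t) \<notin> (E - {g})\<^sup>*" using W0 by (auto simp: bridge_disjoint_def)
    moreover have "(s, t) \<in> (E - {g})\<^sup>*" by (rule rtrancl_in_mono[OF st]) (use that in auto)
    ultimately show False ..
  qed
  have ef: "e \<noteq> f" using not_common[OF e(2)] e f by auto
  have "{e, f} = F" by (rule card_seteq[OF F(1)]) (use F ef e f in auto)
  note F_eq = this[symmetric]
  have fp: "f \<notin> walk_arcs (p {})" using not_common[OF f(2)] f by auto
  have ok: ?thesis if D: "D \<in> removal_sets R (p {})" "e \<in> D" "(s, t) \<in> (E - D - {f})\<^sup>*" for D
  proof -
    have conn: "(s, t) \<in> (E - D)\<^sup>*" by (rule rtrancl_in_mono[OF D(3)]) auto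
    note WD = W[OF conn]
    have "f \<notin> walk_arcs (p D) \<or> f \<notin> walk_arcs (q D)"
      using WD D(3) by (auto simp: bridge_disjoint_def)
    then have "is_walk (E - F) s (p D) t \<or> is_walk (E - F) s (q D) t"
      using WD D(2) F_eq by (auto simp: bridge_disjoint_def is_walk_def)
    then show ?thesis using D(1) conn by auto
  qed
  show ?thesis
  proof (cases "e \<in> outer_arcs R (p {})")
    case True
    have "E - {e} - {f} = E - F" using F_eq by auto
    then show ?thesis using st True by (intro ok[of "{e}"]) (auto simp: removal_sets_def)
  next
    case False
    then have inner: "e \<in> inner_arcs R (p {})" using e walk_arcs_outer_inner[of "p {}" R] by auto
    have "(s, t) \<in> (E - inner_arcs R (p {}) - {f})\<^sup>*"
      using W0 st no_hit unfolding F_eq bridge_disjoint_def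
      by (intro avoid_inner_arcs[OF _ _ inner fp]) auto
    then show ?thesis using inner by (intro ok) (auto simp: removal_sets_def)
  qed
qed

text \<open>Multiplying by \<open>m * m\<close> avoids division and covers \<open>m = 0\<close>. The
  first summand pays for the preservers from and to the at most \<open>2 * m\<close> vertices of
  \<open>R\<close>, each with at most \<open>4 ^ 3 * card V\<close> arcs; the other two pay for the
  walks that miss \<open>R\<close>.\<close>

lemma pairwise_preserver:
  assumes V: "finite V" and E: "E \<subseteq> V \<times> V" and P: "P \<subseteq> V \<times> V"
  shows "\<exists>H. preserves 2 P E H \<and>
    m * m * card H \<le> 256 * m * m * m * card V + 8 * m * card P * card V + 16 * card P * (card V)\<^sup>2"
proof -
  let ?n = "card V"
  have finE: "finite E" and finP: "finite P" using V E P finite_subset by blast+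
  have "\<exists>w. (fst c, snd c) \<in> (E - D)\<^sup>* \<longrightarrow> bridge_disjoint (E - D) (fst c) (snd c) (fst w) (snd w)" for c D
    using two_walks[of "fst c" "snd c" "E - D"] unfolding bridge_disjoint_def by auto
  then obtain w where w: "(fst c, snd c) \<in> (E - D)\<^sup>* \<Longrightarrow>
      bridge_disjoint (E - D) (fst c) (snd c) (fst (w c D)) (snd (w c D))" for c D
    by metis
  define p where "p c D = fst (w c D)" for c D
  define q where "q c D = snd (w c D)" for c D
  define conn where "conn c D \<longleftrightarrow> (fst c, snd c) \<in> (E - D)\<^sup>*" for c D
  have W: "bridge_disjoint (E - D) s t (p (s, t) D) (q (s, t) D)" if "(s, t) \<in> (E - D)\<^sup>*" for s t D
    using w[of "(s, t)" D] that by (simp add: p_def q_def)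
  have walk_V: "set xs \<subseteq> V" if "is_walk (E - D) s xs t" "s \<in> V" for xs D s t
  proof
    fix x assume "x \<in> set xs"
    with that(1) have "(s, x) \<in> (E - D)\<^sup>*" by (rule is_walk_reach_from)
    then show "x \<in> V" by (rule rtrancl_closed) (use that E in auto)
  qed
  have pq: "distinct (p c D)" "set (p c D) \<subseteq> V" "distinct (q c D)" "set (q c D) \<subseteq> V"
    if "c \<in> P" "conn c D" for c D
  proof -
    obtain s t where c: "c = (s, t)" by (cases c)
    have "bridge_disjoint (E - D) s t (p c D) (q c D)" using W[of s t D] that c by (simp add: conn_def)
    moreover have "s \<in> V" using that c P by auto
    ultimately show "distinct (p c D)" "set (p c D) \<subseteq> V" "distinct (q c D)" "set (q c D) \<subseteq> V"
      using walk_V[of D s _ t] unfolding bridge_disjoint_def by simp_all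
  qed
  define P' where "P' = {c \<in> P. conn c {}}"
  have finP': "finite P'" and cardP': "card P' \<le> card P"
    using finP by (auto simp: P'_def intro: card_mono)
  \<comment> \<open>Each walk is listed in both directions, so that \<open>R1\<close> bounds the
    outer arcs at either end.\<close>
  define f where "f j = (if snd j then p (fst j) {} else rev (p (fst j) {}))" for j
  obtain R1 where R1: "R1 \<subseteq> V" "card R1 \<le> m"
    "m * (\<Sum>j\<in>P' \<times> UNIV. unhit R1 (f j)) \<le> 2 * card (P' \<times> (UNIV :: bool set)) * ?n"
  proof -
    have "distinct (f j)" "set (f j) \<subseteq> V" if "j \<in> P' \<times> UNIV" for j
      using that pq[of "fst j" "{}"] by (auto simp: f_def P'_def)
    then show thesis using hitting_set[OF V, of "P' \<times> UNIV" f m] finP' that by auto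
  qed
  define A where "A = (\<Sum>c\<in>P'. unhit R1 (p c {}) + unhit R1 (rev (p c {})))"
  have "(\<Sum>j\<in>P' \<times> UNIV. unhit R1 (f j)) = (\<Sum>c\<in>P'. \<Sum>b\<in>UNIV. unhit R1 (f (c, b)))"
    by (simp add: sum.cartesian_product)
  also have "\<dots> = A" by (simp add: f_def A_def UNIV_bool add.commute)
  finally have A: "m * A \<le> 4 * card P * ?n"
    using R1(3) cardP' by (simp add: card_cartesian_product) (meson le_trans mult_le_mono1 mult_le_mono2)
  define Ds where "Ds c = {D \<in> removal_sets R1 (p c {}). conn c D}" for c
  define Items where "Items = (\<Union>c\<in>P'. p c ` Ds c \<union> q c ` Ds c)"
  have finDs: "finite (Ds c)" for c using card_removal_sets(1)[of R1 "p c {}"] by (simp add: Ds_def)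
  have cardDs: "card (Ds c) \<le> 2 + (unhit R1 (p c {}) + unhit R1 (rev (p c {})))" for c
    unfolding Ds_def by (rule order.trans[OF card_mono card_removal_sets(2)])
      (auto simp: card_removal_sets(1))
  have finItems: "finite Items" using finP' finDs by (simp add: Items_def)
  have "card Items \<le> (\<Sum>c\<in>P'. card (p c ` Ds c \<union> q c ` Ds c))"
    unfolding Items_def by (rule card_UN_le[OF finP'])
  also have "\<dots> \<le> (\<Sum>c\<in>P'. 4 + 2 * (unhit R1 (p c {}) + unhit R1 (rev (p c {}))))"
  proof (rule sum_mono)
    fix c
    have "card (p c ` Ds c \<union> q c ` Ds c) \<le> card (p c ` Ds c) + card (q c ` Ds c)" by (rule card_Un_le)
    also have "\<dots> \<le> card (Ds c) + card (Ds c)" by (intro add_mono card_image_le finDs)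
    also have "\<dots> \<le> 4 + 2 * (unhit R1 (p c {}) + unhit R1 (rev (p c {})))" using cardDs[of c] by simp
    finally show "card (p c ` Ds c \<union> q c ` Ds c) \<le> \<dots>" .
  qed
  also have "\<dots> = 4 * card P' + 2 * A"
    unfolding A_def by (subst sum.distrib) (subst sum_distrib_left[symmetric], simp)
  finally have cardItems: "card Items \<le> 4 * card P + 2 * A" using cardP' by simp
  \<comment> \<open>\<open>Items\<close> depends on \<open>R1\<close> through
    \<open>removal_sets\<close>, so these walks need a hitting set of their own.\<close>
  obtain R2 where R2: "R2 \<subseteq> V" "card R2 \<le> m"
    "m * (\<Sum>xs\<in>Items. unhit R2 xs) \<le> 2 * card Items * ?n"
  proof -
    have "distinct xs \<and> set xs \<subseteq> V" if "xs \<in> Items" for xs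
    proof -
      from that obtain c D where "c \<in> P" "conn c D" "xs = p c D \<or> xs = q c D"
        by (auto simp: Items_def Ds_def P'_def)
      then show ?thesis using pq[of c D] by auto
    qed
    then show thesis using hitting_set[OF V finItems, of "\<lambda>xs. xs" m] that by auto
  qed
  define R where "R = R1 \<union> R2"
  have RV: "R \<subseteq> V" and finR: "finite R" using R1 R2 V finite_subset by (auto simp: R_def)
  have cardR: "card R \<le> 2 * m" using card_Un_le[of R1 R2] R1 R2 by (simp add: R_def)
  have "\<exists>H. preserves 2 ({x} \<times> UNIV) E H \<and> card H \<le> 64 * ?n" if "x \<in> V" for x
    by (rule single_source_preserver[OF V E that, of 2]) auto
  then obtain HS where HS: "preserves 2 ({x} \<times> UNIV) E (HS x)" "card (HS x) \<le> 64 * ?n"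
    if "x \<in> V" for x
    by metis
  have "\<exists>H. preserves 2 (UNIV \<times> {x}) E H \<and> card H \<le> 64 * ?n" if "x \<in> V" for x
    by (rule single_sink_preserver[OF V E that, of 2]) auto
  then obtain HT where HT: "preserves 2 (UNIV \<times> {x}) E (HT x)" "card (HT x) \<le> 64 * ?n"
    if "x \<in> V" for x
    by metis
  \<comment> \<open>Walks that meet \<open>R\<close> can be left out: if one of them survives
    \<open>F\<close>, then \<open>t\<close> is reachable through \<open>R\<close>, and the
    preservers for \<open>R\<close> keep that connection.\<close>
  define B where "B = {xs \<in> Items. set xs \<inter> R = {}}"
  define H where "H = (\<Union>x\<in>R. HS x \<union> HT x) \<union> (\<Union>xs\<in>B. walk_arcs xs)"
  have "preserves 2 P E H"
  proof (rule preservesI)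
    have "walk_arcs xs \<subseteq> E" if "xs \<in> Items" for xs
    proof -
      from that obtain s t D where "(s, t) \<in> (E - D)\<^sup>*" "xs = p (s, t) D \<or> xs = q (s, t) D"
        by (auto simp: Items_def Ds_def conn_def)
      with W[of s t D] show ?thesis by (auto simp: bridge_disjoint_def is_walk_def)
    qed
    moreover have "HS x \<subseteq> E \<and> HT x \<subseteq> E" if "x \<in> R" for x
      using HS(1)[of x, THEN preserves_subset] HT(1)[of x, THEN preserves_subset] that RV by auto
    ultimately show "H \<subseteq> E" unfolding H_def B_def by (intro Un_least UN_least) simp_all
  next
    fix s t F
    assume st: "(s, t) \<in> P" and F: "finite F" "card F \<le> 2" and reach: "(s, t) \<in> (E - F)\<^sup>*"
    show "(s, t) \<in> (H - F)\<^sup>*"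
    proof (cases "\<exists>x\<in>R. (s, x) \<in> (E - F)\<^sup>* \<and> (x, t) \<in> (E - F)\<^sup>*")
      case True
      then obtain x where x: "x \<in> R" "(s, x) \<in> (E - F)\<^sup>*" "(x, t) \<in> (E - F)\<^sup>*" by auto
      have xV: "x \<in> V" using x RV by auto
      have "(s, x) \<in> (HT x - F)\<^sup>*" by (rule preservesD[OF HT(1)[OF xV] _ F x(2)]) simp
      then have "(s, x) \<in> (H - F)\<^sup>*" by (rule rtrancl_in_mono) (use x in \<open>auto simp: H_def\<close>)
      moreover have "(x, t) \<in> (HS x - F)\<^sup>*" by (rule preservesD[OF HS(1)[OF xV] _ F x(3)]) simp
      then have "(x, t) \<in> (H - F)\<^sup>*" by (rule rtrancl_in_mono) (use x in \<open>auto simp: H_def\<close>)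
      ultimately show ?thesis by (rule rtrancl_trans)
    next
      case False
      then have no_hit: "(x, t) \<notin> (E - F)\<^sup>*" if "x \<in> R" "(s, x) \<in> (E - F)\<^sup>*" for x
        using that by simp
      have "(s, t) \<in> (E - {})\<^sup>*" by (rule rtrancl_in_mono[OF reach]) auto
      then have c: "(s, t) \<in> P'" using st by (simp add: P'_def conn_def)
      have "\<exists>D \<in> removal_sets R1 (p (s, t) {}). (s, t) \<in> (E - D)\<^sup>* \<and>
          (is_walk (E - F) s (p (s, t) D) t \<or> is_walk (E - F) s (q (s, t) D) t)"
        by (rule removal_sets_suffice[OF W F reach]) (use no_hit in \<open>auto simp: R_def\<close>)
      then obtain D xs where D: "D \<in> removal_sets R1 (p (s, t) {})" "(s, t) \<in> (E - D)\<^sup>*"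
        "xs = p (s, t) D \<or> xs = q (s, t) D" and xs: "is_walk (E - F) s xs t" by auto
      have "D \<in> Ds (s, t)" using D by (simp add: Ds_def conn_def)
      then have "xs \<in> Items" using D(3) c unfolding Items_def by auto
      moreover have "set xs \<inter> R = {}"
      proof (rule ccontr)
        assume "set xs \<inter> R \<noteq> {}"
        then obtain x where "x \<in> set xs" "x \<in> R" by auto
        then show False
          using no_hit[of x] is_walk_reach_from[OF xs, of x] is_walk_reach_to[OF xs, of x] by simp
      qed
      ultimately have "walk_arcs xs \<subseteq> H" unfolding H_def B_def by auto
      then have "is_walk (H - F) s xs t" using xs by (auto simp: is_walk_def)
      then show ?thesis by (rule is_walk_reach)
    qed
  qed
  moreover have "m * m * card H \<le> 256 * m * m * m * ?n + 8 * m * card P * ?n + 16 * card P * ?n\<^sup>2"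
  proof -
    have "card (\<Union>x\<in>R. HS x \<union> HT x) \<le> (\<Sum>x\<in>R. card (HS x \<union> HT x))" by (rule card_UN_le[OF finR])
    also have "\<dots> \<le> (\<Sum>x\<in>R. 128 * ?n)"
    proof (rule sum_mono)
      fix x assume "x \<in> R"
      then have "x \<in> V" using RV by auto
      then show "card (HS x \<union> HT x) \<le> 128 * ?n"
        using card_Un_le[of "HS x" "HT x"] HS(2)[of x] HT(2)[of x] by linarith
    qed
    also have "\<dots> \<le> 2 * m * (128 * ?n)" using mult_right_mono[OF cardR, of "128 * ?n"] by simp
    finally have 1: "card (\<Union>x\<in>R. HS x \<union> HT x) \<le> 256 * m * ?n" by simp
    have finB: "finite B" using finItems by (simp add: B_def)
    have "card (\<Union>xs\<in>B. walk_arcs xs) \<le> (\<Sum>xs\<in>B. card (walk_arcs xs))" by (rule card_UN_le[OF finB])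
    also have "\<dots> \<le> (\<Sum>xs\<in>B. unhit R2 xs)"
    proof (rule sum_mono)
      fix xs assume "xs \<in> B"
      then have "unhit R2 xs = length xs" by (intro unhit_disjoint) (auto simp: B_def R_def)
      then show "card (walk_arcs xs) \<le> unhit R2 xs" using card_walk_arcs[of xs] by simp
    qed
    also have "\<dots> \<le> (\<Sum>xs\<in>Items. unhit R2 xs)"
      by (rule sum_mono2[OF finItems]) (auto simp: B_def)
    finally have 2: "card (\<Union>xs\<in>B. walk_arcs xs) \<le> (\<Sum>xs\<in>Items. unhit R2 xs)" (is "_ \<le> ?S") .
    have "m * ?S \<le> 2 * (4 * card P + 2 * A) * ?n"
      by (rule order.trans[OF R2(3)]) (intro mult_right_mono mult_left_mono cardItems, auto)
    \<comment> \<open>One factor \<open>m\<close> was spent on \<open>R2\<close>; the second one is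
      spent on \<open>A\<close>, by the choice of \<open>R1\<close>.\<close>
    then have "m * (m * ?S) \<le> m * (2 * (4 * card P + 2 * A) * ?n)" by (rule mult_left_mono) simp
    also have "\<dots> = 8 * m * card P * ?n + 4 * (m * A) * ?n" by (simp add: algebra_simps)
    also have "\<dots> \<le> 8 * m * card P * ?n + 4 * (4 * card P * ?n) * ?n"
      by (intro add_left_mono mult_right_mono mult_left_mono A) auto
    finally have 3: "m * m * ?S \<le> 8 * m * card P * ?n + 16 * card P * ?n\<^sup>2"
      by (simp add: power2_eq_square mult.assoc)
    have "card H \<le> 256 * m * ?n + ?S"
      unfolding H_def using card_Un_le[of "\<Union>x\<in>R. HS x \<union> HT x" "\<Union>xs\<in>B. walk_arcs xs"] 1 2 by linarith
    then have "m * m * card H \<le> m * m * (256 * m * ?n + ?S)" by (rule mult_left_mono) simp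
    also have "\<dots> = 256 * m * m * m * ?n + m * m * ?S" by (simp add: algebra_simps)
    finally show ?thesis using 3 by linarith
  qed
  ultimately show ?thesis by blast
qed

text \<open>The choice of \<open>m\<close> balances the two contributions \<open>m * n\<close> and \<open>p * (n / m)\<^sup>2\<close>.\<close>

lemma cube_root_balance:
  fixes n p m :: nat
  defines "z \<equiv> (real n * real p) powr (1/3)"
  assumes "p > 0" "n > 0" "p \<le> n\<^sup>2" and m: "m = nat \<lceil>z\<rceil>"
    and h: "m * m * h \<le> 256 * m * m * m * n + 8 * m * p * n + 16 * p * n\<^sup>2"
  shows "real h \<le> 536 * real n powr (4/3) * real p powr (1/3)"
proof -
  have z3: "z * z * z = real n * real p"
  proof -
    have "z * z * z = (real n * real p) powr (1/3 + 1/3 + 1/3)" unfolding z_def powr_add by simp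
    then show ?thesis by simp
  qed
  have "1 \<le> real n * real p" using assms(2,3) by (metis of_nat_1 of_nat_le_iff of_nat_mult nat_0_less_mult_iff Suc_leI One_nat_def)
  then have z1: "1 \<le> z" unfolding z_def by (intro ge_one_powr_ge_zero) auto
  have "real n * real p \<le> real n ^ 3"
    using assms(4) by (simp add: power2_eq_square power3_eq_cube mult_left_mono flip: of_nat_mult)
  then have "z \<le> (real n ^ 3) powr (1/3)" unfolding z_def by (intro powr_mono2) auto
  also have "real n ^ 3 = real n powr 3" using assms(3) by simp
  also have "(real n powr 3) powr (1/3) = real n" unfolding powr_powr using assms(3) by simp
  finally have zn: "z \<le> real n" .
  \<comment> \<open>Rounding up at most doubles \<open>z\<close>, because
    \<open>z \<ge> 1\<close>.\<close>
  have mz: "z \<le> real m" "real m \<le> 2 * z" using z1 unfolding m by linarith+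
  \<comment> \<open>This consequence of \<open>p \<le> n\<^sup>2\<close> lets the term
    \<open>8 * m * p * n\<close> be absorbed by a multiple of \<open>p * n\<^sup>2\<close>.\<close>
  have mn: "real m \<le> real n" using zn unfolding m by (simp add: ceiling_le_iff nat_le_iff)
  have m0: "real m > 0" using mz z1 by linarith
  have "real (m * m * h) \<le> real (256 * m * m * m * n + 8 * m * p * n + 16 * p * n\<^sup>2)"
    using h by (rule of_nat_mono)
  then have "real m * real m * real h \<le>
      256 * real m * real m * real m * real n + 8 * real m * (real n * real p) + 16 * (real n * real p) * real n"
    by (simp add: power2_eq_square algebra_simps)
  also have "\<dots> \<le> 256 * real m * real m * real m * real n + 24 * (real n * real p) * real n"
    using mn mult_right_mono[OF mn, of "8 * (real n * real p)"] by (simp add: algebra_simps)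
  finally have "real m * real m * real h \<le> 256 * real m * real m * real m * real n + 24 * (real n * real p) * real n" .
  moreover have "(real n * real p) * real n \<le> (real m * real m * z) * real n"
    unfolding z3[symmetric] using mz z1 by (intro mult_right_mono mult_mono) auto
  moreover have "(real m * real m) * (real m * real n) \<le> (real m * real m) * (2 * z * real n)"
    using mz by (intro mult_right_mono mult_left_mono) auto
  \<comment> \<open>\<open>536 = 2 * 256 + 24\<close>, the factor \<open>2\<close> coming from
    \<open>m \<le> 2 * z\<close>.\<close>
  ultimately have "real m * real m * real h \<le> real m * real m * (536 * (real n * z))"
    by (simp add: algebra_simps)
  then have "real h \<le> 536 * (real n * z)" using m0 by (simp add: mult_le_cancel_left)
  also have "real n * z = real n powr (4/3) * real p powr (1/3)"
  proof -
    have "real n powr (4/3) = real n powr (1 + 1/3)" by simp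
    also have "\<dots> = real n * real n powr (1/3)" using assms(3) unfolding powr_add by simp
    finally show ?thesis unfolding z_def by (simp add: powr_mult)
  qed
  finally show ?thesis by simp
qed

theorem pairwise_preserver_size:
  assumes V: "finite V" and E: "E \<subseteq> V \<times> V" and P: "P \<subseteq> V \<times> V"
  shows "\<exists>H. preserves 2 P E H \<and>
    real (card H) \<le> 536 * real (card V) powr (4/3) * real (card P) powr (1/3)"
proof (cases "P = {}")
  case True
  \<comment> \<open>\<open>0 powr (1/3)\<close> is \<open>0\<close>, so the bound forces an empty
    arc set.\<close>
  then show ?thesis by (intro exI[of _ "{}"]) (simp add: preserves_def)
next
  case False
  have finP: "finite P" using V P finite_subset by blast
  then have "card P > 0" using False by (simp add: card_gt_0_iff)
  moreover have "card V > 0" using False P V by (auto simp: card_gt_0_iff)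
  moreover have "card P \<le> (card V)\<^sup>2"
    using card_mono[OF _ P] V by (simp add: card_cartesian_product power2_eq_square)
  ultimately show ?thesis
    using pairwise_preserver[OF assms, of "nat \<lceil>(real (card V) * real (card P)) powr (1/3)\<rceil>"]
      cube_root_balance by blast
qed

section \<open>Reasoning about programs\<close>

fun writes :: "com \<Rightarrow> nat set" where
  "writes Skip = {}"
| "writes (Set_const x k) = {x}"
| "writes (Add x y z) = {x}"
| "writes (Sub x y z) = {x}"
| "writes (Load x y) = {x}"
| "writes (Store x y) = {}"
| "writes (Seq c1 c2) = writes c1 \<union> writes c2"
| "writes (Cond x c1 c2) = writes c1 \<union> writes c2"
| "writes (While x c) = writes c"

lemma exec_frame: "exec c s t s' \<Longrightarrow> x \<notin> writes c \<Longrightarrow> fst s' x = fst s x"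
  by (induction rule: exec.induct) auto

definition frame :: "com \<Rightarrow> (nat \<Rightarrow> nat) \<Rightarrow> (nat \<Rightarrow> nat) \<Rightarrow> bool" where
  "frame c r r' \<longleftrightarrow> (\<forall>x. x \<notin> writes c \<longrightarrow> r' x = r x)"

lemma frameD: "frame c r r' \<Longrightarrow> x \<notin> writes c \<Longrightarrow> r' x = r x"
  by (simp add: frame_def)

definition runs :: "com \<Rightarrow> state \<Rightarrow> nat \<Rightarrow> ((nat \<Rightarrow> nat) \<Rightarrow> (nat \<Rightarrow> nat) \<Rightarrow> bool) \<Rightarrow> bool" where
  "runs c s T Q \<longleftrightarrow> (\<exists>t r' m'. exec c s t (r', m') \<and> t \<le> T \<and> Q r' m')"

lemma runs_frame: "runs c (r, m) T Q \<Longrightarrow> runs c (r, m) T (\<lambda>r' m'. Q r' m' \<and> frame c r r')"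
  unfolding runs_def frame_def using exec_frame by fastforce

lemma runs_weaken:
  assumes "runs c (r, m) T Q" "T \<le> T'" "\<And>r' m'. Q r' m' \<Longrightarrow> frame c r r' \<Longrightarrow> Q' r' m'"
  shows "runs c (r, m) T' Q'"
  using runs_frame[OF assms(1)] assms(2,3) unfolding runs_def by (meson le_trans)

lemma runs_time: "runs c s T Q \<Longrightarrow> T \<le> T' \<Longrightarrow> runs c s T' Q"
  unfolding runs_def by (meson le_trans)

lemma runs_Seq:
  assumes "runs c1 (r, m) T1 Q1"
    and "\<And>r' m'. Q1 r' m' \<Longrightarrow> frame c1 r r' \<Longrightarrow> runs c2 (r', m') T2 Q"
  shows "runs (Seq c1 c2) (r, m) (T1 + T2) Q"
proof -
  obtain t1 r1 m1 where 1: "exec c1 (r, m) t1 (r1, m1)" "t1 \<le> T1" "Q1 r1 m1" "frame c1 r r1"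
    using runs_frame[OF assms(1)] unfolding runs_def by blast
  obtain t2 r2 m2 where 2: "exec c2 (r1, m1) t2 (r2, m2)" "t2 \<le> T2" "Q r2 m2"
    using assms(2)[OF 1(3,4)] unfolding runs_def by blast
  show ?thesis unfolding runs_def using exec.Seq[OF 1(1) 2(1)] 1(2) 2(2,3) add_mono by blast
qed

lemma runs_atom:
  "Q r m \<Longrightarrow> runs Skip (r, m) 1 Q"
  "Q (r(x := k)) m \<Longrightarrow> runs (Set_const x k) (r, m) 1 Q"
  "Q (r(x := r y + r z)) m \<Longrightarrow> runs (Add x y z) (r, m) 1 Q"
  "Q (r(x := r y - r z)) m \<Longrightarrow> runs (Sub x y z) (r, m) 1 Q"
  "Q (r(x := m (r y))) m \<Longrightarrow> runs (Load x y) (r, m) 1 Q"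
  "Q r (m(r x := r y)) \<Longrightarrow> runs (Store x y) (r, m) 1 Q"
  unfolding runs_def by (blast intro: exec.intros le_refl)+

lemma runs_step:
  "runs c (r(x := k), m) T Q \<Longrightarrow> runs (Seq (Set_const x k) c) (r, m) (Suc T) Q"
  "runs c (r(x := r y + r z), m) T Q \<Longrightarrow> runs (Seq (Add x y z) c) (r, m) (Suc T) Q"
  "runs c (r(x := r y - r z), m) T Q \<Longrightarrow> runs (Seq (Sub x y z) c) (r, m) (Suc T) Q"
  "runs c (r(x := m (r y)), m) T Q \<Longrightarrow> runs (Seq (Load x y) c) (r, m) (Suc T) Q"
  "runs c (r, m(r x := r y)) T Q \<Longrightarrow> runs (Seq (Store x y) c) (r, m) (Suc T) Q"
  unfolding runs_def
  using exec.Seq[OF exec.Set_const] exec.Seq[OF exec.Add] exec.Seq[OF exec.Sub]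
    exec.Seq[OF exec.Load] exec.Seq[OF exec.Store] by fastforce+

lemma runs_Cond:
  assumes "r x \<noteq> 0 \<Longrightarrow> runs c1 (r, m) T1 Q" "r x = 0 \<Longrightarrow> runs c2 (r, m) T2 Q"
  shows "runs (Cond x c1 c2) (r, m) (Suc (max T1 T2)) Q"
proof (cases "r x = 0")
  case True
  then show ?thesis using assms(2) exec.Cond_false[of r x c2 m] unfolding runs_def by fastforce
next
  case False
  then show ?thesis using assms(1) exec.Cond_true[of r x c1 m] unfolding runs_def by fastforce
qed

text \<open>Register \<open>d\<close> is scratch and may be shared by nested loops; register \<open>one\<close> has to hold \<open>1\<close>.\<close>

definition For :: "nat \<Rightarrow> nat \<Rightarrow> nat \<Rightarrow> nat \<Rightarrow> com \<Rightarrow> com" where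
  "For one d i n b = Seq (Set_const i 0) (Seq (Sub d n i)
     (While d (Seq b (Seq (Add i i one) (Sub d n i)))))"

lemma writes_For [simp]: "writes (For one d i n b) = {i, d} \<union> writes b"
  by (auto simp: For_def)

lemma runs_While:
  assumes body: "\<And>k r m. k < N \<Longrightarrow> J k r m \<Longrightarrow> runs c (r, m) T (J (Suc k))"
    and guard: "\<And>k r m. J k r m \<Longrightarrow> r d = N - k"
    and "k \<le> N" "J k r m"
  shows "runs (While d c) (r, m) ((N - k) * Suc T + 1) (J N)"
  using assms(3,4)
proof (induction "N - k" arbitrary: k r m)
  case 0
  then have "k = N" by simp
  with 0 guard[of k r m] exec.While_false[of r d c m] show ?case
    unfolding runs_def by fastforce
next
  case (Suc l)
  then have k: "k < N" by simp
  obtain t1 r1 m1 where 1: "exec c (r, m) t1 (r1, m1)" "t1 \<le> T" "J (Suc k) r1 m1"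
    using body[OF k Suc.prems(2)] unfolding runs_def by blast
  have "runs (While d c) (r1, m1) ((N - Suc k) * Suc T + 1) (J N)"
    using Suc.hyps(2) k 1(3) by (intro Suc.hyps(1)) auto
  then obtain t2 r2 m2 where 2: "exec (While d c) (r1, m1) t2 (r2, m2)"
    "t2 \<le> (N - Suc k) * Suc T + 1" "J N r2 m2"
    unfolding runs_def by blast
  have "r d \<noteq> 0" using guard[OF Suc.prems(2)] k by simp
  note exec.While_true[OF this 1(1) 2(1)]
  moreover have "N - k = Suc (N - Suc k)" using k by simp
  then have "Suc (t1 + t2) \<le> (N - k) * Suc T + 1" using 1(2) 2(2) by simp
  ultimately show ?case unfolding runs_def using 2(3) by blast
qed

text \<open>An iteration costs the body, two updates and a guard; the final \<open>3\<close> counts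
  the two initial assignments and the failing guard. The invariant must be \<open>stable\<close>
  since the loop itself changes \<open>i\<close> and \<open>d\<close> outside the body.\<close>

lemma runs_For:
  assumes regs: "r n = N" "r one = 1" "n \<notin> {i, d} \<union> writes b" "one \<notin> {i, d} \<union> writes b"
      "i \<notin> writes b" "i \<noteq> d"
    and start: "I 0 r m"
    and body: "\<And>k r' m'. k < N \<Longrightarrow> I k r' m' \<Longrightarrow> r' i = k \<Longrightarrow>
        (\<And>x. x \<noteq> i \<Longrightarrow> x \<noteq> d \<Longrightarrow> x \<notin> writes b \<Longrightarrow> r' x = r x) \<Longrightarrow>
        runs b (r', m') T (I (Suc k))"
    and stable: "\<And>k r' m' v w. I k r' m' \<Longrightarrow> I k (r'(i := v, d := w)) m'"
  shows "runs (For one d i n b) (r, m) (N * (T + 3) + 3) (I N)"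
proof -
  define J where "J k r' m' \<longleftrightarrow> I k r' m' \<and> r' i = k \<and> r' d = N - k \<and>
    (\<forall>x. x \<noteq> i \<longrightarrow> x \<noteq> d \<longrightarrow> x \<notin> writes b \<longrightarrow> r' x = r x)" for k r' m'
  let ?c = "Seq b (Seq (Add i i one) (Sub d n i))"
  have body': "runs ?c (r', m') (T + 2) (J (Suc k))" if k: "k < N" and J: "J k r' m'" for k r' m'
  proof (rule runs_Seq)
    show "runs b (r', m') T (I (Suc k))" using J k by (intro body) (auto simp: J_def)
    fix r'' m'' assume I: "I (Suc k) r'' m''" and f: "frame b r' r''"
    have "runs (Seq (Add i i one) (Sub d n i)) (r'', m'') (Suc 1) (J (Suc k))"
      using J k regs f I by (intro runs_step runs_atom) (auto simp: J_def frame_def intro!: stable)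
    then show "runs (Seq (Add i i one) (Sub d n i)) (r'', m'') 2 (J (Suc k))"
      by (simp add: numeral_2_eq_2)
  qed
  have "J 0 (r(i := 0, d := r n - 0)) m"
    unfolding J_def using stable[OF start, of 0 "r n"] regs by simp
  then have "runs (While d ?c) (r(i := 0, d := r n - 0), m) ((N - 0) * Suc (T + 2) + 1) (J N)"
  proof (rule runs_While[where J = J, rotated 3])
    show "runs ?c (r', m') (T + 2) (J (Suc k))" if "k < N" "J k r' m'" for k r' m'
      using that by (rule body')
  qed (auto simp: J_def)
  then have "runs (While d ?c) (r(i := 0, d := r n - 0), m) (N * (T + 3) + 1) (I N)"
    unfolding runs_def J_def by (auto simp: numeral_3_eq_3)
  then have "runs (For one d i n b) (r, m) (Suc (Suc (N * (T + 3) + 1))) (I N)"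
    unfolding For_def using regs by (intro runs_step) simp
  then show ?thesis by (simp add: numeral_3_eq_3)
qed

section \<open>The pruning program\<close>

definition arcs_at :: "nat \<Rightarrow> (nat \<Rightarrow> nat) \<Rightarrow> (nat \<times> nat) set" where
  "arcs_at n m = {(u, v). u < n \<and> v < n \<and> m (Suc (u * n + v)) \<noteq> 0}"

definition marks :: "nat \<Rightarrow> nat \<Rightarrow> (nat \<Rightarrow> nat) \<Rightarrow> nat set" where
  "marks n B m = {v. v < n \<and> m (B + v) \<noteq> 0}"

text \<open>Cells from \<open>B\<close> on hold only marks of the search, so a subroutine that
  leaves everything below \<open>B\<close> as it was counts as free of side effects.\<close>

definition agree :: "nat \<Rightarrow> (nat \<Rightarrow> nat) \<Rightarrow> (nat \<Rightarrow> nat) \<Rightarrow> bool" where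
  "agree B m m' \<longleftrightarrow> (\<forall>a<B. m' a = m a)"

text \<open>
  Memory layout: cell \<open>0\<close> holds \<open>n\<close>, the next \<open>n * n\<close> cells the arcs, the next \<open>n * n\<close> cells the pairs,
  and from address \<open>B = 2 * n * n + 1\<close> on there are \<open>n\<close> cells of marks for the reachability search.

  Constant registers: 0 holds \<open>1\<close>, 1 holds \<open>n\<close>, 2 holds \<open>n * n\<close>, 4 holds \<open>B\<close>, 5 holds \<open>n * n + 1\<close>, and
  9 holds \<open>0\<close>. Register 3 is the scratch register of all loops. Further: 10 and 11 are the current
  pair; 12, 13, 14 the loop variables and 15 the cell pointer of the search, whose answer is put in 19;
  20 counts the arcs, 21 is the cell of the current arc and 22 the flag that it is critical; 25 points
  to the current pair; 26 and 27 are the cells of the two faults; 28 to 30 save cells that are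
  temporarily cleared; 31 keeps the first answer; 16, 17, 18 and 32 are auxiliary.
\<close>

definition relax :: com where
  "relax = Seq (Load 16 15) (Seq
     (Cond 16 (Seq (Add 17 4 14) (Seq (Load 17 17) (Cond 17 (Seq (Add 18 4 12) (Store 18 0)) Skip))) Skip)
     (Add 15 15 0))"

text \<open>Register 15 moves through the matrix row by row in step with the loops, as the machine
  cannot multiply to compute \<open>u * n + v\<close>.\<close>

definition round_prog :: com where
  "round_prog = Seq (Set_const 15 1) (For 0 3 14 1 (For 0 3 12 1 relax))"

text \<open>\<open>n * n\<close> rounds suffice because a reachable vertex is reached in at most as
  many steps as there are arcs.\<close>

definition reach_prog :: com where
  "reach_prog =
     Seq (For 0 3 12 1 (Seq (Add 16 4 12) (Store 16 9)))
    (Seq (Add 16 4 10) (Seq (Store 16 0)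
    (Seq (For 0 3 13 2 round_prog)
    (Seq (Add 16 4 11) (Load 19 16)))))"

lemma writes_relax: "x \<in> writes relax \<longleftrightarrow> x = 15 \<or> x = 16 \<or> x = 17 \<or> x = 18"
  unfolding relax_def writes.simps Un_iff insert_iff empty_iff by argo

lemma writes_round: "x \<in> writes round_prog \<longleftrightarrow>
    x = 3 \<or> x = 12 \<or> x = 14 \<or> x = 15 \<or> x = 16 \<or> x = 17 \<or> x = 18"
  unfolding round_prog_def writes.simps writes_For writes_relax Un_iff insert_iff empty_iff by argo

lemma writes_reach: "x \<in> writes reach_prog \<longleftrightarrow>
    x = 3 \<or> x = 12 \<or> x = 13 \<or> x = 14 \<or> x = 15 \<or> x = 16 \<or> x = 17 \<or> x = 18 \<or> x = 19"
  unfolding reach_prog_def writes.simps writes_For writes_round Un_iff insert_iff empty_iff by argo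

lemma cell_less:
  fixes u v n :: nat
  assumes "u < n" "v < n"
  shows "u * n + v < n * n"
proof -
  have "u * n + v < Suc u * n" using assms by simp
  also have "\<dots> \<le> n * n" using assms by (intro mult_le_mono1) simp
  finally show ?thesis .
qed

lemma runs_relax:
  assumes "r 0 = 1" "r 15 = c" "r 14 = u" "r 12 = v" "r 4 = B"
  shows "runs relax (r, m) 8 (\<lambda>r' m'. r' 15 = Suc c \<and>
    m' = (if m c \<noteq> 0 \<and> m (B + u) \<noteq> 0 then m(B + v := 1) else m))"
  unfolding relax_def
  apply (rule runs_time)
   apply (rule runs_step)
   apply (rule runs_Seq)
    apply (rule runs_Cond)
     apply (rule runs_step)
     apply (rule runs_step)
     apply (rule runs_Cond)
      apply (rule runs_step)
      \<comment> \<open>This fixes the assertion between the conditional and the increment of the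
        pointer, so far schematic, for all branches.\<close>
      apply (rule runs_atom(6)[where Q = "\<lambda>r' m'. r' 15 = c \<and> r' 0 = 1 \<and>
          m' = (if m c \<noteq> 0 \<and> m (B + u) \<noteq> 0 then m(B + v := 1) else m)"])
  using assms apply simp
     apply (rule runs_atom)
  using assms apply simp
    apply (rule runs_atom)
  using assms apply simp
   apply (rule runs_atom)
   apply simp
  apply simp
  done

text \<open>The marks are only sandwiched: they are updated in place, so one round may advance by
  several arcs. \<open>M\<close> grows with the rounds, while \<open>C\<close> is a fixed closed
  set.\<close>

definition flood_inv ::
  "nat \<Rightarrow> nat \<Rightarrow> (nat \<Rightarrow> nat) \<Rightarrow> nat set \<Rightarrow> nat set \<Rightarrow> (nat \<Rightarrow> nat) \<Rightarrow> bool" where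
  "flood_inv n B m0 M C m \<longleftrightarrow> agree B m0 m \<and> M \<subseteq> marks n B m \<and> marks n B m \<subseteq> C"

definition round_time :: "nat \<Rightarrow> nat" where
  "round_time n = Suc (n * (n * (8 + 3) + 3 + 3) + 3)"

lemma runs_round:
  assumes regs: "r 0 = 1" "r 1 = n" "r 4 = B" and B: "n * n < B"
    and inv: "flood_inv n B m0 M C m"
    and closed: "\<And>u v. (u, v) \<in> arcs_at n m0 \<Longrightarrow> u \<in> C \<Longrightarrow> v \<in> C"
  shows "runs round_prog (r, m) (round_time n)
    (\<lambda>r' m'. flood_inv n B m0 (M \<union> arcs_at n m0 `` M) C m')"
proof -
  let ?E = "arcs_at n m0"
  define I where "I u v r' m' \<longleftrightarrow> r' 15 = Suc (u * n + v) \<and> flood_inv n B m0 M C m' \<and>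
    (\<forall>x y. (x, y) \<in> ?E \<longrightarrow> x \<in> M \<longrightarrow> x < u \<or> x = u \<and> y < v \<longrightarrow> y \<in> marks n B m')" for u v m' and r' :: "nat \<Rightarrow> nat"
  have step: "runs relax (r', m') 8 (I u (Suc v))"
    if I: "I u v r' m'" and uv: "u < n" "v < n" and r': "r' 0 = 1" "r' 14 = u" "r' 12 = v" "r' 4 = B"
    for u v r' m'
  proof (rule runs_weaken)
    have pc: "r' 15 = Suc (u * n + v)" using I by (simp add: I_def)
    show "runs relax (r', m') 8 (\<lambda>r'' m''. r'' 15 = Suc (Suc (u * n + v)) \<and>
      m'' = (if m' (Suc (u * n + v)) \<noteq> 0 \<and> m' (B + u) \<noteq> 0 then m'(B + v := 1) else m'))"
      by (rule runs_relax[OF r'(1) pc r'(2-4)])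
  next
    fix r'' m'' :: "nat \<Rightarrow> nat" assume post: "r'' 15 = Suc (Suc (u * n + v)) \<and>
      m'' = (if m' (Suc (u * n + v)) \<noteq> 0 \<and> m' (B + u) \<noteq> 0 then m'(B + v := 1) else m')"
    have cell: "m' (Suc (u * n + v)) = m0 (Suc (u * n + v))"
      using I cell_less[OF uv] B by (auto simp: I_def flood_inv_def agree_def)
    let ?c = "m' (Suc (u * n + v)) \<noteq> 0 \<and> m' (B + u) \<noteq> 0"
    have marks': "marks n B m'' = (if ?c then insert v (marks n B m') else marks n B m')"
      using post uv by (auto simp: marks_def)
    have uv_E: "(u, v) \<in> ?E \<longleftrightarrow> m' (Suc (u * n + v)) \<noteq> 0" using uv cell by (simp add: arcs_at_def)
    have u_mark: "u \<in> marks n B m' \<longleftrightarrow> m' (B + u) \<noteq> 0" using uv by (simp add: marks_def)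
    have "agree B m0 m''" using I post by (auto simp: I_def flood_inv_def agree_def)
    moreover have "marks n B m'' \<subseteq> C"
      using I closed[of u v] marks' uv_E u_mark by (auto simp: I_def flood_inv_def)
    moreover have "M \<subseteq> marks n B m''" using I marks' by (auto simp: I_def flood_inv_def)
    moreover have "y \<in> marks n B m''"
      if "(x, y) \<in> ?E" "x \<in> M" "x < u \<or> x = u \<and> y < Suc v" for x y
    proof (cases "x = u \<and> y = v")
      case True
      then have "?c" using that uv_E u_mark I by (auto simp: I_def flood_inv_def)
      then show ?thesis using True marks' by simp
    next
      case False
      then have "y \<in> marks n B m'" using that I unfolding I_def by auto
      then show ?thesis using marks' by auto
    qed
    ultimately show "I u (Suc v) r'' m''" using post by (simp add: I_def flood_inv_def)
  qed simp
  have row: "runs (For 0 3 12 1 relax) (r', m') (n * (8 + 3) + 3) (I (Suc u) 0)"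
    if I: "I u 0 r' m'" and u: "u < n" and r': "r' 0 = 1" "r' 14 = u" "r' 4 = B" "r' 1 = n" for u r' m'
  proof (rule runs_weaken)
    show "runs (For 0 3 12 1 relax) (r', m') (n * (8 + 3) + 3) (I u n)"
    proof (rule runs_For)
      fix k and r'' m'' :: "nat \<Rightarrow> nat"
      assume *: "k < n" "I u k r'' m''" "r'' 12 = k"
        "\<And>x. x \<noteq> 12 \<Longrightarrow> x \<noteq> 3 \<Longrightarrow> x \<notin> writes relax \<Longrightarrow> r'' x = r' x"
      then show "runs relax (r'', m'') 8 (I u (Suc k))"
        using u r' by (intro step) (auto simp: writes_relax)
    qed (use I r' in \<open>auto simp: writes_relax I_def\<close>)
    fix r'' m'' :: "nat \<Rightarrow> nat" assume I: "I u n r'' m''"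
    have "y < n" if "(x, y) \<in> ?E" for x y using that by (simp add: arcs_at_def)
    then show "I (Suc u) 0 r'' m''" using I by (auto simp: I_def less_Suc_eq algebra_simps)
  qed simp
  have "runs (For 0 3 14 1 (For 0 3 12 1 relax)) (r(15 := 1), m)
      (n * (n * (8 + 3) + 3 + 3) + 3) (I n 0)"
  proof (rule runs_For[where I = "\<lambda>u. I u 0"])
    fix k and r'' m'' :: "nat \<Rightarrow> nat"
    assume *: "k < n" "I k 0 r'' m''" "r'' 14 = k"
      "\<And>x. x \<noteq> 14 \<Longrightarrow> x \<noteq> 3 \<Longrightarrow> x \<notin> writes (For 0 3 12 1 relax) \<Longrightarrow> r'' x = (r(15 := 1)) x"
    then show "runs (For 0 3 12 1 relax) (r'', m'') (n * (8 + 3) + 3) (I (Suc k) 0)"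
      using regs by (intro row) (auto simp: writes_relax)
  qed (use regs inv in \<open>auto simp: writes_relax I_def\<close>)
  then have "runs round_prog (r, m) (round_time n) (I n 0)"
    unfolding round_prog_def round_time_def by (rule runs_step)
  then show ?thesis
  proof (rule runs_weaken)
    fix r'' m'' :: "nat \<Rightarrow> nat" assume I: "I n 0 r'' m''"
    have "x < n" if "(x, y) \<in> ?E" for x y using that by (simp add: arcs_at_def)
    then show "flood_inv n B m0 (M \<union> ?E `` M) C m''"
      using I by (auto simp: I_def flood_inv_def)
  qed simp
qed

fun layers :: "('a \<times> 'a) set \<Rightarrow> 'a \<Rightarrow> nat \<Rightarrow> 'a set" where
  "layers E s 0 = {s}"
| "layers E s (Suc k) = layers E s k \<union> E `` layers E s k"

lemma layers_mono: "j \<le> k \<Longrightarrow> layers E s j \<subseteq> layers E s k"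
  by (induction k rule: dec_induct) auto

lemma relpow_layers: "(s, y) \<in> E ^^ k \<Longrightarrow> y \<in> layers E s k"
  by (induction k arbitrary: y) auto

lemma reachable_layers:
  assumes "finite E" "card E \<le> k"
  shows "E\<^sup>* `` {s} \<subseteq> layers E s k"
proof
  fix y assume "y \<in> E\<^sup>* `` {s}"
  then have "(s, y) \<in> E\<^sup>*" by simp
  then obtain j where "j \<le> card E" "(s, y) \<in> E ^^ j"
    unfolding rtrancl_finite_eq_relpow[OF assms(1)] by auto
  then show "y \<in> layers E s k"
    using relpow_layers[of s y j E] layers_mono[of j k E s] assms(2) by auto
qed

lemma arcs_at_subset: "arcs_at n m \<subseteq> {..<n} \<times> {..<n}"
  by (auto simp: arcs_at_def)

lemma card_arcs_at: "finite (arcs_at n m)" "card (arcs_at n m) \<le> n * n"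
  using finite_subset[OF arcs_at_subset] card_mono[OF _ arcs_at_subset[of n m]]
  by (auto simp: card_cartesian_product)

lemma arcs_at_agree:
  assumes "agree B m m'" "n * n < B"
  shows "arcs_at n m' = arcs_at n m"
proof -
  have "m' (Suc (u * n + v)) = m (Suc (u * n + v))" if "u < n" "v < n" for u v
    using assms cell_less[OF that] by (simp add: agree_def)
  then show ?thesis by (auto simp: arcs_at_def)
qed

definition reach_time :: "nat \<Rightarrow> nat" where
  "reach_time n = (n * (2 + 3) + 3) + (2 + ((n * n * (round_time n + 3) + 3) + 2))"

lemma runs_reach:
  assumes regs: "r 0 = 1" "r 1 = n" "r 2 = n * n" "r 4 = B" "r 9 = 0" "r 10 = s" "r 11 = t"
    and B: "n * n < B" and s: "s < n" and t: "t < n"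
  shows "runs reach_prog (r, m) (reach_time n)
    (\<lambda>r' m'. (r' 19 \<noteq> 0 \<longleftrightarrow> (s, t) \<in> (arcs_at n m)\<^sup>*) \<and> agree B m m')"
proof -
  let ?E = "arcs_at n m"
  let ?C = "?E\<^sup>* `` {s}"
  have closed: "v \<in> ?C" if "(u, v) \<in> ?E" "u \<in> ?C" for u v
    using that rtrancl_into_rtrancl[of s u ?E v] by simp
  have clear: "runs (For 0 3 12 1 (Seq (Add 16 4 12) (Store 16 9))) (r, m) (n * (2 + 3) + 3)
      (\<lambda>r' m'. agree B m m' \<and> (\<forall>v<n. m' (B + v) = 0))"
  proof (rule runs_For[where I = "\<lambda>k r' m'. agree B m m' \<and> (\<forall>v<k. m' (B + v) = 0)"])
    fix k and r' m' :: "nat \<Rightarrow> nat"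
    assume *: "k < n" "agree B m m' \<and> (\<forall>v<k. m' (B + v) = 0)" "r' 12 = k"
      "\<And>x. x \<noteq> 12 \<Longrightarrow> x \<noteq> 3 \<Longrightarrow> x \<notin> writes (Seq (Add 16 4 12) (Store 16 9)) \<Longrightarrow> r' x = r x"
    then have "r' 4 = B" "r' 9 = 0" using regs by auto
    then have "runs (Seq (Add 16 4 12) (Store 16 9)) (r', m') (Suc 1)
        (\<lambda>r' m'. agree B m m' \<and> (\<forall>v<Suc k. m' (B + v) = 0))"
      using * by (intro runs_step runs_atom) (auto simp: agree_def less_Suc_eq)
    then show "runs (Seq (Add 16 4 12) (Store 16 9)) (r', m') 2
        (\<lambda>r' m'. agree B m m' \<and> (\<forall>v<Suc k. m' (B + v) = 0))"
      by (simp add: numeral_2_eq_2)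
  qed (use regs in \<open>auto simp: agree_def\<close>)
  have rounds: "runs (For 0 3 13 2 round_prog) (r', m') (n * n * (round_time n + 3) + 3)
      (\<lambda>r' m'. flood_inv n B m (layers ?E s (n * n)) ?C m')"
    if r': "r' 0 = 1" "r' 1 = n" "r' 2 = n * n" "r' 4 = B" and inv: "flood_inv n B m {s} ?C m'"
    for r' m'
  proof (rule runs_For[where I = "\<lambda>k r' m'. flood_inv n B m (layers ?E s k) ?C m'"])
    fix k and r'' m'' :: "nat \<Rightarrow> nat"
    assume *: "flood_inv n B m (layers ?E s k) ?C m''"
      "\<And>x. x \<noteq> 13 \<Longrightarrow> x \<noteq> 3 \<Longrightarrow> x \<notin> writes round_prog \<Longrightarrow> r'' x = r' x"
    show "runs round_prog (r'', m'') (round_time n) (\<lambda>r' m'. flood_inv n B m (layers ?E s (Suc k)) ?C m')"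
      unfolding layers.simps using * r' B
      by (intro runs_round[OF _ _ _ _ _ closed]) (simp_all add: writes_round)
  qed (use r' inv in \<open>simp_all add: writes_round\<close>)
  show ?thesis
    unfolding reach_prog_def reach_time_def
  proof (rule runs_Seq[OF clear])
    fix r1 m1
    assume m1: "agree B m m1 \<and> (\<forall>v<n. m1 (B + v) = 0)"
      and f: "frame (For 0 3 12 1 (Seq (Add 16 4 12) (Store 16 9))) r r1"
    let ?r2 = "r1(16 := r1 4 + r1 10)"
    let ?m2 = "m1(B + s := 1)"
    have r1: "r1 0 = 1" "r1 1 = n" "r1 2 = n * n" "r1 4 = B" "r1 10 = s" "r1 11 = t"
      using regs by (simp_all add: frameD[OF f])
    have "flood_inv n B m {s} ?C ?m2"
      using m1 s by (auto simp: flood_inv_def agree_def marks_def)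
    then have "runs (For 0 3 13 2 round_prog) (?r2, ?m2) (n * n * (round_time n + 3) + 3)
        (\<lambda>r' m'. flood_inv n B m (layers ?E s (n * n)) ?C m')"
      using r1 by (intro rounds) auto
    then have "runs (Seq (For 0 3 13 2 round_prog) (Seq (Add 16 4 11) (Load 19 16))) (?r2, ?m2)
        ((n * n * (round_time n + 3) + 3) + 2)
        (\<lambda>r' m'. (r' 19 \<noteq> 0 \<longleftrightarrow> (s, t) \<in> ?E\<^sup>*) \<and> agree B m m')"
    proof (rule runs_Seq)
      fix r3 m3
      assume inv: "flood_inv n B m (layers ?E s (n * n)) ?C m3" and f3: "frame (For 0 3 13 2 round_prog) ?r2 r3"
      have r3: "r3 4 = B" "r3 11 = t" using r1 by (simp_all add: frameD[OF f3] writes_round)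
      \<comment> \<open>After \<open>n * n\<close> rounds the lower and the upper bound of the
        invariant coincide.\<close>
      have "marks n B m3 = ?C"
        using inv reachable_layers[OF card_arcs_at, of n m s] by (auto simp: flood_inv_def)
      then have "m3 (B + t) \<noteq> 0 \<longleftrightarrow> (s, t) \<in> ?E\<^sup>*" using t by (auto simp: marks_def)
      then have "runs (Seq (Add 16 4 11) (Load 19 16)) (r3, m3) (Suc 1)
          (\<lambda>r' m'. (r' 19 \<noteq> 0 \<longleftrightarrow> (s, t) \<in> ?E\<^sup>*) \<and> agree B m m')"
        using inv r3 by (intro runs_step runs_atom) (auto simp: flood_inv_def)
      then show "runs (Seq (Add 16 4 11) (Load 19 16)) (r3, m3) 2
          (\<lambda>r' m'. (r' 19 \<noteq> 0 \<longleftrightarrow> (s, t) \<in> ?E\<^sup>*) \<and> agree B m m')"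
        by (simp add: numeral_2_eq_2)
    qed
    then have "runs (Seq (Add 16 4 10) (Seq (Store 16 0)
        (Seq (For 0 3 13 2 round_prog) (Seq (Add 16 4 11) (Load 19 16))))) (r1, m1)
        (Suc (Suc ((n * n * (round_time n + 3) + 3) + 2)))
        (\<lambda>r' m'. (r' 19 \<noteq> 0 \<longleftrightarrow> (s, t) \<in> ?E\<^sup>*) \<and> agree B m m')"
      using r1 by (intro runs_step) simp
    then show "runs (Seq (Add 16 4 10) (Seq (Store 16 0)
        (Seq (For 0 3 13 2 round_prog) (Seq (Add 16 4 11) (Load 19 16))))) (r1, m1)
        (2 + ((n * n * (round_time n + 3) + 3) + 2))
        (\<lambda>r' m'. (r' 19 \<noteq> 0 \<longleftrightarrow> (s, t) \<in> ?E\<^sup>*) \<and> agree B m m')"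
      by simp
  qed
qed

lemma agree_refl: "agree B m m"
  by (simp add: agree_def)

lemma agree_trans: "agree B m m' \<Longrightarrow> agree B m' m'' \<Longrightarrow> agree B m m''"
  by (simp add: agree_def)

lemma agree_upd: "agree B m m' \<Longrightarrow> agree B (m(a := x)) (m'(a := x))"
  by (simp add: agree_def)

section \<open>Testing whether an arc is critical\<close>

definition consts_ok :: "nat \<Rightarrow> (nat \<Rightarrow> nat) \<Rightarrow> bool" where
  "consts_ok n r \<longleftrightarrow> r 0 = 1 \<and> r 1 = n \<and> r 2 = n * n \<and> r 4 = Suc (n * n + n * n) \<and>
     r 5 = Suc (n * n) \<and> r 9 = 0"

text \<open>
  The fault cells range over \<open>0, \<dots>, n * n\<close>. Cell \<open>0\<close> is no arc, so that fault sets with fewer than two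
  arcs are covered as well.
\<close>

definition test_prog :: com where
  "test_prog =
     Seq (Load 28 26) (Seq (Store 26 9) (Seq (Load 29 27) (Seq (Store 27 9)
    (Seq reach_prog (Seq (Add 31 19 9) (Seq (Load 30 21) (Seq (Store 21 9)
    (Seq reach_prog (Seq (Store 21 30) (Seq (Store 27 29) (Seq (Store 26 28)
    (Cond 31 (Cond 19 Skip (Set_const 22 1)) Skip))))))))))))"

definition pair_prog :: com where
  "pair_prog = Seq (Load 32 25) (Seq (Cond 32 (For 0 3 26 5 (For 0 3 27 5 test_prog)) Skip) (Add 25 25 0))"

definition critical_prog :: com where
  "critical_prog = Seq (Add 25 2 0) (For 0 3 10 1 (For 0 3 11 1 pair_prog))"

definition arc_prog :: com where
  "arc_prog = Seq (Add 21 20 0) (Seq (Set_const 22 0) (Seq critical_prog (Cond 22 Skip (Store 21 9))))"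

text \<open>\<open>n * n\<close> is computed by repeated addition. \<open>Load 1 9\<close> reads
  cell \<open>0\<close>, because register 9 is never written and so holds its initial
  \<open>0\<close>.\<close>

definition prune_prog :: com where
  "prune_prog = Seq (Set_const 0 1) (Seq (Load 1 9) (Seq (For 0 3 12 1 (Add 2 2 1))
     (Seq (Add 5 2 0) (Seq (Add 4 2 5) (For 0 3 20 2 arc_prog)))))"

lemma writes_test: "x \<in> writes test_prog \<longleftrightarrow>
    x \<in> writes reach_prog \<or> x = 22 \<or> x = 28 \<or> x = 29 \<or> x = 30 \<or> x = 31"
  unfolding test_prog_def writes.simps Un_iff insert_iff empty_iff by argo

lemma writes_pair: "x \<in> writes pair_prog \<longleftrightarrow>
    x \<in> writes test_prog \<or> x = 3 \<or> x = 25 \<or> x = 26 \<or> x = 27 \<or> x = 32"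
  unfolding pair_prog_def writes.simps writes_For Un_iff insert_iff empty_iff by argo

lemma writes_critical: "x \<in> writes critical_prog \<longleftrightarrow>
    x \<in> writes pair_prog \<or> x = 3 \<or> x = 10 \<or> x = 11 \<or> x = 25"
  unfolding critical_prog_def writes.simps writes_For Un_iff insert_iff empty_iff by argo

lemma writes_arc: "x \<in> writes arc_prog \<longleftrightarrow> x \<in> writes critical_prog \<or> x = 21 \<or> x = 22"
  unfolding arc_prog_def writes.simps Un_iff insert_iff empty_iff by argo

lemmas writes_progs = writes_reach writes_test writes_pair writes_critical writes_arc

definition breaks :: "nat \<Rightarrow> (nat \<Rightarrow> nat) \<Rightarrow> nat \<Rightarrow> nat \<Rightarrow> nat \<Rightarrow> nat \<Rightarrow> nat \<Rightarrow> bool" where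
  "breaks n m a s t f g \<longleftrightarrow> (s, t) \<in> (arcs_at n (m(f := 0, g := 0)))\<^sup>* \<and>
     (s, t) \<notin> (arcs_at n (m(f := 0, g := 0, a := 0)))\<^sup>*"

lemma breaks_agree:
  assumes "agree B m m'" "n * n < B"
  shows "breaks n m' a s t f g \<longleftrightarrow> breaks n m a s t f g"
  unfolding breaks_def
  using arcs_at_agree[OF agree_upd[OF agree_upd[OF assms(1)]] assms(2)]
    arcs_at_agree[OF agree_upd[OF agree_upd[OF agree_upd[OF assms(1)]]] assms(2)]
  by simp

lemma ex_less_Suc_iff: "(\<exists>k<Suc n. P k) \<longleftrightarrow> (\<exists>k<n. P k) \<or> P n"
  by (auto simp: less_Suc_eq)

definition test_time :: "nat \<Rightarrow> nat" where
  "test_time n = 4 + (reach_time n + (3 + (reach_time n + 6)))"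

lemma runs_test:
  assumes c: "consts_ok n r" and B: "B = Suc (n * n + n * n)"
    and regs: "r 10 = s" "r 11 = t" "r 21 = a" "r 26 = f" "r 27 = g"
    and s: "s < n" and t: "t < n" and cells: "a < B" "f < B" "g < B"
  shows "runs test_prog (r, m) (test_time n)
    (\<lambda>r' m'. (r' 22 \<noteq> 0 \<longleftrightarrow> r 22 \<noteq> 0 \<or> breaks n m a s t f g) \<and> agree B m m')"
proof -
  let ?m = "m(f := 0, g := 0)"
  let ?Q = "\<lambda>r' m'. (r' 22 \<noteq> 0 \<longleftrightarrow> r 22 \<noteq> 0 \<or> breaks n m a s t f g) \<and> agree B m m'"
  let ?r0 = "r(28 := m f, 29 := (m(f := 0)) g)"
  let ?c3 = "Seq (Store 21 30) (Seq (Store 27 29) (Seq (Store 26 28)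
    (Cond 31 (Cond 19 Skip (Set_const 22 1)) Skip)))"
  let ?c2 = "Seq (Add 31 19 9) (Seq (Load 30 21) (Seq (Store 21 9) (Seq reach_prog ?c3)))"
  have nB: "n * n < B" using B by simp
  have r0: "?r0 0 = 1" "?r0 1 = n" "?r0 2 = n * n" "?r0 4 = B" "?r0 9 = 0" "?r0 10 = s" "?r0 11 = t"
    "?r0 21 = a" "?r0 26 = f" "?r0 27 = g"
    using c regs B by (simp_all add: consts_ok_def)
  have "runs (Seq reach_prog ?c2) (?r0, ?m) (reach_time n + (3 + (reach_time n + 6))) ?Q"
  proof (rule runs_Seq[OF runs_reach[OF r0(1-7) nB s t]])
    fix r1 m1
    assume 1: "(r1 19 \<noteq> 0 \<longleftrightarrow> (s, t) \<in> (arcs_at n ?m)\<^sup>*) \<and> agree B ?m m1" and f1: "frame reach_prog ?r0 r1"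
    have r1: "r1 0 = 1" "r1 1 = n" "r1 2 = n * n" "r1 4 = B" "r1 9 = 0" "r1 10 = s" "r1 11 = t"
      "r1 21 = a" "r1 26 = f" "r1 27 = g" "r1 28 = m f" "r1 29 = (m(f := 0)) g" "r1 22 = r 22"
      using r0 by (simp_all add: frameD[OF f1] writes_reach)
    let ?r2 = "r1(31 := r1 19, 30 := m1 a)"
    have r2: "?r2 0 = 1" "?r2 1 = n" "?r2 2 = n * n" "?r2 4 = B" "?r2 9 = 0" "?r2 10 = s" "?r2 11 = t"
      using r1 by simp_all
    have "runs (Seq reach_prog ?c3) (?r2, m1(a := 0)) (reach_time n + 6) ?Q"
    proof (rule runs_Seq[OF runs_reach[OF r2 nB s t]])
      fix r3 m3
      assume 3: "(r3 19 \<noteq> 0 \<longleftrightarrow> (s, t) \<in> (arcs_at n (m1(a := 0)))\<^sup>*) \<and> agree B (m1(a := 0)) m3"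
        and f3: "frame reach_prog ?r2 r3"
      have r3: "r3 9 = 0" "r3 21 = a" "r3 26 = f" "r3 27 = g" "r3 28 = m f" "r3 29 = (m(f := 0)) g"
        "r3 22 = r 22" "r3 31 = r1 19" "r3 30 = m1 a"
        using r1 by (simp_all add: frameD[OF f3] writes_reach)
      \<comment> \<open>Cells are restored in the reverse order of clearing. This matters when some
        of \<open>a\<close>, \<open>f\<close>, \<open>g\<close> coincide: the value saved first is
        the original one and is written back last.\<close>
      let ?m4 = "m3(a := m1 a, g := (m(f := 0)) g, f := m f)"
      have ag: "agree B m ?m4" using 1 3 cells by (simp add: agree_def)
      have "arcs_at n (m1(a := 0)) = arcs_at n (?m(a := 0))"
        using arcs_at_agree[OF agree_upd nB] 1 by blast
      then have br: "breaks n m a s t f g \<longleftrightarrow> r3 31 \<noteq> 0 \<and> r3 19 = 0"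
        using 1 3 r3 unfolding breaks_def by (cases "r3 19 = 0") simp_all
      have "runs (Cond 31 (Cond 19 Skip (Set_const 22 1)) Skip) (r3, ?m4)
          (Suc (max (Suc (max 1 1)) 1)) ?Q"
        using ag br r3(7) by (intro runs_Cond runs_atom) simp_all
      then have "runs ?c3 (r3, m3) (Suc (Suc (Suc (Suc (max (Suc (max 1 1)) 1))))) ?Q"
        using r3 by (intro runs_step) simp
      then show "runs ?c3 (r3, m3) 6 ?Q" by (rule runs_time) simp
    qed
    then have "runs ?c2 (r1, m1) (Suc (Suc (Suc (reach_time n + 6)))) ?Q"
      using r1 by (intro runs_step) simp
    then show "runs ?c2 (r1, m1) (3 + (reach_time n + 6)) ?Q" by (rule runs_time) simp
  qed
  then have "runs test_prog (r, m)
      (Suc (Suc (Suc (Suc (reach_time n + (3 + (reach_time n + 6))))))) ?Q"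
    using c regs unfolding test_prog_def consts_ok_def by (intro runs_step) simp
  then show ?thesis unfolding test_time_def by (rule runs_time) simp
qed

definition faults_time :: "nat \<Rightarrow> nat" where
  "faults_time n = Suc (n * n) * ((Suc (n * n) * (test_time n + 3) + 3) + 3) + 3"

definition pair_critical :: "nat \<Rightarrow> (nat \<Rightarrow> nat) \<Rightarrow> nat \<Rightarrow> nat \<Rightarrow> nat \<Rightarrow> bool" where
  "pair_critical n m a s t \<longleftrightarrow> m (Suc (n * n) + s * n + t) \<noteq> 0 \<and>
    (\<exists>f<Suc (n * n). \<exists>g<Suc (n * n). breaks n m a s t f g)"

lemma runs_faults:
  assumes c: "consts_ok n r" and B: "B = Suc (n * n + n * n)"
    and regs: "r 10 = s" "r 11 = t" "r 21 = a"
    and s: "s < n" and t: "t < n" and a: "a < B"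
  shows "runs (For 0 3 26 5 (For 0 3 27 5 test_prog)) (r, m) (faults_time n)
    (\<lambda>r' m'. (r' 22 \<noteq> 0 \<longleftrightarrow> r 22 \<noteq> 0 \<or>
        (\<exists>f<Suc (n * n). \<exists>g<Suc (n * n). breaks n m a s t f g)) \<and> agree B m m')"
proof -
  let ?N = "Suc (n * n)"
  have nB: "n * n < B" using B by simp
  have row: "runs (For 0 3 27 5 test_prog) (r', m') (?N * (test_time n + 3) + 3)
      (\<lambda>r'' m''. (r'' 22 \<noteq> 0 \<longleftrightarrow> r' 22 \<noteq> 0 \<or> (\<exists>g<?N. breaks n m a s t f g)) \<and> agree B m m'')"
    if r': "consts_ok n r'" "r' 10 = s" "r' 11 = t" "r' 21 = a" "r' 26 = f" "f < ?N" and m': "agree B m m'"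
    for r' m' f
  proof (rule runs_For[where I = "\<lambda>k r'' m''. (r'' 22 \<noteq> 0 \<longleftrightarrow> r' 22 \<noteq> 0 \<or>
      (\<exists>g<k. breaks n m a s t f g)) \<and> agree B m m''"])
    fix k and r'' m'' :: "nat \<Rightarrow> nat"
    assume k: "k < ?N" and I: "(r'' 22 \<noteq> 0 \<longleftrightarrow> r' 22 \<noteq> 0 \<or> (\<exists>g<k. breaks n m a s t f g)) \<and> agree B m m''"
      and r27: "r'' 27 = k" and fr: "\<And>x. x \<noteq> 27 \<Longrightarrow> x \<noteq> 3 \<Longrightarrow> x \<notin> writes test_prog \<Longrightarrow> r'' x = r' x"
    have c'': "consts_ok n r''" "r'' 10 = s" "r'' 11 = t" "r'' 21 = a" "r'' 26 = f"
      using r' unfolding consts_ok_def by (simp_all add: fr writes_progs)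
    have "f < B" "k < B" using \<open>f < ?N\<close> k B by simp_all
    from runs_test[OF c''(1) B c''(2-5) r27 s t a this]
    show "runs test_prog (r'', m'') (test_time n) (\<lambda>r'' m''. (r'' 22 \<noteq> 0 \<longleftrightarrow> r' 22 \<noteq> 0 \<or>
        (\<exists>g<Suc k. breaks n m a s t f g)) \<and> agree B m m'')"
    proof (rule runs_weaken)
      fix r3 m3 assume 3: "(r3 22 \<noteq> 0 \<longleftrightarrow> r'' 22 \<noteq> 0 \<or> breaks n m'' a s t f k) \<and> agree B m'' m3"
      have "breaks n m'' a s t f k \<longleftrightarrow> breaks n m a s t f k" using I nB by (intro breaks_agree) auto
      then show "(r3 22 \<noteq> 0 \<longleftrightarrow> r' 22 \<noteq> 0 \<or> (\<exists>g<Suc k. breaks n m a s t f g)) \<and> agree B m m3"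
        using 3 I agree_trans[of B m m'' m3] by (simp add: ex_less_Suc_iff disj_assoc)
    qed simp
  qed (use r' m' in \<open>simp_all add: consts_ok_def writes_progs\<close>)
  show ?thesis unfolding faults_time_def
  proof (rule runs_For[where I = "\<lambda>k r'' m''. (r'' 22 \<noteq> 0 \<longleftrightarrow> r 22 \<noteq> 0 \<or>
      (\<exists>f<k. \<exists>g<?N. breaks n m a s t f g)) \<and> agree B m m''"])
    fix k and r'' m'' :: "nat \<Rightarrow> nat"
    assume k: "k < ?N" and I: "(r'' 22 \<noteq> 0 \<longleftrightarrow> r 22 \<noteq> 0 \<or>
        (\<exists>f<k. \<exists>g<?N. breaks n m a s t f g)) \<and> agree B m m''"
      and r26: "r'' 26 = k"
      and fr: "\<And>x. x \<noteq> 26 \<Longrightarrow> x \<noteq> 3 \<Longrightarrow> x \<notin> writes (For 0 3 27 5 test_prog) \<Longrightarrow> r'' x = r x"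
    have c'': "consts_ok n r''" "r'' 10 = s" "r'' 11 = t" "r'' 21 = a"
      using c regs unfolding consts_ok_def by (simp_all add: fr writes_progs)
    have "agree B m m''" using I by simp
    from row[OF c'' r26 k this]
    show "runs (For 0 3 27 5 test_prog) (r'', m'') (?N * (test_time n + 3) + 3)
      (\<lambda>r'' m''. (r'' 22 \<noteq> 0 \<longleftrightarrow> r 22 \<noteq> 0 \<or>
        (\<exists>f<Suc k. \<exists>g<?N. breaks n m a s t f g)) \<and> agree B m m'')"
      by (rule runs_weaken) (use I in \<open>simp_all add: ex_less_Suc_iff disj_assoc\<close>)
  qed (use c in \<open>simp_all add: consts_ok_def writes_progs agree_refl\<close>)
qed

definition pair_time :: "nat \<Rightarrow> nat" where
  "pair_time n = 3 + faults_time n"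

lemma pair_critical_agree:
  assumes "agree B m m'" "B = Suc (n * n + n * n)" "s < n" "t < n"
  shows "pair_critical n m' a s t \<longleftrightarrow> pair_critical n m a s t"
proof -
  have "Suc (n * n) + s * n + t < B" using cell_less[OF assms(3,4)] assms(2) by simp
  then have "m' (Suc (n * n) + s * n + t) = m (Suc (n * n) + s * n + t)"
    using assms(1) unfolding agree_def by blast
  moreover have "n * n < B" using assms(2) by simp
  note breaks_agree[OF assms(1) this]
  ultimately show ?thesis unfolding pair_critical_def by simp
qed

lemma runs_pair:
  assumes c: "consts_ok n r" and B: "B = Suc (n * n + n * n)"
    and regs: "r 10 = s" "r 11 = t" "r 21 = a" "r 25 = Suc (n * n) + s * n + t"
    and s: "s < n" and t: "t < n" and a: "a < B"
  shows "runs pair_prog (r, m) (pair_time n)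
    (\<lambda>r' m'. r' 25 = Suc (n * n) + s * n + Suc t \<and>
      (r' 22 \<noteq> 0 \<longleftrightarrow> r 22 \<noteq> 0 \<or> pair_critical n m a s t) \<and> agree B m m')"
proof -
  let ?r = "r(32 := m (r 25))"
  let ?F = "For 0 3 26 5 (For 0 3 27 5 test_prog)"
  let ?R = "\<lambda>r' m'. (r' 22 \<noteq> 0 \<longleftrightarrow> r 22 \<noteq> 0 \<or> pair_critical n m a s t) \<and> agree B m m'"
  have cell: "?r 32 = m (Suc (n * n) + s * n + t)" using regs by simp
  have c': "consts_ok n ?r" "?r 10 = s" "?r 11 = t" "?r 21 = a"
    using c regs by (simp_all add: consts_ok_def)
  have "runs (Cond 32 ?F Skip) (?r, m) (Suc (max (faults_time n) 1)) ?R"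
  proof (rule runs_Cond)
    assume "?r 32 \<noteq> 0"
    with cell show "runs ?F (?r, m) (faults_time n) ?R"
      by (intro runs_weaken[OF runs_faults[OF c'(1) B c'(2-4) s t a]]) (simp_all add: pair_critical_def)
  next
    assume "?r 32 = 0"
    with cell show "runs Skip (?r, m) 1 ?R" by (intro runs_atom) (simp add: pair_critical_def agree_refl)
  qed
  then have "runs (Seq (Cond 32 ?F Skip) (Add 25 25 0)) (?r, m) (Suc (max (faults_time n) 1) + 1)
    (\<lambda>r' m'. r' 25 = Suc (n * n) + s * n + Suc t \<and> ?R r' m')"
  proof (rule runs_Seq)
    fix r' m' assume R: "?R r' m'" and f: "frame (Cond 32 ?F Skip) ?r r'"
    have "r' 25 = Suc (n * n) + s * n + t" "r' 0 = 1"
      using c regs by (simp_all add: frameD[OF f] writes_progs consts_ok_def)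
    then show "runs (Add 25 25 0) (r', m') 1 (\<lambda>r' m'. r' 25 = Suc (n * n) + s * n + Suc t \<and> ?R r' m')"
      using R by (intro runs_atom) simp
  qed
  then have "runs pair_prog (r, m) (Suc (Suc (max (faults_time n) 1) + 1))
    (\<lambda>r' m'. r' 25 = Suc (n * n) + s * n + Suc t \<and> ?R r' m')"
    unfolding pair_prog_def by (rule runs_step)
  then show ?thesis
    by (rule runs_time) (simp add: pair_time_def faults_time_def)
qed

definition critical :: "nat \<Rightarrow> (nat \<Rightarrow> nat) \<Rightarrow> nat \<Rightarrow> bool" where
  "critical n m a \<longleftrightarrow> (\<exists>s<n. \<exists>t<n. pair_critical n m a s t)"

lemma critical_agree:
  assumes "agree B m m'" "B = Suc (n * n + n * n)"
  shows "critical n m' a \<longleftrightarrow> critical n m a"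
  unfolding critical_def using pair_critical_agree[OF assms] by blast

definition critical_time :: "nat \<Rightarrow> nat" where
  "critical_time n = Suc (n * ((n * (pair_time n + 3) + 3) + 3) + 3)"

lemma runs_critical:
  assumes c: "consts_ok n r" and B: "B = Suc (n * n + n * n)" and regs: "r 21 = a" and a: "a < B"
  shows "runs critical_prog (r, m) (critical_time n)
    (\<lambda>r' m'. (r' 22 \<noteq> 0 \<longleftrightarrow> r 22 \<noteq> 0 \<or> critical n m a) \<and> agree B m m')"
proof -
  let ?p = "\<lambda>s t. Suc (n * n) + s * n + t"
  have row: "runs (For 0 3 11 1 pair_prog) (r', m') (n * (pair_time n + 3) + 3)
      (\<lambda>r'' m''. r'' 25 = ?p s n \<and> (r'' 22 \<noteq> 0 \<longleftrightarrow> r' 22 \<noteq> 0 \<or> (\<exists>t<n. pair_critical n m a s t)) \<and> agree B m m'')"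
    if r': "consts_ok n r'" "r' 10 = s" "r' 21 = a" "r' 25 = ?p s 0" "s < n" and m': "agree B m m'"
    for r' m' s
  proof (rule runs_For[where I = "\<lambda>k r'' m''. r'' 25 = ?p s k \<and> (r'' 22 \<noteq> 0 \<longleftrightarrow> r' 22 \<noteq> 0 \<or>
      (\<exists>t<k. pair_critical n m a s t)) \<and> agree B m m''"])
    fix k and r'' m'' :: "nat \<Rightarrow> nat"
    assume k: "k < n" and I: "r'' 25 = ?p s k \<and> (r'' 22 \<noteq> 0 \<longleftrightarrow> r' 22 \<noteq> 0 \<or>
        (\<exists>t<k. pair_critical n m a s t)) \<and> agree B m m''"
      and r11: "r'' 11 = k" and fr: "\<And>x. x \<noteq> 11 \<Longrightarrow> x \<noteq> 3 \<Longrightarrow> x \<notin> writes pair_prog \<Longrightarrow> r'' x = r' x"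
    have c'': "consts_ok n r''" "r'' 10 = s" "r'' 21 = a"
      using r' unfolding consts_ok_def by (simp_all add: fr writes_progs)
    have r25: "r'' 25 = ?p s k" using I by simp
    from runs_pair[OF c''(1) B c''(2) r11 c''(3) r25 \<open>s < n\<close> k a]
    show "runs pair_prog (r'', m'') (pair_time n) (\<lambda>r'' m''. r'' 25 = ?p s (Suc k) \<and>
        (r'' 22 \<noteq> 0 \<longleftrightarrow> r' 22 \<noteq> 0 \<or> (\<exists>t<Suc k. pair_critical n m a s t)) \<and> agree B m m'')"
    proof (rule runs_weaken)
      fix r3 m3 assume 3: "r3 25 = ?p s (Suc k) \<and>
        (r3 22 \<noteq> 0 \<longleftrightarrow> r'' 22 \<noteq> 0 \<or> pair_critical n m'' a s k) \<and> agree B m'' m3"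
      have "pair_critical n m'' a s k \<longleftrightarrow> pair_critical n m a s k"
        using I B \<open>s < n\<close> k by (intro pair_critical_agree) auto
      then show "r3 25 = ?p s (Suc k) \<and> (r3 22 \<noteq> 0 \<longleftrightarrow> r' 22 \<noteq> 0 \<or>
          (\<exists>t<Suc k. pair_critical n m a s t)) \<and> agree B m m3"
        using 3 I agree_trans[of B m m'' m3] by (simp add: ex_less_Suc_iff disj_assoc)
    qed simp
  qed (use r' m' in \<open>simp_all add: consts_ok_def writes_progs\<close>)
  let ?r = "r(25 := r 2 + r 0)"
  have "runs (For 0 3 10 1 (For 0 3 11 1 pair_prog)) (?r, m)
      (n * ((n * (pair_time n + 3) + 3) + 3) + 3)
      (\<lambda>r'' m''. r'' 25 = ?p n 0 \<and> (r'' 22 \<noteq> 0 \<longleftrightarrow> r 22 \<noteq> 0 \<or>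
        (\<exists>s<n. \<exists>t<n. pair_critical n m a s t)) \<and> agree B m m'')"
  proof (rule runs_For[where I = "\<lambda>k r'' m''. r'' 25 = ?p k 0 \<and> (r'' 22 \<noteq> 0 \<longleftrightarrow> r 22 \<noteq> 0 \<or>
        (\<exists>s<k. \<exists>t<n. pair_critical n m a s t)) \<and> agree B m m''"])
    fix k and r'' m'' :: "nat \<Rightarrow> nat"
    assume k: "k < n" and I: "r'' 25 = ?p k 0 \<and> (r'' 22 \<noteq> 0 \<longleftrightarrow> r 22 \<noteq> 0 \<or>
        (\<exists>s<k. \<exists>t<n. pair_critical n m a s t)) \<and> agree B m m''"
      and r10: "r'' 10 = k"
      and fr: "\<And>x. x \<noteq> 10 \<Longrightarrow> x \<noteq> 3 \<Longrightarrow> x \<notin> writes (For 0 3 11 1 pair_prog) \<Longrightarrow> r'' x = ?r x"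
    have c'': "consts_ok n r''" "r'' 21 = a"
      using c regs unfolding consts_ok_def by (simp_all add: fr writes_progs)
    have "r'' 25 = ?p k 0" "agree B m m''" using I by simp_all
    from row[OF c''(1) r10 c''(2) this(1) k this(2)]
    show "runs (For 0 3 11 1 pair_prog) (r'', m'') (n * (pair_time n + 3) + 3)
      (\<lambda>r'' m''. r'' 25 = ?p (Suc k) 0 \<and> (r'' 22 \<noteq> 0 \<longleftrightarrow> r 22 \<noteq> 0 \<or>
        (\<exists>s<Suc k. \<exists>t<n. pair_critical n m a s t)) \<and> agree B m m'')"
      by (rule runs_weaken) (use I in \<open>simp_all add: ex_less_Suc_iff disj_assoc\<close>)
  qed (use c in \<open>simp_all add: consts_ok_def writes_progs agree_refl\<close>)
  then have "runs critical_prog (r, m) (critical_time n)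
      (\<lambda>r'' m''. r'' 25 = ?p n 0 \<and> (r'' 22 \<noteq> 0 \<longleftrightarrow> r 22 \<noteq> 0 \<or>
        (\<exists>s<n. \<exists>t<n. pair_critical n m a s t)) \<and> agree B m m'')"
    unfolding critical_prog_def critical_time_def by (rule runs_step)
  then show ?thesis by (rule runs_weaken) (simp_all add: critical_def)
qed

section \<open>The greedy pass over the arcs\<close>

definition prune_step :: "nat \<Rightarrow> nat \<Rightarrow> (nat \<Rightarrow> nat) \<Rightarrow> nat \<Rightarrow> nat" where
  "prune_step n a m = (if critical n m a then m else m(a := 0))"

lemma prune_step_agree:
  assumes "agree B m m'" "B = Suc (n * n + n * n)"
  shows "agree B (prune_step n a m) (prune_step n a m')"
  unfolding prune_step_def critical_agree[OF assms] using agree_upd[OF assms(1)] assms(1) by simp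

lemma runs_arc:
  assumes c: "consts_ok n r" and B: "B = Suc (n * n + n * n)" and k: "r 20 = k" "k < n * n"
  shows "runs arc_prog (r, m) (critical_time n + 4) (\<lambda>r' m'. agree B (prune_step n (Suc k) m) m')"
proof -
  let ?r = "r(21 := r 20 + r 0, 22 := 0)"
  let ?Q = "\<lambda>r' m'. agree B (prune_step n (Suc k) m) m'"
  have c': "consts_ok n ?r" "?r 21 = Suc k" "Suc k < B"
    using c k B by (simp_all add: consts_ok_def)
  have "runs (Seq critical_prog (Cond 22 Skip (Store 21 9))) (?r, m) (critical_time n + Suc (max 1 1)) ?Q"
  proof (rule runs_Seq[OF runs_critical[OF c'(1) B c'(2,3)]])
    fix r' m'
    assume 1: "(r' 22 \<noteq> 0 \<longleftrightarrow> ?r 22 \<noteq> 0 \<or> critical n m (Suc k)) \<and> agree B m m'"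
      and f: "frame critical_prog ?r r'"
    have r': "r' 21 = Suc k" "r' 9 = 0"
      using c' by (simp_all add: frameD[OF f] writes_progs consts_ok_def)
    show "runs (Cond 22 Skip (Store 21 9)) (r', m') (Suc (max 1 1)) ?Q"
      using 1 r' agree_upd[of B m m' "Suc k" 0]
      by (intro runs_Cond runs_atom) (simp_all add: prune_step_def)
  qed
  then have "runs arc_prog (r, m) (Suc (Suc (critical_time n + Suc (max 1 1)))) ?Q"
    unfolding arc_prog_def by (intro runs_step)
  then show ?thesis by (rule runs_time) simp
qed

fun prune :: "nat \<Rightarrow> nat \<Rightarrow> (nat \<Rightarrow> nat) \<Rightarrow> nat \<Rightarrow> nat" where
  "prune n 0 m = m"
| "prune n (Suc k) m = prune_step n (Suc k) (prune n k m)"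

definition prune_time :: "nat \<Rightarrow> nat" where
  "prune_time n = 2 + ((n * (1 + 3) + 3) + (2 + (n * n * (critical_time n + 4 + 3) + 3)))"

lemma runs_prune:
  assumes n: "m 0 = n" and B: "B = Suc (n * n + n * n)"
  shows "runs prune_prog (\<lambda>_. 0, m) (prune_time n) (\<lambda>r' m'. agree B (prune n (n * n) m) m')"
proof -
  let ?Q = "\<lambda>r' m'. agree B (prune n (n * n) m) m'"
  let ?r = "(\<lambda>_. 0)(0 := 1, 1 := n) :: nat \<Rightarrow> nat"
  have "runs (For 0 3 12 1 (Add 2 2 1)) (?r, m) (n * (1 + 3) + 3) (\<lambda>r' m'. r' 2 = n * n \<and> m' = m)"
  proof (rule runs_For[where I = "\<lambda>k r' m'. r' 2 = k * n \<and> m' = m"])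
    fix k and r' m' :: "nat \<Rightarrow> nat"
    assume I: "r' 2 = k * n \<and> m' = m"
      and fr: "\<And>x. x \<noteq> 12 \<Longrightarrow> x \<noteq> 3 \<Longrightarrow> x \<notin> writes (Add 2 2 1) \<Longrightarrow> r' x = ?r x"
    have "r' 1 = n" by (simp add: fr)
    then show "runs (Add 2 2 1) (r', m') 1 (\<lambda>r' m'. r' 2 = Suc k * n \<and> m' = m)"
      using I by (intro runs_atom) simp
  qed simp_all
  then have "runs (Seq (For 0 3 12 1 (Add 2 2 1)) (Seq (Add 5 2 0) (Seq (Add 4 2 5) (For 0 3 20 2 arc_prog))))
      (?r, m) ((n * (1 + 3) + 3) + (2 + (n * n * (critical_time n + 4 + 3) + 3))) ?Q"
  proof (rule runs_Seq)
    fix r1 m1 assume 1: "r1 2 = n * n \<and> m1 = m" and f: "frame (For 0 3 12 1 (Add 2 2 1)) ?r r1"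
    let ?r2 = "r1(5 := r1 2 + r1 0, 4 := r1 2 + (r1 2 + r1 0))"
    have r1: "r1 0 = 1" "r1 1 = n" "r1 9 = 0" by (simp_all add: frameD[OF f])
    then have c: "consts_ok n ?r2" using 1 by (simp add: consts_ok_def)
    have "runs (For 0 3 20 2 arc_prog) (?r2, m) (n * n * (critical_time n + 4 + 3) + 3) ?Q"
    proof (rule runs_For[where I = "\<lambda>k r' m'. agree B (prune n k m) m'"])
      fix k and r' m' :: "nat \<Rightarrow> nat"
      assume k: "k < n * n" and I: "agree B (prune n k m) m'" and r20: "r' 20 = k"
        and fr: "\<And>x. x \<noteq> 20 \<Longrightarrow> x \<noteq> 3 \<Longrightarrow> x \<notin> writes arc_prog \<Longrightarrow> r' x = ?r2 x"
      have "consts_ok n r'" using c unfolding consts_ok_def by (simp add: fr writes_progs)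
      from runs_arc[OF this B r20 k]
      show "runs arc_prog (r', m') (critical_time n + 4) (\<lambda>r' m'. agree B (prune n (Suc k) m) m')"
        by (rule runs_weaken) (simp_all add: agree_trans[OF prune_step_agree[OF I B]])
    qed (use c in \<open>simp_all add: consts_ok_def writes_progs agree_refl\<close>)
    then have "runs (Seq (Add 5 2 0) (Seq (Add 4 2 5) (For 0 3 20 2 arc_prog))) (r1, m1)
        (Suc (Suc (n * n * (critical_time n + 4 + 3) + 3))) ?Q"
      using 1 by (intro runs_step) simp
    then show "runs (Seq (Add 5 2 0) (Seq (Add 4 2 5) (For 0 3 20 2 arc_prog))) (r1, m1)
        (2 + (n * n * (critical_time n + 4 + 3) + 3)) ?Q" by (rule runs_time) simp
  qed
  then have "runs prune_prog (\<lambda>_. 0, m)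
      (Suc (Suc ((n * (1 + 3) + 3) + (2 + (n * n * (critical_time n + 4 + 3) + 3))))) ?Q"
    unfolding prune_prog_def using n by (intro runs_step) simp
  then show ?thesis unfolding prune_time_def by (rule runs_time) simp
qed

section \<open>Correctness of the pruning program\<close>

text \<open>A set with at most one element, so that cells outside the arc matrix, such as cell
  \<open>0\<close>, act as empty faults.\<close>

definition cell_arcs :: "nat \<Rightarrow> nat \<Rightarrow> (nat \<times> nat) set" where
  "cell_arcs n c = {(u, v). u < n \<and> v < n \<and> c = Suc (u * n + v)}"

definition pairs_at :: "nat \<Rightarrow> (nat \<Rightarrow> nat) \<Rightarrow> (nat \<times> nat) set" where
  "pairs_at n m = {(s, t). s < n \<and> t < n \<and> m (Suc (n * n) + s * n + t) \<noteq> 0}"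

lemma arcs_at_delete: "arcs_at n (m(c := 0)) = arcs_at n m - cell_arcs n c"
  by (auto simp: arcs_at_def cell_arcs_def)

lemma cell_arcs_Suc:
  assumes "u < n" "v < n"
  shows "cell_arcs n (Suc (u * n + v)) = {(u, v)}"
proof -
  have "u' = u \<and> v' = v" if "u' < n" "v' < n" "u * n + v = u' * n + v'" for u' v'
  proof -
    have "(u * n + v) div n = u" "(u * n + v) mod n = v" using assms by auto
    moreover have "(u' * n + v') div n = u'" "(u' * n + v') mod n = v'" using that by auto
    ultimately show ?thesis using that(3) by simp
  qed
  then show ?thesis using assms by (auto simp: cell_arcs_def)
qed

lemma cell_arcs_cases: "cell_arcs n c = {} \<or> (\<exists>e. cell_arcs n c = {e})"
proof (cases "cell_arcs n c = {}")
  case False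
  then obtain u v where "u < n" "v < n" "c = Suc (u * n + v)" by (auto simp: cell_arcs_def)
  then show ?thesis using cell_arcs_Suc by blast
qed simp

lemma card_cell_arcs: "finite (cell_arcs n c)" "card (cell_arcs n c) \<le> 1"
  using cell_arcs_cases[of n c] by auto

lemma ex_cell:
  "\<exists>c<Suc (n * n). cell_arcs n c = {e} \<inter> {..<n} \<times> {..<n}"
proof (cases "e \<in> {..<n} \<times> {..<n}")
  case True
  then obtain u v where e: "e = (u, v)" "u < n" "v < n" by auto
  then show ?thesis
    using cell_less[OF e(2,3)] cell_arcs_Suc[OF e(2,3)] by (intro exI[of _ "Suc (u * n + v)"]) simp
next
  case False
  then show ?thesis by (intro exI[of _ 0]) (auto simp: cell_arcs_def)
qed

text \<open>Smaller sets are covered by repeating a cell or by using cell \<open>0\<close>, and the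
  latter also stands for pairs outside the vertex range.\<close>

lemma ex_two_cells:
  assumes "finite F" "card F \<le> 2"
  shows "\<exists>f<Suc (n * n). \<exists>g<Suc (n * n). cell_arcs n f \<union> cell_arcs n g = F \<inter> {..<n} \<times> {..<n}"
proof -
  consider "card F = 0" | "card F = 1" | "card F = 2" using assms(2) by linarith
  then show ?thesis
  proof cases
    case 1
    then have "F = {}" using assms(1) by simp
    then show ?thesis by (intro exI[of _ 0]) (auto simp: cell_arcs_def)
  next
    case 2
    then obtain x where F: "F = {x}" by (rule card_1_singletonE)
    obtain c where "c < Suc (n * n)" "cell_arcs n c = {x} \<inter> {..<n} \<times> {..<n}" using ex_cell by metis
    then show ?thesis unfolding F by (intro exI[of _ c] conjI) simp_all
  next
    case 3
    then obtain x y where F: "F = {x, y}" unfolding card_2_iff by metis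
    obtain c d where c: "c < Suc (n * n)" "cell_arcs n c = {x} \<inter> {..<n} \<times> {..<n}"
      and d: "d < Suc (n * n)" "cell_arcs n d = {y} \<inter> {..<n} \<times> {..<n}" using ex_cell by metis
    have "cell_arcs n c \<union> cell_arcs n d = F \<inter> {..<n} \<times> {..<n}" unfolding c d F by auto
    then show ?thesis using c(1) d(1) by metis
  qed
qed

lemma ex_breaks_iff:
  "(\<exists>f<Suc (n * n). \<exists>g<Suc (n * n). breaks n m a s t f g) \<longleftrightarrow>
   (\<exists>F. finite F \<and> card F \<le> 2 \<and> (s, t) \<in> (arcs_at n m - F)\<^sup>* \<and>
      (s, t) \<notin> (arcs_at n m - cell_arcs n a - F)\<^sup>*)" (is "?L \<longleftrightarrow> ?R")
proof -
  let ?A = "arcs_at n m"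
  let ?ok = "\<lambda>F. (s, t) \<in> (?A - F)\<^sup>* \<and> (s, t) \<notin> (?A - cell_arcs n a - F)\<^sup>*"
  have br: "breaks n m a s t f g \<longleftrightarrow> ?ok (cell_arcs n f \<union> cell_arcs n g)" for f g
  proof -
    have "arcs_at n (m(f := 0, g := 0)) = ?A - (cell_arcs n f \<union> cell_arcs n g)"
      unfolding arcs_at_delete by auto
    moreover have "arcs_at n (m(f := 0, g := 0, a := 0)) =
        ?A - cell_arcs n a - (cell_arcs n f \<union> cell_arcs n g)"
      unfolding arcs_at_delete by auto
    ultimately show ?thesis unfolding breaks_def by simp
  qed
  show ?thesis
  proof
    assume ?L
    then obtain f g where "breaks n m a s t f g" by metis
    moreover have "card (cell_arcs n f \<union> cell_arcs n g) \<le> 2"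
      using card_Un_le[of "cell_arcs n f" "cell_arcs n g"] card_cell_arcs(2)[of n f] card_cell_arcs(2)[of n g]
      by linarith
    ultimately show ?R unfolding br
      using card_cell_arcs(1) by (intro exI[of _ "cell_arcs n f \<union> cell_arcs n g"]) simp
  next
    assume ?R
    then obtain F where F: "finite F" "card F \<le> 2" "?ok F" by metis
    obtain f g where fg: "f < Suc (n * n)" "g < Suc (n * n)"
      "cell_arcs n f \<union> cell_arcs n g = F \<inter> {..<n} \<times> {..<n}"
      using ex_two_cells[OF F(1,2)] by metis
    have "?A - (F \<inter> {..<n} \<times> {..<n}) = ?A - F"
      "?A - cell_arcs n a - (F \<inter> {..<n} \<times> {..<n}) = ?A - cell_arcs n a - F"
      using arcs_at_subset[of n m] by auto
    then have "breaks n m a s t f g" unfolding br fg(3) using F(3) by simp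
    then show ?L using fg(1,2) by metis
  qed
qed

text \<open>Links the test, which runs over pairs of cells, to arbitrary fault sets; by
  \<open>ex_breaks_iff\<close> both detect the same failures.\<close>

lemma critical_iff:
  "critical n m a \<longleftrightarrow> \<not> preserves 2 (pairs_at n m) (arcs_at n m) (arcs_at n m - cell_arcs n a)"
  (is "_ \<longleftrightarrow> \<not> preserves 2 ?P ?A ?A'")
proof -
  have pc: "pair_critical n m a s t \<longleftrightarrow> (s, t) \<in> ?P \<and>
      (\<exists>F. finite F \<and> card F \<le> 2 \<and> (s, t) \<in> (?A - F)\<^sup>* \<and> (s, t) \<notin> (?A' - F)\<^sup>*)"
    if "s < n" "t < n" for s t
    using that unfolding pair_critical_def ex_breaks_iff pairs_at_def by simp
  show ?thesis
  proof
    assume "critical n m a"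
    then obtain s t F where "(s, t) \<in> ?P" "finite F" "card F \<le> 2" "(s, t) \<in> (?A - F)\<^sup>*"
      "(s, t) \<notin> (?A' - F)\<^sup>*"
      unfolding critical_def using pc by metis
    then show "\<not> preserves 2 ?P ?A ?A'" using preservesD by metis
  next
    assume np: "\<not> preserves 2 ?P ?A ?A'"
    show "critical n m a"
    proof (rule ccontr)
      assume nc: "\<not> critical n m a"
      have "preserves 2 ?P ?A ?A'"
      proof (rule preservesI)
        fix s t F assume st: "(s, t) \<in> ?P" and F: "finite F" "card F \<le> 2" "(s, t) \<in> (?A - F)\<^sup>*"
        have lt: "s < n" "t < n" using st by (simp_all add: pairs_at_def)
        then have "\<not> pair_critical n m a s t" using nc unfolding critical_def by metis
        then show "(s, t) \<in> (?A' - F)\<^sup>*" using pc[OF lt] st F by metis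
      qed simp
      with np show False ..
    qed
  qed
qed

lemma prune_cells:
  "prune n k m c = m c \<or> prune n k m c = 0"
  "c = 0 \<or> k < c \<Longrightarrow> prune n k m c = m c"
  by (induction k) (auto simp: prune_step_def)

text \<open>One pass is enough because a critical arc stays critical while other arcs are deleted:
  if it could be dropped from the smaller graph, transitivity and \<open>preserves_mono\<close>
  would allow dropping it from the larger one.\<close>

lemma prune_invariant:
  assumes "k \<le> n * n" and P_def: "P = pairs_at n m"
  shows "preserves 2 P (arcs_at n m) (arcs_at n (prune n k m)) \<and>
    (\<forall>u v. (u, v) \<in> arcs_at n (prune n k m) \<longrightarrow> u * n + v < k \<longrightarrow>
      \<not> preserves 2 P (arcs_at n (prune n k m)) (arcs_at n (prune n k m) - {(u, v)}))"
  using assms(1)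
proof (induction k)
  case 0
  show ?case by (simp add: preserves_refl)
next
  case (Suc k)
  let ?E = "arcs_at n (prune n k m)" and ?E' = "arcs_at n (prune n (Suc k) m)"
  have IH: "preserves 2 P (arcs_at n m) ?E"
    "\<And>u v. (u, v) \<in> ?E \<Longrightarrow> u * n + v < k \<Longrightarrow> \<not> preserves 2 P ?E (?E - {(u, v)})"
    using Suc by simp_all
  \<comment> \<open>Only cells \<open>1\<close> to \<open>k\<close> may have been cleared, and the
    pairs lie beyond cell \<open>n * n\<close>.\<close>
  have "prune n k m (Suc (n * n) + s * n + t) = m (Suc (n * n) + s * n + t)" for s t
    using Suc.prems by (intro prune_cells) simp
  then have P: "pairs_at n (prune n k m) = P" by (simp add: pairs_at_def P_def)
  have crit: "critical n (prune n k m) (Suc k) \<longleftrightarrow> \<not> preserves 2 P ?E (?E - cell_arcs n (Suc k))"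
    unfolding critical_iff P ..
  have E': "?E' = (if critical n (prune n k m) (Suc k) then ?E else ?E - cell_arcs n (Suc k))"
    by (simp add: prune_step_def arcs_at_delete)
  have pres: "preserves 2 P ?E ?E'" unfolding E' using crit by (simp add: preserves_refl)
  have "\<not> preserves 2 P ?E' (?E' - {(u, v)})" if uv: "(u, v) \<in> ?E'" "u * n + v < Suc k" for u v
  proof (cases "u * n + v = k")
    case True
    have lt: "u < n" "v < n" using uv(1) arcs_at_subset by fastforce+
    have "cell_arcs n (Suc k) = {(u, v)}" unfolding True[symmetric] by (rule cell_arcs_Suc[OF lt])
    then show ?thesis using uv(1) crit E' by (auto split: if_splits)
  next
    case False
    show ?thesis
    proof
      assume "preserves 2 P ?E' (?E' - {(u, v)})"
      then have "preserves 2 P ?E (?E' - {(u, v)})" by (rule preserves_trans[OF pres])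
      then have "preserves 2 P ?E (?E - {(u, v)})"
        by (rule preserves_mono) (use preserves_subset[OF pres] in auto)
      moreover have "(u, v) \<in> ?E" using uv(1) preserves_subset[OF pres] by auto
      ultimately show False using IH(2) False uv(2) by simp
    qed
  qed
  then show ?case using preserves_trans[OF IH(1) pres] by simp
qed

section \<open>From minimal preservers to the size bound and to \<open>ftrs\<close>\<close>

lemma card_minimal_preserver:
  assumes "finite V" "A \<subseteq> V \<times> V" "P \<subseteq> V \<times> V"
    and min: "\<And>e. e \<in> A \<Longrightarrow> \<not> preserves 2 P A (A - {e})"
  shows "real (card A) \<le> 536 * real (card V) powr (4/3) * real (card P) powr (1/3)"
proof -
  obtain H where H: "preserves 2 P A H"
    "real (card H) \<le> 536 * real (card V) powr (4/3) * real (card P) powr (1/3)"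
    using pairwise_preserver_size[OF assms(1-3)] by metis
  have "H = A"
  proof (rule ccontr)
    assume "H \<noteq> A"
    then obtain e where e: "e \<in> A" "e \<notin> H" using preserves_subset[OF H(1)] by auto
    have "preserves 2 P A (A - {e})"
      by (rule preserves_mono[OF H(1)]) (use e preserves_subset[OF H(1)] in auto)
    with min[OF e(1)] show False ..
  qed
  with H(2) show ?thesis by simp
qed

text \<open>\<open>reachable\<close> requires every vertex of a walk, even of the empty one, to
  belong to the graph; the assumptions provide this.\<close>

lemma reachable_with_proj_iff:
  assumes "parcs X \<subseteq> pverts X \<times> pverts X" "s \<in> pverts X"
  shows "reachable (with_proj X) s t \<longleftrightarrow> (s, t) \<in> (parcs X)\<^sup>*"
proof -
  have ends: "arcs_ends (with_proj X) = parcs X" by (auto simp: arcs_ends_def arc_to_ends_def)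
  have "(s, t) \<in> rtrancl_on (pverts X) (parcs X) \<longleftrightarrow> (s, t) \<in> (parcs X)\<^sup>*"
  proof
    assume "(s, t) \<in> rtrancl_on (pverts X) (parcs X)"
    then show "(s, t) \<in> (parcs X)\<^sup>*"
      by (induction rule: rtrancl_on.induct) (simp_all add: rtrancl.rtrancl_into_rtrancl)
  next
    assume "(s, t) \<in> (parcs X)\<^sup>*"
    then show "(s, t) \<in> rtrancl_on (pverts X) (parcs X)"
    proof (induction rule: rtrancl_induct)
      case (step y z)
      then have "z \<in> pverts X" using assms(1) by auto
      with step show ?case using rtrancl_on_into_rtrancl_on by metis
    qed (simp add: assms(2))
  qed
  then show ?thesis by (simp add: reachable_def ends)
qed

lemma ftrs_if_preserves:
  assumes G: "parcs G \<subseteq> pverts G \<times> pverts G" and P: "P \<subseteq> pverts G \<times> pverts G"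
    and H: "preserves k P (parcs G) A"
  shows "ftrs k G P \<lparr>pverts = pverts G, parcs = A\<rparr>"
proof -
  let ?H = "\<lparr>pverts = pverts G, parcs = A\<rparr>"
  have A: "A \<subseteq> parcs G" by (rule preserves_subset[OF H])
  have "wf_digraph (with_proj G)" "wf_digraph (with_proj ?H)"
    by (unfold_locales; use G A in auto)+
  then have "subgraph (with_proj ?H) (with_proj G)"
    using A by (auto simp: subgraph_def compatible_def)
  moreover have "reachable (with_proj (del_arcs G F)) s t \<longleftrightarrow> reachable (with_proj (del_arcs ?H F)) s t"
    if st: "(s, t) \<in> P" and F: "finite F" "card F \<le> k" for s t F
  proof -
    have s: "s \<in> pverts G" using st P by auto
    have "reachable (with_proj (del_arcs G F)) s t \<longleftrightarrow> (s, t) \<in> (parcs G - F)\<^sup>*"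
      using reachable_with_proj_iff[of "del_arcs G F" s t] G s by (auto simp: del_arcs_def)
    moreover have "reachable (with_proj (del_arcs ?H F)) s t \<longleftrightarrow> (s, t) \<in> (A - F)\<^sup>*"
      using reachable_with_proj_iff[of "del_arcs ?H F" s t] G A s by (auto simp: del_arcs_def)
    moreover have "(s, t) \<in> (parcs G - F)\<^sup>* \<longleftrightarrow> (s, t) \<in> (A - F)\<^sup>*"
    proof
      assume "(s, t) \<in> (parcs G - F)\<^sup>*"
      then show "(s, t) \<in> (A - F)\<^sup>*" by (rule preservesD[OF H st F])
    next
      assume "(s, t) \<in> (A - F)\<^sup>*"
      then show "(s, t) \<in> (parcs G - F)\<^sup>*" by (rule rtrancl_in_mono) (use A in auto)
    qed
    ultimately show ?thesis by simp
  qed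
  ultimately show ?thesis unfolding ftrs_def by auto
qed

section \<open>Running time and encoding\<close>

text \<open>Closed under sums and products, so the nested time bounds are seen to be polynomial
  without computing coefficients.\<close>

definition poly_fun :: "(nat \<Rightarrow> nat) \<Rightarrow> bool" where
  "poly_fun f \<longleftrightarrow> (\<exists>p. \<forall>x. poly p x = f x)"

lemma poly_fun_intros:
  "poly_fun (\<lambda>x. c)" "poly_fun (\<lambda>x. x)"
  "poly_fun f \<Longrightarrow> poly_fun g \<Longrightarrow> poly_fun (\<lambda>x. f x + g x)"
  "poly_fun f \<Longrightarrow> poly_fun g \<Longrightarrow> poly_fun (\<lambda>x. f x * g x)"
  "poly_fun f \<Longrightarrow> poly_fun (\<lambda>x. Suc (f x))"
proof -
  show "poly_fun (\<lambda>x. c)" unfolding poly_fun_def by (intro exI[of _ "[:c:]"]) simp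
  show "poly_fun (\<lambda>x. x)" unfolding poly_fun_def by (intro exI[of _ "[:0, 1:]"]) simp
  show "poly_fun f \<Longrightarrow> poly_fun g \<Longrightarrow> poly_fun (\<lambda>x. f x + g x)"
    unfolding poly_fun_def by (metis poly_add)
  show "poly_fun f \<Longrightarrow> poly_fun g \<Longrightarrow> poly_fun (\<lambda>x. f x * g x)"
    unfolding poly_fun_def by (metis poly_mult)
  show "poly_fun f \<Longrightarrow> poly_fun (\<lambda>x. Suc (f x))"
    unfolding poly_fun_def by (metis Suc_eq_plus1 poly_add poly_1)
qed

lemma poly_fun_prune_time: "poly_fun prune_time"
proof -
  have "poly_fun (\<lambda>n. prune_time n)"
    unfolding prune_time_def critical_time_def pair_time_def faults_time_def test_time_def
      reach_time_def round_time_def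
    by (intro poly_fun_intros)
  then show ?thesis .
qed

lemma poly_nat_mono: "x \<le> y \<Longrightarrow> poly p x \<le> poly p y" for x y :: nat
  by (induction p) (auto intro: mult_le_mono)

lemma length_le_input_size: "length xs \<le> input_size xs"
  unfolding input_size_def by (induction xs) auto

lemma length_concat_rows: "(\<And>u. length (f u) = n) \<Longrightarrow> length (concat (map f [0..<k])) = k * n"
  by (induction k) auto

lemma nth_concat_rows:
  assumes len: "\<And>u. length (f u) = n" and "u < k" "v < n"
  shows "concat (map f [0..<k]) ! (u * n + v) = f u ! v"
  using assms(2)
proof (induction k)
  case (Suc k)
  note l = length_concat_rows[of f n k, OF len]
  show ?case
  proof (cases "u = k")
    case True
    then show ?thesis using l by (simp add: nth_append)
  next
    case False
    then have "u < k" using Suc.prems by simp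
    moreover have "u * n + v < k * n"
    proof -
      have "u * n + v < Suc u * n" using assms(3) by simp
      also have "\<dots> \<le> k * n" using \<open>u < k\<close> by (intro mult_le_mono1) simp
      finally show ?thesis .
    qed
    ultimately show ?thesis using Suc.IH l by (simp add: nth_append)
  qed
qed simp

lemma length_rel_code: "length (rel_code n A) = n * n"
  unfolding rel_code_def by (subst length_concat_rows[of _ n]) simp_all

lemma nth_rel_code:
  "u < n \<Longrightarrow> v < n \<Longrightarrow> rel_code n A ! (u * n + v) = (if (u, v) \<in> A then 1 else 0)"
  unfolding rel_code_def by (subst nth_concat_rows) simp_all

lemma prune_correct:
  assumes EP: "E \<subseteq> {..<n} \<times> {..<n}" "P \<subseteq> {..<n} \<times> {..<n}"
  shows "\<exists>t s A. exec prune_prog (init_state (instance_code (n, E, P))) t s \<and> t \<le> prune_time n \<and>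
    outputs s (n # rel_code n A) \<and> preserves 2 P E A \<and>
    (\<forall>e \<in> A. \<not> preserves 2 P A (A - {e})) \<and> A \<subseteq> {..<n} \<times> {..<n}"
proof -
  define m where "m = snd (init_state (instance_code (n, E, P)))"
  define B where "B = Suc (n * n + n * n)"
  let ?m = "prune n (n * n) m"
  define A where "A = arcs_at n ?m"
  have init: "init_state (instance_code (n, E, P)) = (\<lambda>_. 0, m)"
    by (simp add: m_def init_state_def)
  have m0: "m 0 = n" by (simp add: m_def init_state_def instance_code_def)
  have mE: "m (Suc (u * n + v)) = (if (u, v) \<in> E then 1 else 0)" if "u < n" "v < n" for u v
    using cell_less[OF that] that
    by (simp add: m_def init_state_def instance_code_def nth_append length_rel_code nth_rel_code)
  have mP: "m (Suc (n * n) + s * n + t) = (if (s, t) \<in> P then 1 else 0)" if "s < n" "t < n" for s t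
    using cell_less[OF that] that
    by (simp add: m_def init_state_def instance_code_def nth_append length_rel_code nth_rel_code add.assoc)
  have E: "arcs_at n m = E" using EP mE by (auto simp: arcs_at_def split: if_splits)
  have P: "pairs_at n m = P" using EP mP by (auto simp: pairs_at_def split: if_splits)
  have inv: "preserves 2 P E A"
    "\<And>u v. (u, v) \<in> A \<Longrightarrow> u * n + v < n * n \<Longrightarrow> \<not> preserves 2 P A (A - {(u, v)})"
    using prune_invariant[of "n * n" n _ m, OF _ refl] by (simp_all add: A_def E P)
  have AV: "A \<subseteq> {..<n} \<times> {..<n}" unfolding A_def by (rule arcs_at_subset)
  have min: "\<not> preserves 2 P A (A - {e})" if "e \<in> A" for e
    using that inv(2)[of "fst e" "snd e"] AV cell_less[of "fst e" n "snd e"] by auto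
  have "runs prune_prog (\<lambda>_. 0, m) (prune_time n) (\<lambda>r' m'. agree B ?m m')"
    by (intro runs_prune m0 B_def)
  then obtain t r' m' where run: "exec prune_prog (\<lambda>_. 0, m) t (r', m')" "t \<le> prune_time n" "agree B ?m m'"
    unfolding runs_def by metis
  have "m' i = (n # rel_code n A) ! i" if i: "i < length (n # rel_code n A)" for i
  proof (cases i)
    case 0
    have "m' 0 = ?m 0" using run(3) by (simp add: agree_def B_def)
    also have "\<dots> = n" using prune_cells(2)[of 0 "n * n" n m] m0 by simp
    finally show ?thesis using 0 by simp
  next
    case (Suc j)
    then have j: "j < n * n" using i by (simp add: length_rel_code)
    define u v where "u = j div n" and "v = j mod n"
    have n: "n > 0" using j by (cases n) auto
    have uv: "u < n" "v < n" "j = u * n + v"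
      using j n by (simp_all add: u_def v_def less_mult_imp_div_less)
    have "m' (Suc j) = ?m (Suc j)" using run(3) j by (simp add: agree_def B_def)
    \<comment> \<open>The output must be exactly \<open>0\<close> or \<open>1\<close>: pruning never
      writes a nonzero value, so a surviving cell still holds its initial \<open>1\<close>.\<close>
    also have "\<dots> = (if (u, v) \<in> A then 1 else 0)"
      using prune_cells(1)[of n "n * n" m "Suc j"] mE[OF uv(1,2)] uv
      by (auto simp: A_def arcs_at_def split: if_splits)
    also have "\<dots> = rel_code n A ! j" using nth_rel_code[OF uv(1,2)] uv(3) by simp
    finally show ?thesis using Suc by simp
  qed
  then have "outputs (r', m') (n # rel_code n A)" by (simp add: outputs_def)
  then show ?thesis using run(1,2) inv(1) min AV init by metis
qed

theorem theorem1p5: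
  shows "\<exists>C :: real.
    (\<forall>(G :: 'a pair_pre_digraph) P.
       pair_fin_digraph G \<and> P \<subseteq> pverts G \<times> pverts G \<longrightarrow>
       (\<exists>H. ftrs 2 G P H \<and>
            real (card (parcs H))
              \<le> C * real (card (pverts G)) powr (4/3) * real (card P) powr (1/3))) \<and>
    poly_time_solvable graph_instances instance_code arcs_code
      (\<lambda>(n, E, P) A.
         ftrs 2 \<lparr>pverts = {..<n}, parcs = E\<rparr> P \<lparr>pverts = {..<n}, parcs = A\<rparr> \<and>
         real (card A) \<le> C * real n powr (4/3) * real (card P) powr (1/3))"
proof (intro exI[of _ 536] conjI allI impI)
  fix G :: "'a pair_pre_digraph" and P
  assume *: "pair_fin_digraph G \<and> P \<subseteq> pverts G \<times> pverts G"
  then interpret pair_fin_digraph G by simp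
  have G: "parcs G \<subseteq> pverts G \<times> pverts G" using in_arcsD1 in_arcsD2 by fastforce
  obtain A where A: "preserves 2 P (parcs G) A"
    "real (card A) \<le> 536 * real (card (pverts G)) powr (4/3) * real (card P) powr (1/3)"
    using pairwise_preserver_size[OF _ G, of P] * by auto
  show "\<exists>H. ftrs 2 G P H \<and> real (card (parcs H))
      \<le> 536 * real (card (pverts G)) powr (4/3) * real (card P) powr (1/3)"
    using ftrs_if_preserves[OF G _ A(1)] * A(2)
    by (intro exI[of _ "\<lparr>pverts = pverts G, parcs = A\<rparr>"]) simp
next
  obtain p where p: "\<And>x. poly p x = prune_time x" using poly_fun_prune_time unfolding poly_fun_def by metis
  show "poly_time_solvable graph_instances instance_code arcs_code
      (\<lambda>(n, E, P) A.
         ftrs 2 \<lparr>pverts = {..<n}, parcs = E\<rparr> P \<lparr>pverts = {..<n}, parcs = A\<rparr> \<and>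
         real (card A) \<le> 536 * real n powr (4/3) * real (card P) powr (1/3))"
    unfolding poly_time_solvable_def
  proof (intro exI[of _ prune_prog] exI[of _ p] ballI)
    fix i assume "i \<in> graph_instances"
    then obtain n E P where i: "i = (n, E, P)" and EP: "E \<subseteq> {..<n} \<times> {..<n}" "P \<subseteq> {..<n} \<times> {..<n}"
      by (auto simp: graph_instances_def)
    obtain t s A where run: "exec prune_prog (init_state (instance_code (n, E, P))) t s"
      "t \<le> prune_time n" "outputs s (n # rel_code n A)" and A: "preserves 2 P E A"
      "\<And>e. e \<in> A \<Longrightarrow> \<not> preserves 2 P A (A - {e})" "A \<subseteq> {..<n} \<times> {..<n}"
      using prune_correct[OF EP] by metis
    \<comment> \<open>The number \<open>n\<close> alone contributes only logarithmically many bits;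
      it is the \<open>n * n\<close> matrix entries that make the input size at least
      \<open>n\<close>.\<close>
    have "n \<le> n * n" by (cases n) simp_all
    also have "\<dots> \<le> length (instance_code (n, E, P))" by (simp add: instance_code_def length_rel_code)
    also have "\<dots> \<le> input_size (instance_code (n, E, P))" by (rule length_le_input_size)
    finally have "prune_time n \<le> poly p (input_size (instance_code (n, E, P)))"
      using poly_nat_mono[of n _ p] p by simp
    moreover have "ftrs 2 \<lparr>pverts = {..<n}, parcs = E\<rparr> P \<lparr>pverts = {..<n}, parcs = A\<rparr>"
      using ftrs_if_preserves[of "\<lparr>pverts = {..<n}, parcs = E\<rparr>" P 2 A] EP A(1) by simp
    moreover have "real (card A) \<le> 536 * real n powr (4/3) * real (card P) powr (1/3)"
      using card_minimal_preserver[of "{..<n}" A P] A EP by simp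
    ultimately show "\<exists>t s A. exec prune_prog (init_state (instance_code i)) t s \<and>
        t \<le> poly p (input_size (instance_code i)) \<and> outputs s (arcs_code i A) \<and>
        (case i of (n, E, P) \<Rightarrow> \<lambda>A.
          ftrs 2 \<lparr>pverts = {..<n}, parcs = E\<rparr> P \<lparr>pverts = {..<n}, parcs = A\<rparr> \<and>
          real (card A) \<le> 536 * real n powr (4/3) * real (card P) powr (1/3)) A"
      using run i by (intro exI[of _ t] exI[of _ s] exI[of _ A]) (simp add: arcs_code_def)
  qed
qed

end
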